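(* Let $V$ be a spectrally negative Lévy process which is not the opposite of a subordinator, let $V^{\uparrow}$ be $V$ conditioned to stay positive (starting from $0$), and let $I(V) := \int_0^{+\infty} e^{-V(t)}\,dt$ and $I(V^{\uparrow}) := \int_0^{+\infty} e^{-V^{\uparrow}(t)}\,dt$. If $V$ drifts to $+\infty$, then there is a positive constant $c$ such that for every $\epsilon>0$ and all $x>0$ small enough (depending on $\epsilon$), $$\mathbb{P}\left(I(V)\leq x\right) \leq \mathbb{P}\left(I(V^{\uparrow})\leq x\right) \leq \frac{\mathbb{P}\left(I(V)\leq(1+\epsilon)x\right)}{c\,\epsilon\,x}.$$
   Context: $V$ drifts to $\pm\infty$ means $V(t)\to\pm\infty$ almost surely as $t\to+\infty$. A spectrally negative Lévy process is a real-valued càdlàg Lévy process $V$ with $V(0)=0$ and no positive jumps. Its Laplace exponent $\Psi_V$ is given by $\mathbb{E}[e^{\lambda V(t)}] = e^{t\Psi_V(\lambda)}$ for $t,\lambda \geq 0$. If $V$ drifts to $-\infty$, $\kappa := \inf\{\lambda>0 : \Psi_V(\lambda)=0\}$; otherwise (in particular here) $\kappa := 0$. Write $V_x := x+V$. Scale function: $W:[0,+\infty[\to[0,+\infty[$ is the continuous increasing function with $\int_0^{+\infty} e^{-\lambda x}W(x)\,dx = 1/\Psi_V(\lambda)$ for all $\lambda>\kappa$. $V$ conditioned to stay positive: for $x>0$, $V^{\uparrow}_x$ is the Markov process started from $x$, with values in $]0,+\infty[$ and infinite lifetime, whose transition semigroup is $p^{\uparrow}_t(x,dy) := \frac{W(y)}{W(x)}\,\mathbb{P}\left(V_x(t)\in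 dy,\ \inf_{[0,t]}V_x>0\right)$. $V^{\uparrow}=V^{\uparrow}_0$ is the process started from $0$ obtained as the limit in distribution of $V^{\uparrow}_x$ as $x\to 0+$; it is a Feller process whose transition laws restricted to $]0,+\infty[$ are given by $p^{\uparrow}_t$. *)

theory Defs
  imports "HOL-Probability.Probability"
begin

text \<open>
  Processes are functions \<open>real \<Rightarrow> 'a \<Rightarrow> real\<close> (time, then sample point). Only the times
  \<open>t \<ge> 0\<close> matter: every notion below ignores the values at negative times.
\<close>

definition cadlag :: "(real \<Rightarrow> real) \<Rightarrow> bool" where
  "cadlag g \<longleftrightarrow> (\<forall>t\<ge>0. (g \<longlongrightarrow> g t) (at_right t)) \<and> (\<forall>t>0. \<exists>l. (g \<longlongrightarrow> l) (at_left t))"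

definition cadlag_process :: "'a measure \<Rightarrow> (real \<Rightarrow> 'a \<Rightarrow> real) \<Rightarrow> bool" where
  "cadlag_process M X \<longleftrightarrow>
     prob_space M \<and> (\<forall>t\<ge>0. X t \<in> borel_measurable M) \<and> (\<forall>\<omega>\<in>space M. cadlag (\<lambda>t. X t \<omega>))"

definition levy_process :: "'a measure \<Rightarrow> (real \<Rightarrow> 'a \<Rightarrow> real) \<Rightarrow> bool" where
  "levy_process M V \<longleftrightarrow>
     cadlag_process M V \<and>
     (AE \<omega> in M. V 0 \<omega> = 0) \<and>
     (\<forall>(n::nat) (t :: nat \<Rightarrow> real). 0 \<le> t 0 \<and> mono t \<longrightarrow>
        prob_space.indep_vars M (\<lambda>_. borel) (\<lambda>i \<omega>. V (t (Suc i)) \<omega> - V (t i) \<omega>) {..<n}) \<and>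
     (\<forall>s\<ge>0. \<forall>h\<ge>0. distr M borel (\<lambda>\<omega>. V (s + h) \<omega> - V s \<omega>) = distr M borel (V h))"

definition subordinator :: "'a measure \<Rightarrow> (real \<Rightarrow> 'a \<Rightarrow> real) \<Rightarrow> bool" where
  "subordinator M X \<longleftrightarrow> levy_process M X \<and> (AE \<omega> in M. mono_on {0..} (\<lambda>t. X t \<omega>))"

definition spectrally_negative_levy :: "'a measure \<Rightarrow> (real \<Rightarrow> 'a \<Rightarrow> real) \<Rightarrow> bool" where
  "spectrally_negative_levy M V \<longleftrightarrow>
     levy_process M V \<and>
     (AE \<omega> in M. \<forall>t>0. \<forall>l. ((\<lambda>s. V s \<omega>) \<longlongrightarrow> l) (at_left t) \<longrightarrow> V t \<omega> \<le> l)"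

definition drifts_to_plus_infinity :: "'a measure \<Rightarrow> (real \<Rightarrow> 'a \<Rightarrow> real) \<Rightarrow> bool" where
  "drifts_to_plus_infinity M V \<longleftrightarrow> (AE \<omega> in M. filterlim (\<lambda>t. V t \<omega>) at_top at_top)"

definition drifts_to_minus_infinity :: "'a measure \<Rightarrow> (real \<Rightarrow> 'a \<Rightarrow> real) \<Rightarrow> bool" where
  "drifts_to_minus_infinity M V \<longleftrightarrow> (AE \<omega> in M. filterlim (\<lambda>t. V t \<omega>) at_bot at_top)"

text \<open>
  The equation determines \<open>\<Psi>\<close> on \<open>{0..}\<close>. It also implies that the exponential moments are
  finite, because the Bochner integral of a non-integrable function is \<open>0\<close>.
\<close>

definition laplace_exponent ::
    "'a measure \<Rightarrow> (real \<Rightarrow> 'a \<Rightarrow> real) \<Rightarrow> (real \<Rightarrow> real) \<Rightarrow> bool" where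
  "laplace_exponent M V \<Psi> \<longleftrightarrow>
     (\<forall>t\<ge>0. \<forall>l\<ge>0. (\<integral>\<omega>. exp (l * V t \<omega>) \<partial>M) = exp (t * \<Psi> l))"

definition kappa :: "'a measure \<Rightarrow> (real \<Rightarrow> 'a \<Rightarrow> real) \<Rightarrow> (real \<Rightarrow> real) \<Rightarrow> real" where
  "kappa M V \<Psi> = (if drifts_to_minus_infinity M V then Inf {l. 0 < l \<and> \<Psi> l = 0} else 0)"

definition scale_function ::
    "'a measure \<Rightarrow> (real \<Rightarrow> 'a \<Rightarrow> real) \<Rightarrow> (real \<Rightarrow> real) \<Rightarrow> (real \<Rightarrow> real) \<Rightarrow> bool" where
  "scale_function M V \<Psi> W \<longleftrightarrow>
     (\<forall>x\<ge>0. 0 \<le> W x) \<and> continuous_on {0..} W \<and> mono_on {0..} W \<and>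
     (\<forall>l > kappa M V \<Psi>.
        set_integrable lborel {0..} (\<lambda>x. exp (- l * x) * W x) \<and>
        (LINT x:{0..}|lborel. exp (- l * x) * W x) = 1 / \<Psi> l)"

text \<open>
  The sub-probability measure \<open>P(V\<^sub>x(t) \<in> dy, inf V\<^sub>x > 0)\<close>, with the infimum over
  \<open>[0,t]\<close>. The infimum is a genuine one, since cadlag paths are bounded on \<open>[0,t]\<close>.
\<close>

definition killed_law :: "'a measure \<Rightarrow> (real \<Rightarrow> 'a \<Rightarrow> real) \<Rightarrow> real \<Rightarrow> real \<Rightarrow> real measure" where
  "killed_law M V t x =
     distr (density M (indicator {\<omega> \<in> space M. 0 < (INF s\<in>{0..t}. x + V s \<omega>)}))
       borel (\<lambda>\<omega>. x + V t \<omega>)"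

text \<open>
  The semigroup of \<open>V\<close> conditioned to stay positive, for \<open>x > 0\<close>. The killed law lives on
  \<open>{0<..}\<close>; the indicator only makes the density Borel, \<open>W\<close> being unspecified on \<open>{..<0}\<close>.
\<close>

definition up_kernel ::
    "'a measure \<Rightarrow> (real \<Rightarrow> 'a \<Rightarrow> real) \<Rightarrow> (real \<Rightarrow> real) \<Rightarrow> real \<Rightarrow> real \<Rightarrow> real measure" where
  "up_kernel M V W t x =
     density (killed_law M V t x) (\<lambda>y. ennreal (indicator {0<..} y * (W y / W x)))"

definition past :: "'b measure \<Rightarrow> (real \<Rightarrow> 'b \<Rightarrow> real) \<Rightarrow> real \<Rightarrow> 'b measure" where
  "past N X s = sigma (space N) (\<Union>u\<in>{0..s}. {X u -` B \<inter> space N |B. B \<in> sets borel})"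

text \<open>
  \<open>X\<close> is a cadlag Markov process with values in \<open>E\<close> (and infinite lifetime), started from
  \<open>x\<close>, with transition kernels \<open>P\<close>, relative to its natural filtration.
\<close>

definition markov_process ::
    "'b measure \<Rightarrow> (real \<Rightarrow> 'b \<Rightarrow> real) \<Rightarrow> real set \<Rightarrow> (real \<Rightarrow> real \<Rightarrow> real measure) \<Rightarrow> real \<Rightarrow> bool"
  where
  "markov_process N X E P x \<longleftrightarrow>
     cadlag_process N X \<and>
     (\<forall>t\<ge>0. \<forall>\<omega>\<in>space N. X t \<omega> \<in> E) \<and>
     (AE \<omega> in N. X 0 \<omega> = x) \<and>
     (\<forall>s\<ge>0. \<forall>t\<ge>0. \<forall>A\<in>sets borel.
        AE \<omega> in N. real_cond_exp N (past N X s) (\<lambda>\<omega>. indicator A (X (s + t) \<omega>)) \<omega>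
                     = measure (P t (X s \<omega>)) A)"

definition C0 :: "(real \<Rightarrow> real) \<Rightarrow> bool" where
  "C0 f \<longleftrightarrow> continuous_on {0..} f \<and> (f \<longlongrightarrow> 0) at_top"

definition feller_semigroup :: "(real \<Rightarrow> real \<Rightarrow> real measure) \<Rightarrow> bool" where
  "feller_semigroup Q \<longleftrightarrow>
     (\<forall>t\<ge>0. \<forall>x\<ge>0. prob_space (Q t x) \<and> sets (Q t x) = sets borel \<and> (AE y in Q t x. 0 \<le> y)) \<and>
     (let T = (\<lambda>t f x. LINT y:{0..}|Q t x. f y) in
        \<forall>f. C0 f \<longrightarrow>
          (\<forall>x\<ge>0. T 0 f x = f x) \<and>
          (\<forall>s\<ge>0. \<forall>t\<ge>0. \<forall>x\<ge>0. T (s + t) f x = T s (T t f) x) \<and>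
          (\<forall>t\<ge>0. C0 (T t f)) \<and>
          uniform_limit {0..} (\<lambda>t. T t f) f (at_right 0))"

text \<open>Convergence of sequences in the Skorokhod J1 topology of \<open>D([0,\<infinity>))\<close>.\<close>

definition skorokhod_lim :: "(nat \<Rightarrow> real \<Rightarrow> real) \<Rightarrow> (real \<Rightarrow> real) \<Rightarrow> bool" where
  "skorokhod_lim g h \<longleftrightarrow>
     (\<exists>r :: nat \<Rightarrow> real \<Rightarrow> real.
        (\<forall>n. bij_betw (r n) {0..} {0..} \<and> strict_mono_on {0..} (r n)) \<and>
        uniform_limit {0..} r (\<lambda>t. t) sequentially \<and>
        (\<forall>T\<ge>0. uniform_limit {0..T} (\<lambda>n t. g n (r n t)) h sequentially))"

text \<open>
  Bounded continuous functionals on \<open>D([0,\<infinity>))\<close>; as the J1 topology is metrizable, sequential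
  continuity is continuity. Such an \<open>F\<close> depends only on the path restricted to \<open>{0..}\<close>.
\<close>

definition bounded_continuous_functional :: "((real \<Rightarrow> real) \<Rightarrow> real) \<Rightarrow> bool" where
  "bounded_continuous_functional F \<longleftrightarrow>
     (\<exists>B. \<forall>g. cadlag g \<longrightarrow> \<bar>F g\<bar> \<le> B) \<and>
     (\<forall>g h. (\<forall>n. cadlag (g n)) \<and> cadlag h \<and> skorokhod_lim g h \<longrightarrow> (\<lambda>n. F (g n)) \<longlonglongrightarrow> F h)"

text \<open>
  \<open>U x\<close>, defined on the probability space \<open>N x\<close>, is \<open>V\<close> conditioned to stay positive and
  started from \<open>x\<close>, for every \<open>x \<ge> 0\<close>. The case \<open>x = 0\<close> is the limit in distribution as
  \<open>x\<close> tends to \<open>0\<close> from the right; this determines its law.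
\<close>

definition conditioned_to_stay_positive ::
    "'a measure \<Rightarrow> (real \<Rightarrow> 'a \<Rightarrow> real) \<Rightarrow> (real \<Rightarrow> real) \<Rightarrow>
     (real \<Rightarrow> 'b measure) \<Rightarrow> (real \<Rightarrow> real \<Rightarrow> 'b \<Rightarrow> real) \<Rightarrow> bool" where
  "conditioned_to_stay_positive M V W N U \<longleftrightarrow>
     (\<forall>x>0. markov_process (N x) (U x) {0<..} (up_kernel M V W) x) \<and>
     (\<forall>F. bounded_continuous_functional F \<longrightarrow>
        ((\<lambda>x. \<integral>\<omega>. F (\<lambda>t. U x t \<omega>) \<partial>N x) \<longlongrightarrow> (\<integral>\<omega>. F (\<lambda>t. U 0 t \<omega>) \<partial>N 0)) (at_right 0)) \<and>
     (\<exists>Q. feller_semigroup Q \<and> (\<forall>t\<ge>0. \<forall>x>0. Q t x = up_kernel M V W t x) \<and>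
        markov_process (N 0) (U 0) {0..} Q 0)"

text \<open>The exponential functional, with values in \<open>[0,\<infinity>]\<close>.\<close>

definition exp_functional :: "(real \<Rightarrow> 'a \<Rightarrow> real) \<Rightarrow> 'a \<Rightarrow> ennreal" where
  "exp_functional X \<omega> = (\<integral>\<^sup>+ t\<in>{0..}. ennreal (exp (- X t \<omega>)) \<partial>lborel)"

end

theory Submission
  imports Defs
begin

text \<open>
  For \<open>x > 0\<close> the process \<open>V\<^sup>\<up>\<^sub>x\<close> has infinite lifetime, so \<open>W\<close> is harmonic for \<open>V\<close> killed at
  \<open>0\<close>. As \<open>V\<close> drifts to \<open>+\<infinity>\<close>, this forces \<open>W\<close> to be bounded and \<open>W(x)\<close> to be proportional to
  \<open>P(inf V\<^sub>x > 0)\<close>; hence \<open>V\<^sup>\<up>\<^sub>x\<close> is \<open>V\<^sub>x\<close> conditioned on \<open>inf V\<^sub>x > 0\<close>, an event of positive probability.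

  Lower bound: if \<open>V\<close> is restarted at the first time it lies below \<open>-x\<close>, the exponential
  functional of the new process is not larger than that of \<open>V\<close>. Hence
  \<open>P(I(V) \<le> a) P(inf V > -x) \<le> P(I(V) \<le> a, inf V > -x)\<close>, that is, conditioning increases the
  probability of a small functional. Let \<open>x\<close> tend to \<open>0\<close>.

  Upper bound: a functional at most \<open>a\<close> forces the path above the level \<open>y\<close> before time
  \<open>a e\<^sup>y + 1\<close>, and \<open>V\<close> has no positive jumps, so on a fine time grid it is at most
  \<open>2 y\<close> when first seen above \<open>y\<close>. Restarting there gives
  \<open>P(I(V\<^sup>\<up>\<^sub>x) \<le> a) \<le> P(I(V) \<le> e\<^sup>2\<^sup>y a) / P(inf V > -y)\<close> for all \<open>x < y\<close>. Let \<open>x\<close> tend to \<open>0\<close> and take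
  \<open>e\<^sup>2\<^sup>y\<close> close to \<open>1 + \<epsilon>\<close>; the denominator does not depend on \<open>a\<close>.

  The passage to \<open>x = 0\<close> uses that \<open>\<integral>\<^sub>0\<^sup>T e\<^sup>-\<^sup>g\<^sup>(\<^sup>t\<^sup>) dt\<close> is continuous in \<open>g\<close> for the Skorokhod topology.
\<close>

section \<open>Cadlag paths\<close>

text \<open>Two tools are available only in weak form, and this shapes the proof. Independence of
  past and future, and the kernels of \<open>U x\<close>, refer to deterministic times. A first
  passage is therefore a first passage on a grid: these events are disjoint and each depends on the
  path up to a fixed time, so independence is applied to each and summed, and the mesh is refined
  afterwards. Likewise the laws of \<open>U x\<close> and \<open>V\<close> are compared on grids,
  and Riemann sums carry the comparison to the functional.

  Convergence as the starting point tends to 0 concerns bounded continuous functionals, so the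
  horizon is truncated and the indicator of a small value is replaced by a ramp between two
  thresholds. The lower bound lets the gap between them shrink while the horizon grows; the upper
  bound pays for it with a second factor \<open>exp (2 * y)\<close>, whence
  \<open>4 * y = ln (1 + \<epsilon>)\<close>. The probability of staying positive from
  \<open>z\<close> may vanish as \<open>z\<close> tends to 0, so it has to be cancelled for fixed
  \<open>z\<close>: this is why both inequalities are proved with it as a factor on each
  side.\<close>

lemma cadlag_local_right:
  assumes "cadlag g" "t \<ge> 0" "e > 0"
  obtains d where "d > 0" "\<And>s. t < s \<Longrightarrow> s < t + d \<Longrightarrow> \<bar>g s - g t\<bar> < e"
proof -
  have "(g \<longlongrightarrow> g t) (at_right t)"
    using assms by (auto simp: cadlag_def)
  then have "eventually (\<lambda>s. dist (g s) (g t) < e) (at_right t)"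
    using assms(3) by (auto simp: tendsto_iff)
  then obtain b where b: "b > t" "\<forall>s>t. s < b \<longrightarrow> dist (g s) (g t) < e"
    unfolding eventually_at_right_field by blast
  show thesis
    by (rule that[of "b - t"]) (use b in \<open>auto simp: dist_real_def\<close>)
qed

text \<open>At \<open>t = 0\<close> there are no times to the left and any \<open>d\<close> and
  \<open>l\<close> serve; including this case spares the callers a distinction. The last conclusion
  identifies \<open>l\<close> as the left limit when there is one.\<close>

lemma cadlag_local_left:
  assumes "cadlag g" "t \<ge> 0" "e > 0"
  obtains d l where "d > 0" "\<And>s. 0 \<le> s \<Longrightarrow> t - d < s \<Longrightarrow> s < t \<Longrightarrow> \<bar>g s - l\<bar> < (e::real)"
    "t > 0 \<Longrightarrow> (g \<longlongrightarrow> l) (at_left t)"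
proof (cases "t > 0")
  case True
  then obtain l where l: "(g \<longlongrightarrow> l) (at_left t)" using assms by (auto simp: cadlag_def)
  then have "eventually (\<lambda>s. dist (g s) l < e) (at_left t)"
    using assms by (auto simp: tendsto_iff)
  then obtain b where b: "b < t" "\<forall>s>b. s < t \<longrightarrow> dist (g s) l < e"
    unfolding eventually_at_left_field by blast
  show thesis
    by (rule that[of "t - b" l]) (use b l in \<open>auto simp: dist_real_def\<close>)
next
  case False
  then show thesis using assms by (intro that[of 1]) auto
qed

text \<open>One-sided limits bound the path near each point, on either side, and bisection glues the
  local bounds. The guard \<open>0 \<le> s\<close> in \<open>P\<close> is there because the small
  intervals around a point may reach below 0.\<close>

lemma cadlag_bounded:
  assumes g: "cadlag g" and T: "T \<ge> 0"
  obtains B where "\<And>s. 0 \<le> s \<Longrightarrow> s \<le> T \<Longrightarrow> \<bar>g s\<bar> \<le> B"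
proof -
  define P where "P a b \<longleftrightarrow> (\<exists>B. \<forall>s. 0 \<le> s \<and> a \<le> s \<and> s \<le> b \<longrightarrow> \<bar>g s\<bar> \<le> B)" for a b
  have "P 0 T"
    using T
  proof (induction rule: Bolzano)
    case (trans a b c)
    then obtain B1 B2 where B: "\<And>s. 0 \<le> s \<Longrightarrow> a \<le> s \<Longrightarrow> s \<le> b \<Longrightarrow> \<bar>g s\<bar> \<le> B1"
       "\<And>s. 0 \<le> s \<Longrightarrow> b \<le> s \<Longrightarrow> s \<le> c \<Longrightarrow> \<bar>g s\<bar> \<le> B2" unfolding P_def by auto
    have "\<bar>g s\<bar> \<le> max B1 B2" if "0 \<le> s" "a \<le> s" "s \<le> c" for s
      using B(1)[of s] B(2)[of s] that by (cases "s \<le> b") auto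
    then show ?case unfolding P_def by (intro exI[of _ "max B1 B2"]) auto
  next
    case (local x)
    obtain d1 where d1: "d1 > 0" "\<And>s. x < s \<Longrightarrow> s < x + d1 \<Longrightarrow> \<bar>g s - g x\<bar> < 1"
      using cadlag_local_right[OF g local(1) zero_less_one] by metis
    obtain d2 l where d2: "d2 > 0" "\<And>s. 0 \<le> s \<Longrightarrow> x - d2 < s \<Longrightarrow> s < x \<Longrightarrow> \<bar>g s - l\<bar> < 1"
      using cadlag_local_left[OF g local(1) zero_less_one] by metis
    show ?case
    proof (intro exI[of _ "min d1 d2"] conjI allI impI)
      fix a b assume ab: "a \<le> x \<and> x \<le> b \<and> b - a < min d1 d2"
      have "\<bar>g s\<bar> \<le> \<bar>g x\<bar> + \<bar>l\<bar> + 1" if "0 \<le> s" "a \<le> s" "s \<le> b" for s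
        using d1(2)[of s] d2(2)[of s] ab that by (cases s x rule: linorder_cases) auto
      then show "P a b" unfolding P_def by (intro exI) auto
    qed (use d1 d2 in auto)
  qed
  then show thesis using that unfolding P_def by auto
qed

text \<open>Near a point \<open>x\<close> the path is close to its left limit \<open>l\<close>
  before \<open>x\<close> and to \<open>g x \<le> l\<close> from \<open>x\<close> on, so crossing
  \<open>x\<close> cannot raise it by \<open>e\<close>. Compactness of \<open>{0..T}\<close> makes
  this uniform. Only upward increments are controlled; the path may still jump down.\<close>

lemma cadlag_no_positive_jumps_oscillation:
  assumes g: "cadlag g" and T: "T \<ge> 0" and e: "e > 0"
    and jump: "\<And>t l. t > 0 \<Longrightarrow> (g \<longlongrightarrow> l) (at_left t) \<Longrightarrow> g t \<le> l"
  obtains d where "d > 0"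
    "\<And>s t. 0 \<le> s \<Longrightarrow> s < t \<Longrightarrow> t \<le> T \<Longrightarrow> t - s < d \<Longrightarrow> g t - g s < e"
proof -
  have ex: "\<exists>d>0. \<forall>s t. 0 \<le> s \<and> x - d < s \<and> s < t \<and> t < x + d \<longrightarrow> g t - g s < e" if x: "x \<ge> 0" for x
  proof -
    obtain d1 where d1: "d1 > 0" "\<And>s. x < s \<Longrightarrow> s < x + d1 \<Longrightarrow> \<bar>g s - g x\<bar> < e/2"
      by (rule cadlag_local_right[OF g x, of "e/2"]) (use e in auto)
    obtain d2 l where d2: "d2 > 0" "\<And>s. 0 \<le> s \<Longrightarrow> x - d2 < s \<Longrightarrow> s < x \<Longrightarrow> \<bar>g s - l\<bar> < e/2"
        "x > 0 \<Longrightarrow> (g \<longlongrightarrow> l) (at_left x)"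
      by (rule cadlag_local_left[OF g x, of "e/2"]) (use e in auto)
    have l: "x > 0 \<Longrightarrow> g x \<le> l" using jump d2(3) by auto
    show ?thesis
    proof (intro exI[of _ "min d1 d2"] conjI allI impI)
      fix s t assume st: "0 \<le> s \<and> x - min d1 d2 < s \<and> s < t \<and> t < x + min d1 d2"
      then consider "t < x" | "s < x" "x \<le> t" | "x \<le> s" by linarith
      then show "g t - g s < e"
      proof cases
        case 1
        then have "\<bar>g s - l\<bar> < e/2" "\<bar>g t - l\<bar> < e/2" using d2(2) st by auto
        then show ?thesis by linarith
      next
        case 2
        then have "\<bar>g s - l\<bar> < e/2" "\<bar>g t - g x\<bar> < e/2" "g x \<le> l"
          using d2(2) d1(2)[of t] l st e by (auto simp: order_le_less)
        then show ?thesis by linarith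
      next
        case 3
        then have "\<bar>g s - g x\<bar> < e/2" "\<bar>g t - g x\<bar> < e/2"
          using d1(2)[of s] d1(2)[of t] st e by (auto simp: order_le_less)
        then show ?thesis by linarith
      qed
    qed (use d1 d2 in auto)
  qed
  have "\<forall>x. \<exists>d. x \<ge> 0 \<longrightarrow> d > 0 \<and> (\<forall>s t. 0 \<le> s \<and> x - d < s \<and> s < t \<and> t < x + d \<longrightarrow> g t - g s < e)"
    using ex by blast
  from choice[OF this] obtain d
    where d: "\<forall>x. x \<ge> 0 \<longrightarrow> d x > 0 \<and> (\<forall>s t. 0 \<le> s \<and> x - d x < s \<and> s < t \<and> t < x + d x \<longrightarrow> g t - g s < e)"
    by blast
  \<comment> \<open>A Lebesgue number of the cover: two times closer than \<open>\<epsilon>\<close>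
    lie in one common ball.\<close>
  obtain \<epsilon> where \<epsilon>: "0 < \<epsilon>" "\<And>x. x \<in> {0..T} \<Longrightarrow> \<exists>G\<in>(\<lambda>x. ball x (d x)) ` {0..T}. ball x \<epsilon> \<subseteq> G"
    by (rule Heine_Borel_lemma[of "{0..T}" "(\<lambda>x. ball x (d x)) ` {0..T}"]) (use d in auto)
  show thesis
  proof (rule that[OF \<epsilon>(1)])
    fix s t assume st: "0 \<le> s" "s < t" "t \<le> T" "t - s < \<epsilon>"
    then obtain x where x: "x \<in> {0..T}" "ball s \<epsilon> \<subseteq> ball x (d x)" using \<epsilon>(2)[of s] by auto
    have "s \<in> ball s \<epsilon>" "t \<in> ball s \<epsilon>"
      using st \<epsilon>(1) by (auto simp: dist_real_def)
    then have "s \<in> ball x (d x)" "t \<in> ball x (d x)"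
      using x(2) by blast+
    then have "x - d x < s" "t < x + d x"
      by (auto simp: dist_real_def abs_less_iff)
    then show "g t - g s < e"
      using d[THEN spec, of x] x(1) st by auto
  qed
qed

text \<open>Jumps of size at least \<open>e\<close> cannot accumulate, because near any point the
  one-sided limits confine the path on either side to a band of width \<open>2 * e / 3\<close>. They
  form a sparse, hence countable, set, and the sizes \<open>e = 1 / Suc n\<close> exhaust the
  discontinuities.\<close>

lemma cadlag_countable_discontinuities:
  assumes g: "cadlag g"
  shows "countable {t. t > 0 \<and> \<not> isCont g t}"
proof -
  define D where "D e = {t. t > 0 \<and> (\<exists>l. (g \<longlongrightarrow> l) (at_left t) \<and> \<bar>g t - l\<bar> \<ge> e)}" for e
  have "countable ({0<..} \<inter> D e)" if e: "e > 0" for e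
  proof (rule sparse_imp_countable)
    show "D e sparse_in {0<..}"
    proof (subst sparse_in_eventually_iff, simp, intro ballI)
      fix x :: real assume "x \<in> {0<..}"
      then have x: "x > 0" by simp
      \<comment> \<open>The left limit at \<open>s\<close> inherits the bound \<open>e / 3\<close>
        around \<open>c\<close>, non-strictly, so the jump at \<open>s\<close> stays below
        \<open>2 * e / 3\<close>.\<close>
      have small: "\<bar>g s - l\<bar> < e"
        if "(g \<longlongrightarrow> l) (at_left s)" "s > 0" "a < s" "\<And>r. a < r \<Longrightarrow> r \<le> s \<Longrightarrow> \<bar>g r - c\<bar> < e / 3" for a c l s
      proof -
        have "eventually (\<lambda>r. \<bar>g r - c\<bar> \<le> e/3) (at_left s)"
          using that(3,4) unfolding eventually_at_left_field by (auto intro!: exI[of _ a] less_imp_le)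
        moreover have "((\<lambda>r. \<bar>g r - c\<bar>) \<longlongrightarrow> \<bar>l - c\<bar>) (at_left s)"
          by (intro tendsto_intros that)
        ultimately have "\<bar>l - c\<bar> \<le> e/3"
          by (intro tendsto_upperbound[where F="at_left s"]) auto
        then show ?thesis using that(4)[of s] that(3) e by linarith
      qed
      obtain d1 where d1: "d1 > 0" "\<And>s. x < s \<Longrightarrow> s < x + d1 \<Longrightarrow> \<bar>g s - g x\<bar> < e/3"
        by (rule cadlag_local_right[OF g, of x "e/3"]) (use e x in auto)
      obtain d2 l where d2: "d2 > 0" "\<And>s. 0 \<le> s \<Longrightarrow> x - d2 < s \<Longrightarrow> s < x \<Longrightarrow> \<bar>g s - l\<bar> < e/3"
        by (rule cadlag_local_left[OF g, of x "e/3"]) (use e x in auto)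
      have "s \<notin> D e" if s: "s \<noteq> x" "dist s x < min x (min d1 d2)" for s
      proof
        assume "s \<in> D e"
        then obtain l' where l': "(g \<longlongrightarrow> l') (at_left s)" "\<bar>g s - l'\<bar> \<ge> e" "s > 0"
          by (auto simp: D_def)
        show False
        proof (cases "s < x")
          case True
          have s1: "max 0 (x - d2) < s"
            using s x True by (auto simp: dist_real_def)
          have "\<bar>g r - l\<bar> < e / 3" if "max 0 (x - d2) < r" "r \<le> s" for r
            using that True by (intro d2(2)) auto
          from small[OF l'(1,3) s1 this] show False using l'(2) by simp
        next
          case False
          have s1: "x < s" "s < x + d1"
            using s False by (auto simp: dist_real_def)
          have "\<bar>g r - g x\<bar> < e / 3" if "x < r" "r \<le> s" for r
            using that s1 by (intro d1(2)) auto
          from small[OF l'(1,3) s1(1) this] show False using l'(2) by simp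
        qed
      qed
      then show "eventually (\<lambda>s. s \<notin> D e) (at x)"
        unfolding eventually_at using x d1 d2 by (intro exI[of _ "min x (min d1 d2)"]) auto
    qed
  qed auto
  then have "countable (\<Union>n::nat. {0<..} \<inter> D (1 / Suc n))"
    by (intro countable_UN) auto
  moreover have "{t. t > 0 \<and> \<not> isCont g t} \<subseteq> (\<Union>n::nat. {0<..} \<inter> D (1 / Suc n))"
  proof safe
    fix t :: real assume t: "t > 0" "\<not> isCont g t"
    obtain l where l: "(g \<longlongrightarrow> l) (at_left t)" using g t by (auto simp: cadlag_def)
    moreover have r: "(g \<longlongrightarrow> g t) (at_right t)" using g t by (auto simp: cadlag_def)
    ultimately have "g t \<noteq> l"
      using t(2) filterlim_split_at by (auto simp: isCont_def)
    then obtain n where "1 / Suc n < \<bar>g t - l\<bar>"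
      using nat_approx_posE[of "\<bar>g t - l\<bar>"] by auto
    then show "t \<in> (\<Union>n::nat. {0<..} \<inter> D (1 / Suc n))"
      using t l by (auto simp: D_def intro!: exI[of _ n] exI[of _ l])
  qed
  ultimately show ?thesis by (rule countable_subset[rotated])
qed

lemma cadlag_tendsto_from_right:
  assumes "cadlag g" "t \<ge> 0" "\<And>n. t < u n" "u \<longlonglongrightarrow> t"
  shows "(\<lambda>n. g (u n)) \<longlonglongrightarrow> g t"
proof -
  have "(g \<longlongrightarrow> g t) (at_right t)" using assms by (auto simp: cadlag_def)
  moreover have "filterlim u (at_right t) sequentially"
    unfolding filterlim_at using assms(3,4)
    by (auto intro!: always_eventually simp: less_imp_neq[symmetric])
  ultimately show ?thesis by (rule filterlim_compose)
qed

text \<open>Sampling the path at a grid point to the right of \<open>t\<close> is measurable in both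
  variables, and right-continuity gives pointwise convergence. \<open>max 0\<close> avoids negative
  times, where nothing is known about the path.\<close>

lemma cadlag_process_jointly_measurable:
  assumes X: "\<And>t. t \<ge> 0 \<Longrightarrow> X t \<in> borel_measurable M"
    and cad: "\<And>\<omega>. \<omega> \<in> space M \<Longrightarrow> cadlag (\<lambda>t. X t \<omega>)"
  shows "(\<lambda>p. X (max 0 (fst p)) (snd p)) \<in> borel_measurable ((lborel :: real measure) \<Otimes>\<^sub>M M)"
proof (rule borel_measurable_LIMSEQ_metric)
  \<comment> \<open>The \<open>+ 1\<close> places the sampled point strictly to the right of
    \<open>t\<close>, as convergence from the right demands.\<close>
  define k :: "nat \<Rightarrow> real \<Rightarrow> nat" where "k n t = nat (\<lfloor>real (Suc n) * max 0 t\<rfloor> + 1)" for n t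
  have kreal: "real (k n t) = of_int \<lfloor>real (Suc n) * max 0 t\<rfloor> + 1" for n t
    unfolding k_def by (subst of_nat_nat) auto
  fix n
  have [measurable]: "(\<lambda>p. k n (fst p)) \<in> measurable ((lborel :: real measure) \<Otimes>\<^sub>M M) (count_space UNIV)"
    unfolding k_def by measurable
  have [measurable]: "(\<lambda>p. X (real i / real (Suc n)) (snd p)) \<in> borel_measurable ((lborel :: real measure) \<Otimes>\<^sub>M M)" for i :: nat
    by (rule measurable_compose[OF measurable_snd X]) simp
  show "(\<lambda>p. X (real (k n (fst p)) / real (Suc n)) (snd p)) \<in> borel_measurable ((lborel :: real measure) \<Otimes>\<^sub>M M)"
    by (rule measurable_compose_countable[where f="\<lambda>i p. X (real i / real (Suc n)) (snd p)" and g="\<lambda>p. k n (fst p)"])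
       measurable
next
  define k :: "nat \<Rightarrow> real \<Rightarrow> nat" where "k n t = nat (\<lfloor>real (Suc n) * max 0 t\<rfloor> + 1)" for n t
  have kreal: "real (k n t) = of_int \<lfloor>real (Suc n) * max 0 t\<rfloor> + 1" for n t
    unfolding k_def by (subst of_nat_nat) auto
  fix p assume p: "p \<in> space ((lborel :: real measure) \<Otimes>\<^sub>M M)"
  have lt: "max 0 (fst p) < real (k n (fst p)) / real (Suc n)" for n
    unfolding kreal using real_of_int_floor_add_one_gt[of "real (Suc n) * max 0 (fst p)"]
    by (subst pos_less_divide_eq) (simp_all add: mult.commute)
  have le: "real (k n (fst p)) / real (Suc n) \<le> max 0 (fst p) + 1 / real (Suc n)" for n
  proof -
    have "of_int \<lfloor>real (Suc n) * max 0 (fst p)\<rfloor> + 1 \<le> (max 0 (fst p) + 1 / real (Suc n)) * real (Suc n)"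
      using of_int_floor_le[of "real (Suc n) * max 0 (fst p)"] by (simp add: algebra_simps del: of_nat_Suc)
    then show ?thesis unfolding kreal by (subst pos_divide_le_eq) simp_all
  qed
  have "(\<lambda>n. real (k n (fst p)) / real (Suc n)) \<longlonglongrightarrow> max 0 (fst p)"
  proof (rule tendsto_sandwich[OF _ _ tendsto_const])
    have "(\<lambda>n. max 0 (fst p) + inverse (real (Suc n))) \<longlonglongrightarrow> max 0 (fst p) + 0"
      by (intro tendsto_intros LIMSEQ_inverse_real_of_nat)
    then show "(\<lambda>n. max 0 (fst p) + 1 / real (Suc n)) \<longlonglongrightarrow> max 0 (fst p)"
      by (simp add: divide_inverse)
  qed (use less_imp_le[OF lt] le in \<open>simp_all del: of_nat_Suc\<close>)
  with lt cad show "(\<lambda>n. X (real (nat (\<lfloor>real (Suc n) * max 0 (fst p)\<rfloor> + 1)) / real (Suc n)) (snd p)) \<longlonglongrightarrow> X (max 0 (fst p)) (snd p)"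
    unfolding k_def using p
    by (intro cadlag_tendsto_from_right[where g="\<lambda>t. X t (snd p)"]) (auto simp: space_pair_measure)
qed

text \<open>A single path is a process over a one-point sample space.\<close>

lemma cadlag_borel_measurable:
  assumes "cadlag g"
  shows "(\<lambda>t. g (max 0 t)) \<in> borel_measurable borel"
proof -
  have "(\<lambda>p. g (max 0 (fst p))) \<in> borel_measurable (lborel \<Otimes>\<^sub>M (count_space UNIV :: unit measure))"
    using cadlag_process_jointly_measurable[of "\<lambda>t _. g t" "count_space UNIV :: unit measure"] assms by simp
  from measurable_compose[OF _ this, of "\<lambda>t. (t, ())" lborel] show ?thesis by simp
qed

section \<open>Truncated exponential integrals as limits of Riemann sums\<close>

definition exp_integral :: "real \<Rightarrow> (real \<Rightarrow> real) \<Rightarrow> real" where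
  "exp_integral T g = (LINT t:{0..T}|lborel. exp (- g t))"

text \<open>Right endpoints, because a cadlag path is recovered from its values to the right. Only
  finitely many times occur, so the sum makes sense for arbitrary paths and its law is read off a
  grid.\<close>

definition riemann_sum :: "real \<Rightarrow> nat \<Rightarrow> (real \<Rightarrow> real) \<Rightarrow> real" where
  "riemann_sum T n g = (\<Sum>k<n. exp (- g (real (Suc k) * (T / n))) * (T / n))"

lemma exp_integral_max:
  "exp_integral T g = (LINT t|lborel. indicator {0..T} t * exp (- g (max 0 t)))"
  unfolding exp_integral_def set_lebesgue_integral_def
  by (rule Bochner_Integration.integral_cong) (auto simp: indicator_def)

text \<open>The sum is the integral of the step function \<open>h n\<close>, whose value at
  \<open>t\<close> is \<open>exp (- g u)\<close> with \<open>u\<close> the right end of the cell of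
  \<open>t\<close>. This \<open>u\<close> exceeds \<open>t\<close> by at most \<open>T / n\<close>,
  so right-continuity gives convergence for every \<open>t < T\<close>, and boundedness of the path
  gives domination.\<close>

lemma riemann_sum_tendsto:
  assumes g: "cadlag g" and T: "T > 0"
  shows "(\<lambda>n. riemann_sum T n g) \<longlonglongrightarrow> exp_integral T g"
proof -
  obtain B where B: "\<And>s. 0 \<le> s \<Longrightarrow> s \<le> T \<Longrightarrow> \<bar>g s\<bar> \<le> B"
    using cadlag_bounded[OF g] T by (metis less_imp_le)
  define h where "h n t = (\<Sum>k<n. exp (- g (real (Suc k) * (T / n))) *
      indicator {real k * (T / n) ..< real (Suc k) * (T / n)} t)" for n :: nat and t
  have h_eq: "\<exists>u. t < u \<and> u \<le> t + T / n \<and> u \<le> T \<and> h n t = exp (- g u)"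
    if t: "0 \<le> t" "t < T" and n: "n > 0" for n :: nat and t
  proof -
    define k where "k = nat \<lfloor>t / (T / n)\<rfloor>"
    have d: "T / n > 0" using T n by simp
    have kr: "real k = of_int \<lfloor>t / (T / n)\<rfloor>"
      unfolding k_def using t d by (subst of_nat_nat) auto
    have k1: "real k * (T / n) \<le> t" "t < real (Suc k) * (T / n)"
      using floor_divide_lower[OF d, of t] floor_divide_upper[OF d, of t] unfolding of_nat_Suc kr
      by (auto simp: algebra_simps)
    have "real k * (T / n) < real n * (T / n)"
      using k1(1) t n by simp
    then have kn: "k < n" by (simp only: mult_less_cancel_right_pos[OF d] of_nat_less_iff)
    have other: "j = k" if "real j * (T / n) \<le> t" "t < real (Suc j) * (T / n)" for j
    proof -
      have "real j * (T / n) < real (Suc k) * (T / n)" "real k * (T / n) < real (Suc j) * (T / n)"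
        using that k1 by linarith+
      then have "j < Suc k" "k < Suc j" by (simp_all only: mult_less_cancel_right_pos[OF d] of_nat_less_iff)
      then show ?thesis by simp
    qed
    have "h n t = (\<Sum>j<n. if j = k then exp (- g (real (Suc k) * (T / n))) else 0)"
      unfolding h_def
    proof (rule sum.cong[OF refl])
      fix j
      show "exp (- g (real (Suc j) * (T / n))) * indicator {real j * (T / n) ..< real (Suc j) * (T / n)} t =
        (if j = k then exp (- g (real (Suc k) * (T / n))) else 0)"
      proof (cases "j = k")
        case True
        then show ?thesis using k1 by (simp del: of_nat_Suc)
      next
        case False
        then have "t \<notin> {real j * (T / n) ..< real (Suc j) * (T / n)}" using other[of j] by auto
        then show ?thesis using False by simp
      qed
    qed
    also have "\<dots> = exp (- g (real (Suc k) * (T / n)))" using kn by simp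
    finally have "h n t = exp (- g (real (Suc k) * (T / n)))" .
    moreover have "real (Suc k) * (T / n) \<le> t + T / n"
      using k1(1) unfolding of_nat_Suc distrib_right by simp
    moreover have "real (Suc k) * (T / n) \<le> real n * (T / n)"
      using kn d by (intro mult_right_mono) simp_all
    then have "real (Suc k) * (T / n) \<le> T" using n by simp
    ultimately show ?thesis using k1(2) by blast
  qed
  have le_step: "real k * (T / n) \<le> real (Suc k) * (T / n)" for k n :: nat
    using T by (intro mult_right_mono) simp_all
  have int_h: "(LINT t|lborel. h n t) = riemann_sum T n g" for n
  proof -
    have fin: "emeasure lborel {real k * (T / n) ..< real (Suc k) * (T / n)} < \<infinity>" for k
      using le_step by (simp del: of_nat_Suc)
    have "(LINT t|lborel. h n t) = (\<Sum>k<n. LINT t|lborel. exp (- g (real (Suc k) * (T / n))) *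
        indicator {real k * (T / n) ..< real (Suc k) * (T / n)} t)"
      unfolding h_def using fin
      by (intro Bochner_Integration.integral_sum integrable_mult_right integrable_real_indicator) simp_all
    also have "\<dots> = (\<Sum>k<n. exp (- g (real (Suc k) * (T / n))) *
        (real (Suc k) * (T / n) - real k * (T / n)))"
      using le_step by (simp del: of_nat_Suc)
    also have "\<dots> = riemann_sum T n g"
      unfolding riemann_sum_def of_nat_Suc distrib_right by simp
    finally show ?thesis .
  qed
  have h0: "h n t = 0" if out: "\<not> (0 \<le> t \<and> t < T)" for n t
  proof -
    have "t \<notin> {real k * (T / n) ..< real (Suc k) * (T / n)}" if k: "k < n" for k
    proof
      assume t: "t \<in> {real k * (T / n) ..< real (Suc k) * (T / n)}"
      have "real (Suc k) * (T / n) \<le> real n * (T / n)"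
        using k T by (intro mult_right_mono) simp_all
      also have "\<dots> = T" using k by simp
      finally have "t < T" using t by simp
      moreover have "0 \<le> real k * (T / n)" using T by simp
      then have "0 \<le> t" using t by (meson atLeastLessThan_iff order.trans)
      ultimately show False using out by simp
    qed
    then show ?thesis unfolding h_def by (intro sum.neutral) simp
  qed
  have [measurable]: "(\<lambda>t. g (max 0 t)) \<in> borel_measurable borel" by (rule cadlag_borel_measurable[OF g])
  have "(\<lambda>n. LINT t|lborel. h (Suc n) t) \<longlonglongrightarrow> (LINT t|lborel. indicator {0..T} t * exp (- g (max 0 t)))"
  proof (rule integral_dominated_convergence[where w="\<lambda>t. exp B * indicator {0..T} t"])
    show "(\<lambda>t. indicator {0..T} t * exp (- g (max 0 t))) \<in> borel_measurable lborel" by measurable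
    show "h (Suc n) \<in> borel_measurable lborel" for n unfolding h_def by measurable
    show "integrable lborel (\<lambda>t. exp B * indicator {0..T} t)"
      using T by (intro integrable_mult_right integrable_real_indicator) simp_all
    show "AE t in lborel. norm (h (Suc n) t) \<le> exp B * indicator {0..T} t" for n
    proof (rule AE_I2)
      fix t
      show "norm (h (Suc n) t) \<le> exp B * indicator {0..T} t"
      proof (cases "0 \<le> t \<and> t < T")
        case True
        then obtain u where "t < u" "u \<le> T" "h (Suc n) t = exp (- g u)"
          using h_eq[of t "Suc n"] by blast
        moreover have "- g u \<le> B" using B[of u] calculation True by linarith
        ultimately show ?thesis using True by simp
      next
        case False
        then show ?thesis using h0[OF False] by (simp add: indicator_def)
      qed
    qed
    show "AE t in lborel. (\<lambda>n. h (Suc n) t) \<longlonglongrightarrow> indicator {0..T} t * exp (- g (max 0 t))"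
      using AE_lborel_singleton[of T]
    proof eventually_elim
      \<comment> \<open>The half-open cells miss the endpoint \<open>T\<close>, which is
        negligible.\<close>
      fix t assume tT: "t \<noteq> T"
      show "(\<lambda>n. h (Suc n) t) \<longlonglongrightarrow> indicator {0..T} t * exp (- g (max 0 t))"
      proof (cases "0 \<le> t \<and> t < T")
        case True
        have "\<exists>u. t < u \<and> u \<le> t + T / Suc n \<and> h (Suc n) t = exp (- g u)" for n
          using h_eq[of t "Suc n"] True by blast
        then have "\<forall>n. \<exists>u. t < u \<and> u \<le> t + T / Suc n \<and> h (Suc n) t = exp (- g u)" by blast
        from choice[OF this] obtain u
          where u: "\<And>n. t < u n" "\<And>n. u n \<le> t + T / Suc n" "\<And>n. h (Suc n) t = exp (- g (u n))" by blast
        have "u \<longlonglongrightarrow> t"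
        proof (rule tendsto_sandwich[OF _ _ tendsto_const])
          have "(\<lambda>n. t + T * inverse (real (Suc n))) \<longlonglongrightarrow> t + T * 0"
            by (intro tendsto_intros LIMSEQ_inverse_real_of_nat)
          then show "(\<lambda>n. t + T / Suc n) \<longlonglongrightarrow> t" by (simp add: divide_inverse)
        qed (use less_imp_le[OF u(1)] u(2) in simp_all)
        then have "(\<lambda>n. g (u n)) \<longlonglongrightarrow> g t"
          using cadlag_tendsto_from_right[where u=u, OF g] u(1) True by simp
        then have "(\<lambda>n. exp (- g (u n))) \<longlonglongrightarrow> exp (- g t)" by (intro tendsto_intros)
        moreover have "indicator {0..T} t * exp (- g (max 0 t)) = exp (- g t)" using True by simp
        moreover have "(\<lambda>n. h (Suc n) t) = (\<lambda>n. exp (- g (u n)))" using u(3) by (rule ext)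
        ultimately show ?thesis by simp
      next
        case False
        then have "t \<notin> {0..T}" using tT by auto
        then show ?thesis using h0[OF False] by simp
      qed
    qed
  qed
  then have "(\<lambda>n. riemann_sum T (Suc n) g) \<longlonglongrightarrow> exp_integral T g"
    by (simp only: int_h exp_integral_max[symmetric])
  then show ?thesis by (rule LIMSEQ_imp_Suc)
qed

section \<open>Skorokhod continuity of the exponential integral\<close>

text \<open>After inversion of the time changes, \<open>g n t\<close> is close to
  \<open>h (s n t)\<close> and \<open>s n t\<close> is close to \<open>t\<close>, so
  \<open>g n t\<close> tends to \<open>h t\<close> wherever \<open>h\<close> is continuous. The
  other times are countable and do not affect the integral.\<close>

lemma skorokhod_lim_exp_integral:
  assumes g: "\<And>n. cadlag (g n)" and h: "cadlag h" and lim: "skorokhod_lim g h" and T: "T > 0"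
  shows "(\<lambda>n. exp_integral T (g n)) \<longlonglongrightarrow> exp_integral T h"
proof -
  obtain r :: "nat \<Rightarrow> real \<Rightarrow> real"
    where bij: "\<And>n. bij_betw (r n) {0..} {0..}"
      and r: "uniform_limit {0..} r (\<lambda>t. t) sequentially"
      and gr: "\<And>T. T \<ge> 0 \<Longrightarrow> uniform_limit {0..T} (\<lambda>n t. g n (r n t)) h sequentially"
    using lim unfolding skorokhod_lim_def by blast
  define s where "s n t = inv_into {0..} (r n) t" for n t
  have s: "s n t \<ge> 0" "r n (s n t) = t" if "t \<ge> 0" for n t
    using bij[of n] that unfolding s_def bij_betw_def
    by (metis atLeast_iff inv_into_into, metis atLeast_iff f_inv_into_f)
  have near: "eventually (\<lambda>n. \<forall>t\<in>{0..T}. \<bar>s n t - t\<bar> < e \<and> \<bar>g n t - h (s n t)\<bar> < e) sequentially"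
    if e: "0 < e" "e \<le> 1" for e
  proof -
    have "eventually (\<lambda>n. \<forall>u\<in>{0..}. dist (r n u) u < e) sequentially"
      using r e by (simp add: uniform_limit_iff)
    \<comment> \<open>The horizon grows by 1 because \<open>s n t\<close> may exceed
      \<open>T\<close>, though by less than \<open>e \<le> 1\<close>.\<close>
    moreover have "eventually (\<lambda>n. \<forall>u\<in>{0..T+1}. dist (g n (r n u)) (h u) < e) sequentially"
      using gr[of "T+1"] e T by (simp add: uniform_limit_iff)
    ultimately show ?thesis
    proof eventually_elim
      case (elim n)
      show ?case
      proof
        fix t assume t: "t \<in> {0..T}"
        then have s': "s n t \<ge> 0" "r n (s n t) = t" using s by auto
        then have d: "\<bar>s n t - t\<bar> < e" using elim(1) by (force simp: dist_real_def)
        then have "s n t \<in> {0..T+1}" using t s' e by auto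
        then show "\<bar>s n t - t\<bar> < e \<and> \<bar>g n t - h (s n t)\<bar> < e"
          using elim(2) s' d by (force simp: dist_real_def)
      qed
    qed
  qed
  obtain B where B: "\<And>t. 0 \<le> t \<Longrightarrow> t \<le> T + 1 \<Longrightarrow> \<bar>h t\<bar> \<le> B"
    by (rule cadlag_bounded[OF h, of "T+1"]) (use T in auto)
  obtain N where N: "\<forall>n\<ge>N. \<forall>t\<in>{0..T}. \<bar>s n t - t\<bar> < 1 \<and> \<bar>g n t - h (s n t)\<bar> < 1"
    using near[of 1] unfolding eventually_sequentially by auto
  have low: "- g n t \<le> B + 1" if "n \<ge> N" "t \<in> {0..T}" for n t
  proof -
    have "\<bar>s n t - t\<bar> < 1" "\<bar>g n t - h (s n t)\<bar> < 1" using N that by blast+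
    moreover have "s n t \<ge> 0" using s that by simp
    moreover have "s n t \<le> T + 1" using calculation(1) that by auto
    ultimately show ?thesis using B[of "s n t"] by linarith
  qed
  have conv: "(\<lambda>n. g n t) \<longlonglongrightarrow> h t" if t: "t \<in> {0..T}" "isCont h t" for t
  proof -
    have "(\<lambda>n. s n t) \<longlonglongrightarrow> t"
    proof (rule LIMSEQ_I)
      fix e :: real assume "e > 0"
      then have "eventually (\<lambda>n. \<forall>t\<in>{0..T}. \<bar>s n t - t\<bar> < min e 1 \<and> \<bar>g n t - h (s n t)\<bar> < min e 1) sequentially"
        by (intro near) auto
      then obtain n0 where n0: "\<forall>n\<ge>n0. \<forall>t\<in>{0..T}. \<bar>s n t - t\<bar> < min e 1 \<and> \<bar>g n t - h (s n t)\<bar> < min e 1"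
        unfolding eventually_sequentially by blast
      show "\<exists>n0. \<forall>n\<ge>n0. norm (s n t - t) < e"
        using n0 t by (intro exI[of _ n0]) auto
    qed
    then have 1: "(\<lambda>n. h (s n t)) \<longlonglongrightarrow> h t"
      by (rule isCont_tendsto_compose[OF t(2)])
    have 2: "(\<lambda>n. g n t - h (s n t)) \<longlonglongrightarrow> 0"
    proof (rule LIMSEQ_I)
      fix e :: real assume "e > 0"
      then have "eventually (\<lambda>n. \<forall>t\<in>{0..T}. \<bar>s n t - t\<bar> < min e 1 \<and> \<bar>g n t - h (s n t)\<bar> < min e 1) sequentially"
        by (intro near) auto
      then obtain n0 where n0: "\<forall>n\<ge>n0. \<forall>t\<in>{0..T}. \<bar>s n t - t\<bar> < min e 1 \<and> \<bar>g n t - h (s n t)\<bar> < min e 1"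
        unfolding eventually_sequentially by blast
      show "\<exists>n0. \<forall>n\<ge>n0. norm (g n t - h (s n t) - 0) < e"
        using n0 t by (intro exI[of _ n0]) auto
    qed
    show ?thesis using tendsto_add[OF 1 2] by simp
  qed
  have [measurable]: "(\<lambda>t. g n (max 0 t)) \<in> borel_measurable borel" for n
    by (rule cadlag_borel_measurable[OF g])
  have [measurable]: "(\<lambda>t. h (max 0 t)) \<in> borel_measurable borel"
    by (rule cadlag_borel_measurable[OF h])
  have "AE t in lborel. t \<notin> {t. t > 0 \<and> \<not> isCont h t}"
    using countable_imp_null_set_lborel[OF cadlag_countable_discontinuities[OF h]] by (rule AE_not_in)
  then have ae: "AE t in lborel. (\<lambda>n. indicator {0..T} t * exp (- g (n + N) (max 0 t)))
      \<longlonglongrightarrow> indicator {0..T} t * exp (- h (max 0 t))"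
    using AE_lborel_singleton[of 0]
  proof eventually_elim
    fix t assume t: "t \<notin> {t. t > 0 \<and> \<not> isCont h t}" "t \<noteq> 0"
    show "(\<lambda>n. indicator {0..T} t * exp (- g (n + N) (max 0 t)))
      \<longlonglongrightarrow> indicator {0..T} t * exp (- h (max 0 t))"
    proof (cases "t \<in> {0..T}")
      case True
      then have "isCont h t" using t by auto
      from LIMSEQ_ignore_initial_segment[OF conv[OF True this], of N]
      have "(\<lambda>n. indicator {0..T} t * exp (- g (n + N) t)) \<longlonglongrightarrow> indicator {0..T} t * exp (- h t)"
        by (intro tendsto_intros)
      then show ?thesis using True by (simp add: max_def)
    qed simp
  qed
  \<comment> \<open>The shift by \<open>N\<close> discards the finitely many paths to which the
    common bound \<open>exp (B + 1)\<close> need not apply.\<close>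
  have "(\<lambda>n. LINT t|lborel. indicator {0..T} t * exp (- g (n + N) (max 0 t))) \<longlonglongrightarrow>
      (LINT t|lborel. indicator {0..T} t * exp (- h (max 0 t)))"
  proof (rule integral_dominated_convergence[where w="\<lambda>t. exp (B + 1) * indicator {0..T} t"])
    show "integrable lborel (\<lambda>t. exp (B + 1) * indicator {0..T} t)"
      using T by (intro integrable_mult_right integrable_real_indicator) simp_all
    show "AE t in lborel. norm (indicator {0..T} t * exp (- g (n + N) (max 0 t))) \<le> exp (B + 1) * indicator {0..T} t" for n
      using low[of "n + N"] by (intro AE_I2) (simp add: indicator_def max_def)
  qed (use ae in measurable)
  then show ?thesis
    unfolding exp_integral_max[symmetric] by (rule LIMSEQ_offset)
qed

text \<open>A continuous function between the indicators of \<open>{..a}\<close> and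
  \<open>{..b}\<close>, so that weak convergence can be tested on it and the result sandwiched
  between two events.\<close>

definition ramp :: "real \<Rightarrow> real \<Rightarrow> real \<Rightarrow> real" where
  "ramp a b v = min 1 (max 0 ((b - v) / (b - a)))"

lemma ramp_bounds: "0 \<le> ramp a b v" "ramp a b v \<le> 1"
  by (auto simp: ramp_def)

lemma ramp_eq_1: "a < b \<Longrightarrow> v \<le> a \<Longrightarrow> ramp a b v = 1"
  by (auto simp: ramp_def field_simps)

lemma ramp_eq_0: "a < b \<Longrightarrow> b \<le> v \<Longrightarrow> ramp a b v = 0"
  by (auto simp: ramp_def field_simps)

lemma continuous_on_ramp: "a < b \<Longrightarrow> continuous_on UNIV (ramp a b)"
  unfolding ramp_def by (intro continuous_intros) auto

lemma bounded_continuous_functional_ramp: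
  assumes "a < b" "T > 0"
  shows "bounded_continuous_functional (\<lambda>g. ramp a b (exp_integral T g))"
  unfolding bounded_continuous_functional_def
proof (intro conjI allI impI)
  show "\<exists>B. \<forall>g. cadlag g \<longrightarrow> \<bar>ramp a b (exp_integral T g)\<bar> \<le> B"
    using ramp_bounds by (intro exI[of _ 1]) (auto simp: abs_le_iff intro: order.trans[OF _ ramp_bounds(1)])
  fix g h assume "(\<forall>n. cadlag (g n)) \<and> cadlag h \<and> skorokhod_lim g h"
  then have "(\<lambda>n. exp_integral T (g n)) \<longlonglongrightarrow> exp_integral T h"
    using skorokhod_lim_exp_integral assms by blast
  then show "(\<lambda>n. ramp a b (exp_integral T (g n))) \<longlonglongrightarrow> ramp a b (exp_integral T h)"
    by (rule continuous_on_tendsto_compose[OF continuous_on_ramp[OF assms(1)]]) auto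
qed

section \<open>The Markov property of Levy processes\<close>

text \<open>Independence of increments is formulated for monotone infinite sequences of times, so
  the sorted list is continued by its last entry.\<close>

lemma finite_set_monotone_enumeration:
  fixes S :: "real set"
  assumes "finite S" "S \<noteq> {}"
  obtains q :: "nat \<Rightarrow> real" and n where "mono q" "q ` {..n} = S" "\<And>i. q i \<in> S" "q 0 = Min S"
proof -
  define L where "L = sorted_list_of_set S"
  have L: "set L = S" "sorted L" "L \<noteq> []" using assms by (auto simp: L_def)
  define q where "q i = L ! min i (length L - 1)" for i
  have len: "length L > 0" using L by simp
  show thesis
  proof (rule that[of q "length L - 1"])
    show "mono q"
    proof (rule monoI)
      fix i j :: nat assume "i \<le> j"
      moreover have "min j (length L - 1) < length L" using len by linarith
      ultimately show "q i \<le> q j" unfolding q_def by (intro sorted_nth_mono[OF L(2)]) linarith+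
    qed
    show mem: "q i \<in> S" for i
    proof -
      have "min i (length L - 1) < length L" using len by linarith
      then show ?thesis unfolding q_def using nth_mem L(1) by blast
    qed
    show "q ` {..length L - 1} = S"
    proof
      show "S \<subseteq> q ` {..length L - 1}"
      proof
        fix x assume "x \<in> S"
        then obtain i where "i < length L" "L ! i = x" using L by (auto simp: in_set_conv_nth)
        then show "x \<in> q ` {..length L - 1}" by (intro image_eqI[of _ _ i]) (auto simp: q_def min_def)
      qed
    qed (use mem in auto)
    have "q 0 \<le> x" if "x \<in> S" for x
    proof -
      from that obtain i where "i < length L" "L ! i = x" using L by (auto simp: in_set_conv_nth)
      then show ?thesis unfolding q_def using sorted_nth_mono[OF L(2), of 0 i] by simp
    qed
    then show "q 0 = Min S" using mem[of 0] assms by (intro Min_eqI[symmetric]) auto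
  qed
qed

lemma sets_Collect_finite_Ball_in:
  assumes K: "finite K" and f: "\<And>u. u \<in> K \<Longrightarrow> f u \<in> measurable M N" and B: "\<And>u. u \<in> K \<Longrightarrow> B u \<in> sets N"
  shows "{x\<in>space M. \<forall>u\<in>K. f u x \<in> B u} \<in> sets M"
proof (rule sets.sets_Collect_finite_All[OF _ K])
  fix u assume "u \<in> K"
  from measurable_sets[OF f[OF this] B[OF this]]
  show "{x\<in>space M. f u x \<in> B u} \<in> sets M"
    by (simp add: vimage_def Int_def conj_commute)
qed

text \<open>All functions on \<open>{0..}\<close> with the product sigma-algebra. Laws on it are
  determined by finitely many times at once; in return, events on it have to be expressed through
  countably many times.\<close>

definition path_space :: "(real \<Rightarrow> real) measure" where
  "path_space = PiM {0..} (\<lambda>_. borel)"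

lemma measurable_path_component:
  "u \<ge> 0 \<Longrightarrow> (\<lambda>g. g u) \<in> borel_measurable path_space"
  unfolding path_space_def by (rule measurable_component_singleton) simp

text \<open>\<open>start\<close> is pointwise, which turns later almost sure identities into
  equalities of events. A version with this property is built at the end by subtracting the initial
  value.\<close>

locale levy =
  fixes M :: "'a measure" and V :: "real \<Rightarrow> 'a \<Rightarrow> real"
  assumes levy: "levy_process M V"
    and start: "\<And>\<omega>. \<omega> \<in> space M \<Longrightarrow> V 0 \<omega> = 0"
begin

sublocale prob_space M
  using levy by (simp add: levy_process_def cadlag_process_def)

lemma V_measurable[measurable]: "t \<ge> 0 \<Longrightarrow> V t \<in> borel_measurable M"
  using levy by (simp add: levy_process_def cadlag_process_def)

lemma V_cadlag: "\<omega> \<in> space M \<Longrightarrow> cadlag (\<lambda>t. V t \<omega>)"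
  using levy by (simp add: levy_process_def cadlag_process_def)

lemma independent_increments:
  "0 \<le> t 0 \<Longrightarrow> mono t \<Longrightarrow> indep_vars (\<lambda>_. borel) (\<lambda>i \<omega>. V (t (Suc i)) \<omega> - V (t i) \<omega>) {..<n}"
  using levy by (simp add: levy_process_def)

lemma stationary_increments:
  "s \<ge> 0 \<Longrightarrow> h \<ge> 0 \<Longrightarrow> distr M borel (\<lambda>\<omega>. V (s + h) \<omega> - V s \<omega>) = distr M borel (V h)"
  using levy by (simp add: levy_process_def)

text \<open>Each value \<open>V (s + u) - V s\<close> is the sum of the first \<open>b u\<close>
  increments along the sorted times. These increments are independent and their laws depend on the
  gaps only, so their joint law is a product measure in which \<open>s\<close> does not
  occur.\<close>

lemma stationary_finite_dim:
  assumes s: "s \<ge> 0" and K: "finite K" "K \<subseteq> {0..}" and B: "\<And>u. u \<in> K \<Longrightarrow> B u \<in> sets borel"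
  shows "prob {\<omega>\<in>space M. \<forall>u\<in>K. V (s + u) \<omega> - V s \<omega> \<in> B u} = prob {\<omega>\<in>space M. \<forall>u\<in>K. V u \<omega> \<in> B u}"
proof -
  obtain q :: "nat \<Rightarrow> real" and m where q: "mono q" "q ` {..m} = insert 0 K" "\<And>i. q i \<in> insert 0 K" "q 0 = Min (insert 0 K)"
    using finite_set_monotone_enumeration[of "insert 0 K"] K by (metis finite_insert insert_not_empty)
  let ?I = "\<lambda>r i \<omega>. V (r + q (Suc i)) \<omega> - V (r + q i) \<omega>"
  let ?D = "\<lambda>r \<omega>. \<lambda>i\<in>{..<Suc m}. V (r + q (Suc i)) \<omega> - V (r + q i) \<omega>"
  let ?P = "PiM {..<Suc m} (\<lambda>_. borel :: real measure)"
  have q_pos: "q i \<ge> 0" for i using q(3)[of i] K by auto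
  have q0: "q 0 = 0" unfolding q(4) using K by (intro Min_eqI) auto
  have "\<forall>u\<in>K. \<exists>i\<le>m. q i = u" using q(2) by (metis atMost_iff image_iff insertCI)
  then obtain b where b: "\<And>u. u \<in> K \<Longrightarrow> b u \<le> m" "\<And>u. u \<in> K \<Longrightarrow> q (b u) = u" by metis
  define C where "C = {f\<in>space ?P. \<forall>u\<in>K. (\<Sum>i<b u. f i) \<in> B u}"
  have C: "C \<in> sets ?P"
  proof -
    have "(\<lambda>f. \<Sum>i<b u. f i) \<in> borel_measurable ?P" if "u \<in> K" for u
      using b(1)[OF that] by (intro borel_measurable_sum measurable_component_singleton) auto
    then show ?thesis unfolding C_def using K(1) B by (intro sets_Collect_finite_Ball_in[where N=borel]) simp_all
  qed
  have law: "distr M ?P (?D r)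
      = PiM {..<Suc m} (\<lambda>i. distr M borel (V (q (Suc i) - q i)))" if r: "r \<ge> 0" for r
  proof -
    have "indep_vars (\<lambda>_. borel) (\<lambda>i \<omega>. ?I r i \<omega>) {..<Suc m}"
      using independent_increments[of "\<lambda>i. r + q i" "Suc m"] q(1) r q_pos by (auto simp: mono_def)
    then have "distr M ?P (?D r)
      = PiM {..<Suc m} (\<lambda>i. distr M borel (\<lambda>\<omega>. ?I r i \<omega>))"
      by (subst (asm) indep_vars_iff_distr_eq_PiM') (use r q_pos in auto)
    also have "\<dots> = PiM {..<Suc m} (\<lambda>i. distr M borel (V (q (Suc i) - q i)))"
    proof (rule PiM_cong[OF refl])
      fix i
      have "q i \<le> q (Suc i)" using q(1) by (simp add: mono_def)
      then show "distr M borel (\<lambda>\<omega>. ?I r i \<omega>) = distr M borel (V (q (Suc i) - q i))"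
        using stationary_increments[of "r + q i" "q (Suc i) - q i"] r q_pos[of i] by (simp add: add.assoc)
    qed
    finally show ?thesis .
  qed
  have eq: "prob {\<omega>\<in>space M. \<forall>u\<in>K. V (r + u) \<omega> - V r \<omega> \<in> B u} =
      measure (PiM {..<Suc m} (\<lambda>i. distr M borel (V (q (Suc i) - q i)))) C" if r: "r \<ge> 0" for r
  proof -
    have sumeq: "(\<Sum>i<b u. ?I r i \<omega>) = V (r + u) \<omega> - V r \<omega>" if "u \<in> K" for u \<omega>
      by (subst sum_lessThan_telescope) (simp add: b(2)[OF that] q0)
    have sumeq': "(\<Sum>i<b u. ?D r \<omega> i) = V (r + u) \<omega> - V r \<omega>" if "u \<in> K" for u \<omega>
    proof -
      have "(\<Sum>i<b u. ?D r \<omega> i) = (\<Sum>i<b u. ?I r i \<omega>)"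
        using b(1)[OF that] by (intro sum.cong) auto
      then show ?thesis using sumeq[OF that] by simp
    qed
    have mble: "(?D r) \<in> measurable M ?P"
      using r q_pos by (intro measurable_restrict borel_measurable_diff V_measurable) auto
    have "measure (PiM {..<Suc m} (\<lambda>i. distr M borel (V (q (Suc i) - q i)))) C =
      prob ((?D r) -` C \<inter> space M)"
      unfolding law[OF r, symmetric] by (rule measure_distr[OF mble C])
    also have "(?D r) -` C \<inter> space M
      = {\<omega>\<in>space M. \<forall>u\<in>K. V (r + u) \<omega> - V r \<omega> \<in> B u}"
      unfolding C_def using sumeq' by (auto simp: space_PiM simp del: restrict_apply)
    finally show ?thesis ..
  qed
  have "{\<omega>\<in>space M. \<forall>u\<in>K. V (0 + u) \<omega> - V 0 \<omega> \<in> B u} = {\<omega>\<in>space M. \<forall>u\<in>K. V u \<omega> \<in> B u}"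
    by (auto simp: start)
  then show ?thesis using eq[OF s] eq[of 0] by simp
qed

text \<open>Past times up to \<open>s\<close> and future times after \<open>s\<close> are merged
  into one monotone sequence. The two events then depend on disjoint blocks of independent
  increments, and stationarity moves the future block back to time 0.\<close>

lemma markov_finite_dim:
  assumes s: "s \<ge> 0" and J: "finite J" "J \<subseteq> {0..}" and A: "\<And>u. u \<in> J \<Longrightarrow> A u \<in> sets borel"
    and K: "finite K" "K \<subseteq> {0..}" and B: "\<And>u. u \<in> K \<Longrightarrow> B u \<in> sets borel"
  shows "prob {\<omega>\<in>space M. (\<forall>u\<in>J. V (min u s) \<omega> \<in> A u) \<and> (\<forall>u\<in>K. V (s + u) \<omega> - V s \<omega> \<in> B u)} =
    prob {\<omega>\<in>space M. \<forall>u\<in>J. V (min u s) \<omega> \<in> A u} * prob {\<omega>\<in>space M. \<forall>u\<in>K. V u \<omega> \<in> B u}"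
proof -
  define S where "S = {0, s} \<union> (\<lambda>u. min u s) ` J"
  have S: "finite S" "S \<noteq> {}" "\<And>x. x \<in> S \<Longrightarrow> 0 \<le> x \<and> x \<le> s" using J s by (auto simp: S_def)
  obtain p :: "nat \<Rightarrow> real" and n where p: "mono p" "p ` {..n} = S" "\<And>i. p i \<in> S" "p 0 = Min S"
    by (rule finite_set_monotone_enumeration[OF S(1,2)]) blast
  have p0: "p 0 = 0" unfolding p(4) by (rule Min_eqI[OF S(1)]) (use S(3) in blast, simp add: S_def)
  obtain q :: "nat \<Rightarrow> real" and m where q: "mono q" "q ` {..m} = insert 0 K" "\<And>i. q i \<in> insert 0 K" "q 0 = Min (insert 0 K)"
    using finite_set_monotone_enumeration[of "insert 0 K"] K by (metis finite_insert insert_not_empty)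
  have q_pos: "q i \<ge> 0" for i using q(3)[of i] K by auto
  have q0: "q 0 = 0" unfolding q(4) using K by (intro Min_eqI) auto
  have "\<forall>u\<in>K. \<exists>i\<le>m. q i = u" using q(2) by (metis atMost_iff image_iff insertCI)
  then obtain b where b: "\<And>u. u \<in> K \<Longrightarrow> b u \<le> m" "\<And>u. u \<in> K \<Longrightarrow> q (b u) = u" by metis
  have "\<forall>u\<in>J. \<exists>i\<le>n. p i = min u s" using p(2) unfolding S_def by (metis UnCI atMost_iff image_iff)
  then obtain a where a: "\<And>u. u \<in> J \<Longrightarrow> a u \<le> n" "\<And>u. u \<in> J \<Longrightarrow> p (a u) = min u s" by metis
  \<comment> \<open>Since \<open>q 0 = 0\<close>, the index \<open>Suc n\<close> is exactly the time
    \<open>s\<close>: increments with index below \<open>Suc n\<close> belong to the past, the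
    others to the future.\<close>
  define t where "t i = (if i \<le> n then p i else s + q (i - Suc n))" for i
  have t0: "t 0 = 0" by (simp add: t_def p0)
  have tn: "t (Suc n) = s" by (simp add: t_def q0)
  have tmono: "mono t"
  proof (rule monoI)
    fix i j :: nat assume ij: "i \<le> j"
    consider "j \<le> n" | "i \<le> n" "n < j" | "n < i" using ij by linarith
    then show "t i \<le> t j"
    proof cases
      case 1 then show ?thesis using ij p(1) by (simp add: t_def mono_def)
    next
      case 2
      have "p i \<le> s" using S(3)[OF p(3)] by simp
      then show ?thesis using 2 q_pos[of "j - Suc n"] by (simp add: t_def)
    next
      case 3
      then have "q (i - Suc n) \<le> q (j - Suc n)" using ij q(1) by (simp add: mono_def)
      then show ?thesis using ij 3 by (simp add: t_def)
    qed
  qed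
  have t_pos: "t i \<ge> 0" for i using monoD[OF tmono, of 0 i] t0 by simp
  define D where "D i \<omega> = V (t (Suc i)) \<omega> - V (t i) \<omega>" for i \<omega>
  define N where "N = Suc n + Suc m"
  have "indep_vars (\<lambda>_. borel) D {..<N}"
    unfolding D_def using independent_increments[OF _ tmono] t0 by simp
  then have ind: "indep_var (PiM {..<Suc n} (\<lambda>_. borel)) (\<lambda>\<omega>. restrict (\<lambda>i. D i \<omega>) {..<Suc n})
     (PiM {Suc n..<N} (\<lambda>_. borel)) (\<lambda>\<omega>. restrict (\<lambda>i. D i \<omega>) {Suc n..<N})"
    by (rule indep_var_restrict) (auto simp: N_def)
  define A' where "A' = {f\<in>space (PiM {..<Suc n} (\<lambda>_. borel)). \<forall>u\<in>J. (\<Sum>i<a u. f i) \<in> A u}"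
  define B' where "B' = {f\<in>space (PiM {Suc n..<N} (\<lambda>_. borel)). \<forall>u\<in>K. (\<Sum>i<b u. f (Suc n + i)) \<in> B u}"
  have A': "A' \<in> sets (PiM {..<Suc n} (\<lambda>_. borel))"
  proof -
    have "(\<lambda>f. \<Sum>i<a u. f i) \<in> borel_measurable (PiM {..<Suc n} (\<lambda>_. borel :: real measure))" if "u \<in> J" for u
      using a(1)[OF that] by (intro borel_measurable_sum measurable_component_singleton) auto
    then show ?thesis unfolding A'_def using J(1) A by (intro sets_Collect_finite_Ball_in[where N=borel]) simp_all
  qed
  have B': "B' \<in> sets (PiM {Suc n..<N} (\<lambda>_. borel))"
  proof -
    have "(\<lambda>f. \<Sum>i<b u. f (Suc n + i)) \<in> borel_measurable (PiM {Suc n..<N} (\<lambda>_. borel :: real measure))" if "u \<in> K" for u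
      using b(1)[OF that] by (intro borel_measurable_sum measurable_component_singleton) (auto simp: N_def)
    then show ?thesis unfolding B'_def using K(1) B by (intro sets_Collect_finite_Ball_in[where N=borel]) simp_all
  qed
  have pa: "(\<Sum>i<a u. restrict (\<lambda>i. D i \<omega>) {..<Suc n} i) = V (min u s) \<omega>" if "u \<in> J" "\<omega> \<in> space M" for u \<omega>
  proof -
    have "(\<Sum>i<a u. restrict (\<lambda>i. D i \<omega>) {..<Suc n} i) = (\<Sum>i<a u. D i \<omega>)"
      using a(1)[OF that(1)] by (intro sum.cong) auto
    also have "\<dots> = V (t (a u)) \<omega> - V (t 0) \<omega>"
      unfolding D_def by (rule sum_lessThan_telescope)
    also have "\<dots> = V (min u s) \<omega>" using a[OF that(1)] that(2) by (simp add: t0 start) (simp add: t_def)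
    finally show ?thesis .
  qed
  have fu: "(\<Sum>i<b u. restrict (\<lambda>i. D i \<omega>) {Suc n..<N} (Suc n + i)) = V (s + u) \<omega> - V s \<omega>" if "u \<in> K" for u \<omega>
  proof -
    have "(\<Sum>i<b u. restrict (\<lambda>i. D i \<omega>) {Suc n..<N} (Suc n + i)) = (\<Sum>i<b u. V (t (Suc n + Suc i)) \<omega> - V (t (Suc n + i)) \<omega>)"
      using b(1)[OF that(1)] by (intro sum.cong) (auto simp: D_def N_def)
    also have "\<dots> = V (t (Suc n + b u)) \<omega> - V (t (Suc n + 0)) \<omega>"
      by (rule sum_lessThan_telescope)
    also have "\<dots> = V (s + u) \<omega> - V s \<omega>" using b(2)[OF that(1)] tn by (simp add: t_def)
    finally show ?thesis .
  qed
  have e1: "(\<lambda>\<omega>. restrict (\<lambda>i. D i \<omega>) {..<Suc n}) -` A' \<inter> space M = {\<omega>\<in>space M. \<forall>u\<in>J. V (min u s) \<omega> \<in> A u}"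
    unfolding A'_def using pa by (auto simp: space_PiM simp del: restrict_apply)
  have e2: "(\<lambda>\<omega>. restrict (\<lambda>i. D i \<omega>) {Suc n..<N}) -` B' \<inter> space M = {\<omega>\<in>space M. \<forall>u\<in>K. V (s + u) \<omega> - V s \<omega> \<in> B u}"
    unfolding B'_def using fu by (auto simp: space_PiM simp del: restrict_apply)
  have "prob ((\<lambda>\<omega>. (restrict (\<lambda>i. D i \<omega>) {..<Suc n}, restrict (\<lambda>i. D i \<omega>) {Suc n..<N})) -` (A' \<times> B') \<inter> space M)
    = prob {\<omega>\<in>space M. \<forall>u\<in>J. V (min u s) \<omega> \<in> A u} * prob {\<omega>\<in>space M. \<forall>u\<in>K. V (s + u) \<omega> - V s \<omega> \<in> B u}"
    using indep_varD[OF ind A' B'] unfolding e1 e2 .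
  also have "(\<lambda>\<omega>. (restrict (\<lambda>i. D i \<omega>) {..<Suc n}, restrict (\<lambda>i. D i \<omega>) {Suc n..<N})) -` (A' \<times> B') \<inter> space M
    = {\<omega>\<in>space M. (\<forall>u\<in>J. V (min u s) \<omega> \<in> A u) \<and> (\<forall>u\<in>K. V (s + u) \<omega> - V s \<omega> \<in> B u)}"
    using e1 e2 by blast
  finally show ?thesis
    using stationary_finite_dim[where B=B, OF s K B] by simp
qed

end

section \<open>Independence of the past and future paths\<close>

lemma path_measure_eqI:
  assumes P: "sets P = sets path_space" and Q: "sets Q = sets path_space" and fin: "finite_measure P"
    and eq: "\<And>K B. finite K \<Longrightarrow> K \<subseteq> {0..} \<Longrightarrow> (\<And>u. u \<in> K \<Longrightarrow> B u \<in> sets borel) \<Longrightarrow>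
      emeasure P {g\<in>space path_space. \<forall>u\<in>K. g u \<in> B u} = emeasure Q {g\<in>space path_space. \<forall>u\<in>K. g u \<in> B u}"
  shows "P = Q"
proof (rule measure_eqI_PiM_infinite[of P "{0..}" "\<lambda>_. borel" Q])
  fix B :: "real \<Rightarrow> real set" and K assume K: "finite K" "K \<subseteq> {0::real..}" and B: "\<And>u. u \<in> K \<Longrightarrow> B u \<in> sets borel"
  have "prod_emb {0..} (\<lambda>_. borel :: real measure) K (Pi\<^sub>E K B) = {g\<in>space path_space. \<forall>u\<in>K. g u \<in> B u}"
    using K(2) by (auto simp: prod_emb_iff path_space_def space_PiM PiE_iff)
  then show "emeasure P (prod_emb {0..} (\<lambda>_. borel) K (Pi\<^sub>E K B)) = emeasure Q (prod_emb {0..} (\<lambda>_. borel) K (Pi\<^sub>E K B))"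
    using eq[OF K B] by simp
qed (use P Q fin in \<open>simp_all add: path_space_def\<close>)

context levy begin

text \<open>The past is the stopped path, so that it lives in the same space as the future.\<close>

definition past_path :: "real \<Rightarrow> 'a \<Rightarrow> real \<Rightarrow> real" where
  "past_path s \<omega> = (\<lambda>u\<in>{0..}. V (min u s) \<omega>)"

definition future_path :: "real \<Rightarrow> 'a \<Rightarrow> real \<Rightarrow> real" where
  "future_path s \<omega> = (\<lambda>u\<in>{0..}. V (s + u) \<omega> - V s \<omega>)"

lemma past_path_measurable: "s \<ge> 0 \<Longrightarrow> past_path s \<in> measurable M path_space"
  unfolding past_path_def path_space_def by (rule measurable_restrict) simp

lemma future_path_measurable: "s \<ge> 0 \<Longrightarrow> future_path s \<in> measurable M path_space"
  unfolding future_path_def path_space_def by (rule measurable_restrict) (simp add: borel_measurable_diff)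

lemma past_path_cylinder:
  assumes "K \<subseteq> {0..}" "s \<ge> 0"
  shows "past_path s -` {g\<in>space path_space. \<forall>u\<in>K. g u \<in> B u} \<inter> space M = {\<omega>\<in>space M. \<forall>u\<in>K. V (min u s) \<omega> \<in> B u}"
  using assms measurable_space[OF past_path_measurable[OF assms(2)]]
  by (auto simp: past_path_def subset_iff)

lemma future_path_cylinder:
  assumes "K \<subseteq> {0..}" "s \<ge> 0"
  shows "future_path s -` {g\<in>space path_space. \<forall>u\<in>K. g u \<in> B u} \<inter> space M = {\<omega>\<in>space M. \<forall>u\<in>K. V (s + u) \<omega> - V s \<omega> \<in> B u}"
  using assms measurable_space[OF future_path_measurable[OF assms(2)]]
  by (auto simp: future_path_def subset_iff)

lemma cylinder_sets:
  assumes "finite K" "K \<subseteq> {0..}" "\<And>u. u \<in> K \<Longrightarrow> B u \<in> sets (borel :: real measure)"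
  shows "{g\<in>space path_space. \<forall>u\<in>K. g u \<in> B u} \<in> sets path_space"
  using assms by (intro sets_Collect_finite_Ball_in[where N=borel] measurable_path_component) auto

lemma emeasure_restricted_law:
  assumes E: "E \<in> sets M" and F: "F \<in> measurable M path_space" and C: "C \<in> sets path_space"
  shows "emeasure (distr (density M (indicator E)) path_space F) C = emeasure M (E \<inter> (F -` C \<inter> space M))"
  using assms by (subst emeasure_distr) (auto simp: emeasure_restricted measurable_sets)

lemma finite_measure_restricted_law:
  assumes "E \<in> sets M" "F \<in> measurable M path_space"
  shows "finite_measure (distr (density M (indicator E)) path_space F)"
proof
  have "emeasure (distr (density M (indicator E)) path_space F) (space path_space) \<le> 1"
    by (subst emeasure_restricted_law[OF assms]) (auto intro: emeasure_le_1)
  then show "emeasure (distr (density M (indicator E)) path_space F) (space (distr (density M (indicator E)) path_space F)) \<noteq> \<infinity>"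
    by (auto simp: top_unique)
qed

text \<open>Two extensions from cylinders, one variable at a time. With a past cylinder fixed, both
  sides are finite measures in the future event and agree on cylinders; this gives all
  \<open>B\<close>. With such a \<open>B\<close> fixed, the same argument applies to the past
  event.\<close>

lemma markov_path_events:
  assumes s: "s \<ge> 0" and A: "A \<in> sets path_space" and B: "B \<in> sets path_space"
  shows "emeasure M ((past_path s -` A \<inter> space M) \<inter> (future_path s -` B \<inter> space M)) =
    emeasure M (past_path s -` A \<inter> space M) * emeasure M (future_path 0 -` B \<inter> space M)"
proof -
  note P = past_path_measurable[OF s] and F = future_path_measurable[OF s] and F0 = future_path_measurable[of 0, simplified]
  have 1: "emeasure M ((past_path s -` C \<inter> space M) \<inter> (future_path s -` B \<inter> space M)) =
      emeasure M (past_path s -` C \<inter> space M) * emeasure M (future_path 0 -` B \<inter> space M)"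
    if C: "C = {g\<in>space path_space. \<forall>u\<in>J. g u \<in> A' u}"
      and J: "finite J" "J \<subseteq> {0..}" "\<And>u. u \<in> J \<Longrightarrow> A' u \<in> sets borel" for C J A'
  proof -
    have Cs: "C \<in> sets path_space" unfolding C using J by (rule cylinder_sets)
    define E where "E = past_path s -` C \<inter> space M"
    have E: "E \<in> sets M" unfolding E_def using P Cs by (rule measurable_sets)
    let ?DF = "distr (density M (indicator E)) path_space (future_path s)"
    have "?DF =
        scale_measure (emeasure M E) (distr M path_space (future_path 0))"
    proof (rule path_measure_eqI)
      show "finite_measure (?DF)"
        by (rule finite_measure_restricted_law[OF E F])
      fix K :: "real set" and B' :: "real \<Rightarrow> real set"
      assume K: "finite K" "K \<subseteq> {0..}" "\<And>u. u \<in> K \<Longrightarrow> B' u \<in> sets borel"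
      let ?D = "{g\<in>space path_space. \<forall>u\<in>K. g u \<in> B' u}"
      have D: "?D \<in> sets path_space" using K by (rule cylinder_sets)
      have "emeasure (?DF) ?D =
        emeasure M (E \<inter> (future_path s -` ?D \<inter> space M))"
        by (rule emeasure_restricted_law[OF E F D])
      also have "E \<inter> (future_path s -` ?D \<inter> space M) =
         {\<omega>\<in>space M. (\<forall>u\<in>J. V (min u s) \<omega> \<in> A' u) \<and> (\<forall>u\<in>K. V (s + u) \<omega> - V s \<omega> \<in> B' u)}"
        unfolding E_def C past_path_cylinder[OF J(2) s] future_path_cylinder[OF K(2) s] by blast
      also have "emeasure M \<dots> = emeasure M {\<omega>\<in>space M. \<forall>u\<in>J. V (min u s) \<omega> \<in> A' u} * emeasure M {\<omega>\<in>space M. \<forall>u\<in>K. V u \<omega> \<in> B' u}"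
        unfolding emeasure_eq_measure by (subst markov_finite_dim[OF s J K]) (simp_all add: ennreal_mult)
      also have "{\<omega>\<in>space M. \<forall>u\<in>J. V (min u s) \<omega> \<in> A' u} = E"
        unfolding E_def C past_path_cylinder[OF J(2) s] ..
      also have "{\<omega>\<in>space M. \<forall>u\<in>K. V u \<omega> \<in> B' u} = future_path 0 -` ?D \<inter> space M"
        using K(2) by (subst future_path_cylinder) (auto simp: start)
      finally show "emeasure (?DF) ?D =
         emeasure (scale_measure (emeasure M E) (distr M path_space (future_path 0))) ?D"
        using D F0 by (simp add: emeasure_distr)
    qed simp_all
    then have "emeasure (?DF) B =
        emeasure (scale_measure (emeasure M E) (distr M path_space (future_path 0))) B" by simp
    then have "emeasure M (E \<inter> (future_path s -` B \<inter> space M)) =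
        emeasure M E * emeasure M (future_path 0 -` B \<inter> space M)"
      unfolding emeasure_restricted_law[OF E F B] using B F0 by (simp add: emeasure_distr)
    then show ?thesis unfolding E_def .
  qed
  define E where "E = future_path s -` B \<inter> space M"
  have E: "E \<in> sets M" unfolding E_def using F B by (rule measurable_sets)
  let ?DP = "distr (density M (indicator E)) path_space (past_path s)"
  have "?DP =
      scale_measure (emeasure M (future_path 0 -` B \<inter> space M)) (distr M path_space (past_path s))"
  proof (rule path_measure_eqI)
    show "finite_measure (?DP)"
      by (rule finite_measure_restricted_law[OF E P])
    fix J :: "real set" and A' :: "real \<Rightarrow> real set"
    assume J: "finite J" "J \<subseteq> {0..}" "\<And>u. u \<in> J \<Longrightarrow> A' u \<in> sets borel"
    let ?C = "{g\<in>space path_space. \<forall>u\<in>J. g u \<in> A' u}"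
    have C: "?C \<in> sets path_space" using J by (rule cylinder_sets)
    show "emeasure (?DP) ?C =
       emeasure (scale_measure (emeasure M (future_path 0 -` B \<inter> space M)) (distr M path_space (past_path s))) ?C"
    proof -
      have "emeasure M (E \<inter> (past_path s -` ?C \<inter> space M)) =
          emeasure M (past_path s -` ?C \<inter> space M) * emeasure M (future_path 0 -` B \<inter> space M)"
        unfolding E_def by (subst Int_commute) (rule 1[OF refl J])
      then show ?thesis
        unfolding emeasure_restricted_law[OF E P C] using C P by (simp add: emeasure_distr mult.commute)
    qed
  qed simp_all
  then have "emeasure (?DP) A =
      emeasure (scale_measure (emeasure M (future_path 0 -` B \<inter> space M)) (distr M path_space (past_path s))) A" by simp
  then have "emeasure M (E \<inter> (past_path s -` A \<inter> space M)) =
      emeasure M (past_path s -` A \<inter> space M) * emeasure M (future_path 0 -` B \<inter> space M)"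
    unfolding emeasure_restricted_law[OF E P A] using A P by (simp add: emeasure_distr mult.commute)
  then show ?thesis unfolding E_def by (subst Int_commute)
qed

lemma markov_prob:
  assumes s: "s \<ge> 0" and A: "A \<in> sets path_space" and B: "B \<in> sets path_space"
  shows "prob {\<omega>\<in>space M. past_path s \<omega> \<in> A \<and> future_path s \<omega> \<in> B} =
    prob {\<omega>\<in>space M. past_path s \<omega> \<in> A} * prob {\<omega>\<in>space M. future_path 0 \<omega> \<in> B}"
proof -
  have e: "(past_path s -` A \<inter> space M) \<inter> (future_path s -` B \<inter> space M) = {\<omega>\<in>space M. past_path s \<omega> \<in> A \<and> future_path s \<omega> \<in> B}"
    "past_path s -` A \<inter> space M = {\<omega>\<in>space M. past_path s \<omega> \<in> A}"
    "future_path 0 -` B \<inter> space M = {\<omega>\<in>space M. future_path 0 \<omega> \<in> B}" by auto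
  show ?thesis
    using markov_path_events[OF assms] unfolding e(1) unfolding e(2,3) emeasure_eq_measure
    by (simp add: ennreal_mult[symmetric])
qed

text \<open>The joint law of past and future is a product, so the integral becomes an iterated one
  in which the future is that of an independent copy started at time 0.\<close>

lemma markov_nn_integral:
  assumes s: "s \<ge> 0" and H: "H \<in> borel_measurable (path_space \<Otimes>\<^sub>M path_space)"
  shows "(\<integral>\<^sup>+\<omega>. H (past_path s \<omega>, future_path s \<omega>) \<partial>M) =
    (\<integral>\<^sup>+\<omega>. \<integral>\<^sup>+\<omega>'. H (past_path s \<omega>, future_path 0 \<omega>') \<partial>M \<partial>M)"
proof -
  note P = past_path_measurable[OF s] and F = future_path_measurable[OF s] and F0 = future_path_measurable[of 0, simplified]
  interpret P: prob_space "distr M path_space (past_path s)" by (rule prob_space_distr[OF P])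
  interpret F0: prob_space "distr M path_space (future_path 0)" by (rule prob_space_distr[OF F0])
  have PF: "(\<lambda>\<omega>. (past_path s \<omega>, future_path s \<omega>)) \<in> measurable M (path_space \<Otimes>\<^sub>M path_space)"
    using P F by (rule measurable_Pair)
  have law: "distr M path_space (past_path s) \<Otimes>\<^sub>M distr M path_space (future_path 0) =
    distr M (path_space \<Otimes>\<^sub>M path_space) (\<lambda>\<omega>. (past_path s \<omega>, future_path s \<omega>))"
  proof (rule pair_measure_eqI)
    fix A B assume "A \<in> sets (distr M path_space (past_path s))" "B \<in> sets (distr M path_space (future_path 0))"
    then have A: "A \<in> sets path_space" and B: "B \<in> sets path_space" by simp_all
    have "(\<lambda>\<omega>. (past_path s \<omega>, future_path s \<omega>)) -` (A \<times> B) \<inter> space M =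
      (past_path s -` A \<inter> space M) \<inter> (future_path s -` B \<inter> space M)" by auto
    then show "emeasure (distr M path_space (past_path s)) A * emeasure (distr M path_space (future_path 0)) B =
      emeasure (distr M (path_space \<Otimes>\<^sub>M path_space) (\<lambda>\<omega>. (past_path s \<omega>, future_path s \<omega>))) (A \<times> B)"
      using A B markov_path_events[OF s A B]
      by (simp add: emeasure_distr[OF P] emeasure_distr[OF F0] emeasure_distr[OF PF])
  qed (unfold_locales, simp_all cong: sets_pair_measure_cong)
  have "(\<integral>\<^sup>+\<omega>. H (past_path s \<omega>, future_path s \<omega>) \<partial>M) =
    (\<integral>\<^sup>+x. H x \<partial>distr M (path_space \<Otimes>\<^sub>M path_space) (\<lambda>\<omega>. (past_path s \<omega>, future_path s \<omega>)))"
    using nn_integral_distr[OF PF, of H] H by simp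
  also have "\<dots> = (\<integral>\<^sup>+x. \<integral>\<^sup>+y. H (x, y) \<partial>distr M path_space (future_path 0) \<partial>distr M path_space (past_path s))"
    unfolding law[symmetric]
    by (rule F0.nn_integral_fst[symmetric]) (use H in \<open>simp cong: measurable_cong_sets sets_pair_measure_cong\<close>)
  also have "\<dots> = (\<integral>\<^sup>+x. \<integral>\<^sup>+\<omega>'. H (x, future_path 0 \<omega>') \<partial>M \<partial>distr M path_space (past_path s))"
  proof (rule nn_integral_cong)
    fix x assume "x \<in> space (distr M path_space (past_path s))"
    then have "(\<lambda>y. H (x, y)) \<in> borel_measurable path_space"
      using H by (intro measurable_compose[OF measurable_Pair1' H]) simp
    then show "(\<integral>\<^sup>+y. H (x, y) \<partial>distr M path_space (future_path 0)) = (\<integral>\<^sup>+\<omega>'. H (x, future_path 0 \<omega>') \<partial>M)"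
      using nn_integral_distr[OF F0, of "\<lambda>y. H (x, y)"] by simp
  qed
  also have "\<dots> = (\<integral>\<^sup>+\<omega>. \<integral>\<^sup>+\<omega>'. H (past_path s \<omega>, future_path 0 \<omega>') \<partial>M \<partial>M)"
  proof (rule nn_integral_distr[OF P, of "\<lambda>x. \<integral>\<^sup>+\<omega>'. H (x, future_path 0 \<omega>') \<partial>M"])
    have "(\<lambda>p. H (fst p, future_path 0 (snd p))) \<in> borel_measurable (path_space \<Otimes>\<^sub>M M)"
      by (rule measurable_compose[OF measurable_Pair[OF measurable_fst measurable_compose[OF measurable_snd F0]] H])
    then have "(\<lambda>x. \<integral>\<^sup>+\<omega>'. H (x, future_path 0 \<omega>') \<partial>M) \<in> borel_measurable path_space"
      by (intro borel_measurable_nn_integral) (simp add: case_prod_beta)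
    then show "(\<lambda>x. \<integral>\<^sup>+\<omega>'. H (x, future_path 0 \<omega>') \<partial>M) \<in> borel_measurable (distr M path_space (past_path s))"
      by simp
  qed
  finally show ?thesis .
qed

end

section \<open>Path functionals\<close>

text \<open>A uniform margin instead of pointwise positivity: a cadlag path may be positive at every
  time and still have left limit 0. The margin expresses that the infimum is positive.\<close>

definition stays_pos :: "real \<Rightarrow> (real \<Rightarrow> real) \<Rightarrow> bool" where
  "stays_pos t g \<longleftrightarrow> (\<exists>e>0. \<forall>s\<in>{0..t}. e \<le> g s)"

text \<open>Equivalent for cadlag paths, but measurable on the product space of all paths.\<close>

definition stays_pos_rat :: "real \<Rightarrow> (real \<Rightarrow> real) \<Rightarrow> bool" where
  "stays_pos_rat t g \<longleftrightarrow>
     (\<exists>k::nat. 1 / Suc k \<le> g t \<and> (\<forall>q::rat. 0 \<le> real_of_rat q \<and> real_of_rat q \<le> t \<longrightarrow> 1 / Suc k \<le> g (real_of_rat q)))"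

text \<open>A time \<open>s < t\<close> is approached from the right by rationals inside the
  interval. The endpoint \<open>t\<close> is not, which is why \<open>stays_pos_rat\<close> asks for
  the bound there separately.\<close>

lemma stays_pos_rat_iff:
  assumes g: "cadlag g" and t: "t \<ge> 0"
  shows "stays_pos_rat t g \<longleftrightarrow> stays_pos t g"
proof
  assume "stays_pos_rat t g"
  then obtain k where k: "1 / Suc k \<le> g t"
    "\<And>q::rat. 0 \<le> real_of_rat q \<Longrightarrow> real_of_rat q \<le> t \<Longrightarrow> 1 / Suc k \<le> g (real_of_rat q)"
    unfolding stays_pos_rat_def by blast
  have "1 / Suc k \<le> g s" if s: "s \<in> {0..t}" for s
  proof (cases "s = t")
    case False
    show ?thesis
    proof (rule field_le_epsilon)
      fix e :: real assume e: "e > 0"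
      have s0: "s \<ge> 0" using s by simp
      obtain d where d: "d > 0" "\<And>r. s < r \<Longrightarrow> r < s + d \<Longrightarrow> \<bar>g r - g s\<bar> < e"
        using cadlag_local_right[OF g s0 e] by blast
      have "s < min t (s + d)" using s False d(1) by auto
      then obtain q :: rat where q: "s < real_of_rat q" "real_of_rat q < min t (s + d)"
        using of_rat_dense by blast
      then have "1 / Suc k \<le> g (real_of_rat q)" using s by (intro k(2)) (simp_all only: atLeastAtMost_iff min_less_iff_conj, linarith+)
      moreover have "\<bar>g (real_of_rat q) - g s\<bar> < e" using q by (intro d(2)) auto
      ultimately show "1 / Suc k \<le> g s + e" by linarith
    qed
  qed (use k in simp)
  then show "stays_pos t g" unfolding stays_pos_def by (intro exI[of _ "1 / Suc k"]) simp
next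
  assume "stays_pos t g"
  then obtain e where e: "e > 0" "\<And>s. s \<in> {0..t} \<Longrightarrow> e \<le> g s" unfolding stays_pos_def by blast
  obtain k where k: "1 / Suc k < e" using nat_approx_posE[OF e(1)] by blast
  have "1 / Suc k \<le> g s" if "s \<in> {0..t}" for s using e(2)[OF that] k by linarith
  then show "stays_pos_rat t g" unfolding stays_pos_rat_def using t by (intro exI[of _ k]) simp
qed

lemma stays_pos_iff_INF:
  assumes g: "cadlag g" and t: "t \<ge> 0"
  shows "0 < (INF s\<in>{0..t}. g s) \<longleftrightarrow> stays_pos t g"
proof
  obtain B where B: "\<And>s. 0 \<le> s \<Longrightarrow> s \<le> t \<Longrightarrow> \<bar>g s\<bar> \<le> B"
    using cadlag_bounded[OF g t] by blast
  have "bdd_below (g ` {0..t})"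
  proof (rule bdd_belowI2)
    show "- B \<le> g s" if "s \<in> {0..t}" for s using B[of s] that by auto
  qed
  then show "0 < (INF s\<in>{0..t}. g s) \<Longrightarrow> stays_pos t g"
    unfolding stays_pos_def by (intro exI[of _ "INF s\<in>{0..t}. g s"]) (auto intro!: cINF_lower)
  assume "stays_pos t g"
  then obtain e where e: "e > 0" "\<And>s. s \<in> {0..t} \<Longrightarrow> e \<le> g s" unfolding stays_pos_def by blast
  have "e \<le> (INF s\<in>{0..t}. g s)" using e(2) t by (intro cINF_greatest) auto
  then show "0 < (INF s\<in>{0..t}. g s)" using e(1) by linarith
qed

lemma stays_pos_add:
  assumes "s \<ge> 0" "t \<ge> 0"
  shows "stays_pos (s + t) g \<longleftrightarrow> stays_pos s g \<and> stays_pos t (\<lambda>u. g (s + u))"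
proof safe
  assume "stays_pos (s + t) g"
  then obtain e where e: "e > 0" "\<And>u. u \<in> {0..s+t} \<Longrightarrow> e \<le> g u" unfolding stays_pos_def by blast
  show "stays_pos s g" "stays_pos t (\<lambda>u. g (s + u))"
    unfolding stays_pos_def using e assms by (auto intro!: exI[of _ e])
next
  assume "stays_pos s g" "stays_pos t (\<lambda>u. g (s + u))"
  then obtain e1 e2 where e: "e1 > 0" "\<And>u. u \<in> {0..s} \<Longrightarrow> e1 \<le> g u" "e2 > 0" "\<And>u. u \<in> {0..t} \<Longrightarrow> e2 \<le> g (s + u)"
    unfolding stays_pos_def by blast
  have "min e1 e2 \<le> g u" if "u \<in> {0..s+t}" for u
  proof (cases "u \<le> s")
    case True then show ?thesis using e(2)[of u] that by auto
  next
    case False then show ?thesis using e(4)[of "u - s"] that by auto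
  qed
  then show "stays_pos (s + t) g" unfolding stays_pos_def using e by (intro exI[of _ "min e1 e2"]) auto
qed

lemma stays_pos_mono: "stays_pos t g \<Longrightarrow> s \<le> t \<Longrightarrow> stays_pos s g"
  unfolding stays_pos_def by (meson atLeastAtMost_iff order.trans)

lemma stays_pos_rat_cong: "t \<ge> 0 \<Longrightarrow> (\<And>s. 0 \<le> s \<Longrightarrow> s \<le> t \<Longrightarrow> f s = g s) \<Longrightarrow> stays_pos_rat t f \<longleftrightarrow> stays_pos_rat t g"
  unfolding stays_pos_rat_def by auto

lemma stays_pos_rat_measurable:
  assumes t: "t \<ge> 0" and X: "\<And>s. s \<ge> 0 \<Longrightarrow> (\<lambda>x. X x s) \<in> borel_measurable M"
  shows "Measurable.pred M (\<lambda>x. stays_pos_rat t (X x))"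
proof -
  have ge: "Measurable.pred M (\<lambda>x. c \<le> X x s)" if "s \<ge> 0" for c s
    unfolding pred_def by (rule borel_measurable_le[OF borel_measurable_const X[OF that]])
  have "Measurable.pred M (\<lambda>x. 0 \<le> real_of_rat q \<and> real_of_rat q \<le> t \<longrightarrow> 1 / Suc k \<le> X x (real_of_rat q))" for q k
  proof (cases "0 \<le> real_of_rat q \<and> real_of_rat q \<le> t")
    case True
    then have "Measurable.pred M (\<lambda>x. 1 / Suc k \<le> X x (real_of_rat q))" by (intro ge) simp
    then show ?thesis by (simp only: True simp_thms)
  next
    case False
    then show ?thesis by (simp only: False simp_thms measurable_const space_count_space UNIV_I)
  qed
  then have all: "Measurable.pred M (\<lambda>x. \<forall>q. 0 \<le> real_of_rat q \<and> real_of_rat q \<le> t \<longrightarrow> 1 / Suc k \<le> X x (real_of_rat q))" for k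
    by (rule pred_intros_countable)
  have "Measurable.pred M (\<lambda>x. 1 / Suc k \<le> X x t \<and> (\<forall>q. 0 \<le> real_of_rat q \<and> real_of_rat q \<le> t \<longrightarrow> 1 / Suc k \<le> X x (real_of_rat q)))" for k
    by (rule pred_intros_logic(3)[OF ge[OF t] all])
  then show ?thesis unfolding stays_pos_rat_def by (rule pred_intros_countable)
qed

lemma cadlag_shift:
  assumes g: "cadlag g" and s: "s \<ge> 0"
  shows "cadlag (\<lambda>u. c + g (s + u))"
  unfolding cadlag_def
proof (intro conjI allI impI)
  fix t :: real assume "t \<ge> 0"
  then have "(g \<longlongrightarrow> g (s + t)) (at_right (s + t))" using g s by (simp add: cadlag_def)
  moreover have "filterlim (\<lambda>u. s + u) (at_right (s + t)) (at_right t)"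
    unfolding filterlim_at
    by (intro conjI tendsto_intros) (auto simp: eventually_at_filter)
  ultimately have "((\<lambda>u. g (s + u)) \<longlongrightarrow> g (s + t)) (at_right t)"
    by (rule filterlim_compose)
  then show "((\<lambda>u. c + g (s + u)) \<longlongrightarrow> c + g (s + t)) (at_right t)"
    by (intro tendsto_intros)
next
  fix t :: real assume t: "t > 0"
  then obtain l where "(g \<longlongrightarrow> l) (at_left (s + t))" using g s unfolding cadlag_def by (meson add_nonneg_pos)
  moreover have "filterlim (\<lambda>u. s + u) (at_left (s + t)) (at_left t)"
    unfolding filterlim_at
    by (intro conjI tendsto_intros) (auto simp: eventually_at_filter)
  ultimately have "((\<lambda>u. g (s + u)) \<longlongrightarrow> l) (at_left t)"
    by (rule filterlim_compose)
  then have "((\<lambda>u. c + g (s + u)) \<longlongrightarrow> c + l) (at_left t)"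
    by (intro tendsto_intros)
  then show "\<exists>l. ((\<lambda>u. c + g (s + u)) \<longlongrightarrow> l) (at_left t)" by blast
qed

section \<open>Calculus and measurability of the exponential integral\<close>

lemma exp_integral_integrable:
  assumes g: "cadlag g" and T: "T \<ge> 0"
  shows "set_integrable lborel {0..T} (\<lambda>t. exp (- g t))"
proof -
  obtain B where B: "\<And>s. 0 \<le> s \<Longrightarrow> s \<le> T \<Longrightarrow> \<bar>g s\<bar> \<le> B"
    using cadlag_bounded[OF g T] by blast
  have [measurable]: "(\<lambda>t. g (max 0 t)) \<in> borel_measurable borel" by (rule cadlag_borel_measurable[OF g])
  have "integrable lborel (\<lambda>t. indicator {0..T} t * exp (- g (max 0 t)))"
  proof (rule Bochner_Integration.integrable_bound[where f="\<lambda>t. exp B * indicator {0..T} t"])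
    show "integrable lborel (\<lambda>t. exp B * indicator {0..T} t)"
      using T by (intro integrable_mult_right integrable_real_indicator) simp_all
    have "exp (- g t) \<le> exp B" if "t \<in> {0..T}" for t
      using B[of t] that by auto
    then show "AE t in lborel. norm (indicator {0..T} t * exp (- g (max 0 t))) \<le> norm (exp B * indicator {0..T} t :: real)"
      by (intro AE_I2) (simp add: indicator_def max_def)
  qed measurable
  also have "(\<lambda>t. indicator {0..T} t * exp (- g (max 0 t))) = (\<lambda>t. indicator {0..T} t *\<^sub>R exp (- g t))"
    by (auto simp: indicator_def fun_eq_iff)
  finally show ?thesis unfolding set_integrable_def .
qed

lemma exp_integral_nonneg: "0 \<le> exp_integral T g"
  unfolding exp_integral_def set_lebesgue_integral_def by (intro integral_nonneg_AE) (simp add: indicator_def)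

lemma exp_integral_split:
  assumes g: "cadlag g" and s: "0 \<le> s" "0 \<le> t"
  shows "exp_integral (s + t) g = exp_integral s g + exp_integral t (\<lambda>u. g (s + u))"
proof -
  have gs: "cadlag (\<lambda>u. g (s + u))" using cadlag_shift[OF g s(1), of 0] by simp
  have st: "{0..s+t} = {0..s} \<union> {s<..s+t}" "{0..s} \<inter> {s<..s+t} = {}" using s by auto
  have "set_integrable lborel {0..s+t} (\<lambda>u. exp (- g u))"
    using s by (intro exp_integral_integrable[OF g]) simp
  then have i: "set_integrable lborel {0..s} (\<lambda>u. exp (- g u))" "set_integrable lborel {s<..s+t} (\<lambda>u. exp (- g u))"
    by (rule set_integrable_subset; use s in auto)+
  have "exp_integral (s + t) g = (LINT u:{0..s}|lborel. exp (- g u)) + (LINT u:{s<..s+t}|lborel. exp (- g u))"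
    unfolding exp_integral_def st(1) by (rule set_integral_Un[OF st(2) i])
  also have "(LINT u:{s<..s+t}|lborel. exp (- g u)) = (LINT u|lborel. indicator {s<..s+t} (s + 1 * u) *\<^sub>R exp (- g (s + 1 * u)))"
    unfolding set_lebesgue_integral_def
    by (subst lborel_integral_real_affine[of 1 _ s]) simp_all
  also have "\<dots> = exp_integral t (\<lambda>u. g (s + u))"
    unfolding exp_integral_def set_lebesgue_integral_def
  proof (rule integral_cong_AE)
    have [measurable]: "(\<lambda>u. g (max 0 u)) \<in> borel_measurable borel" by (rule cadlag_borel_measurable[OF g])
    have [measurable]: "(\<lambda>u. g (s + max 0 u)) \<in> borel_measurable borel" by (rule cadlag_borel_measurable[OF gs])
    have "(\<lambda>u. indicator {s<..s+t} (s + 1 * u) *\<^sub>R exp (- g (s + 1 * u))) = (\<lambda>u. indicator {0<..t} u *\<^sub>R exp (- g (s + max 0 u)))"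
      by (auto simp: indicator_def fun_eq_iff)
    then show "(\<lambda>u. indicator {s<..s+t} (s + 1 * u) *\<^sub>R exp (- g (s + 1 * u))) \<in> borel_measurable lborel" by simp
    have "(\<lambda>u. indicator {0..t} u *\<^sub>R exp (- g (s + u))) = (\<lambda>u. indicator {0..t} u *\<^sub>R exp (- g (s + max 0 u)))"
      by (auto simp: indicator_def fun_eq_iff)
    then show "(\<lambda>u. indicator {0..t} u *\<^sub>R exp (- g (s + u))) \<in> borel_measurable lborel" by simp
    show "AE u in lborel. indicator {s<..s+t} (s + 1 * u) *\<^sub>R exp (- g (s + 1 * u)) = indicator {0..t} u *\<^sub>R exp (- g (s + u))"
      using AE_lborel_singleton[of 0] by eventually_elim (auto simp: indicator_def)
  qed
  finally show ?thesis unfolding exp_integral_def .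
qed

lemma exp_integral_mono:
  assumes "cadlag g" "0 \<le> s" "s \<le> t"
  shows "exp_integral s g \<le> exp_integral t g"
  using exp_integral_split[OF assms(1), of s "t - s"] assms exp_integral_nonneg by simp

lemma exp_integral_add_const: "exp_integral T (\<lambda>u. c + g u) = exp (- c) * exp_integral T g"
  unfolding exp_integral_def by (simp add: exp_add[symmetric] algebra_simps exp_diff exp_minus divide_inverse mult.commute flip: set_integral_mult_right)

lemma nn_exp_integral:
  assumes g: "cadlag g" and T: "T \<ge> 0"
  shows "(\<integral>\<^sup>+ t\<in>{0..T}. ennreal (exp (- g t)) \<partial>lborel) = ennreal (exp_integral T g)"
proof -
  have "ennreal (exp_integral T g) = (\<integral>\<^sup>+ t. ennreal (indicator {0..T} t *\<^sub>R exp (- g t)) \<partial>lborel)"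
    unfolding exp_integral_def set_lebesgue_integral_def
    using exp_integral_integrable[OF g T] unfolding set_integrable_def
    by (intro nn_integral_eq_integral[symmetric]) (auto simp: indicator_def)
  also have "\<dots> = (\<integral>\<^sup>+ t\<in>{0..T}. ennreal (exp (- g t)) \<partial>lborel)"
    by (intro nn_integral_cong) (auto simp: indicator_def)
  finally show ?thesis ..
qed

text \<open>Monotone convergence over integer horizons turns the infinite horizon into countably
  many truncated conditions.\<close>

lemma exp_functional_le_iff:
  assumes g: "cadlag (\<lambda>t. X t \<omega>)" and x: "x \<ge> 0"
  shows "exp_functional X \<omega> \<le> ennreal x \<longleftrightarrow> (\<forall>n::nat. exp_integral (real n) (\<lambda>t. X t \<omega>) \<le> x)"
proof -
  have [measurable]: "(\<lambda>u. X (max 0 u) \<omega>) \<in> borel_measurable borel" using cadlag_borel_measurable[OF g] .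
  have "exp_functional X \<omega> = (\<integral>\<^sup>+ t. (SUP n::nat. ennreal (exp (- X (max 0 t) \<omega>)) * indicator {0..real n} t) \<partial>lborel)"
    unfolding exp_functional_def
  proof (rule nn_integral_cong)
    fix t :: real
    show "ennreal (exp (- X t \<omega>)) * indicator {0..} t = (SUP n::nat. ennreal (exp (- X (max 0 t) \<omega>)) * indicator {0..real n} t)"
    proof (cases "t \<ge> 0")
      case True
      obtain n0 where "t \<le> real n0" using real_arch_simple by blast
      then show ?thesis using True
        by (intro antisym SUP_least) (auto intro!: SUP_upper2[of n0] simp: indicator_def max_def)
    qed (simp add: indicator_def)
  qed
  also have "\<dots> = (SUP n::nat. \<integral>\<^sup>+ t. ennreal (exp (- X (max 0 t) \<omega>)) * indicator {0..real n} t \<partial>lborel)"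
    by (intro nn_integral_monotone_convergence_SUP) (auto simp: incseq_def le_fun_def indicator_def intro!: mult_left_mono)
  also have "\<dots> = (SUP n::nat. ennreal (exp_integral (real n) (\<lambda>t. X t \<omega>)))"
  proof (rule SUP_cong[OF refl])
    fix n :: nat
    show "(\<integral>\<^sup>+ t. ennreal (exp (- X (max 0 t) \<omega>)) * indicator {0..real n} t \<partial>lborel) = ennreal (exp_integral (real n) (\<lambda>t. X t \<omega>))"
      unfolding nn_exp_integral[OF g, of "real n", simplified, symmetric]
      by (rule nn_integral_cong) (auto simp: indicator_def max_def)
  qed
  finally show ?thesis using x by (simp add: SUP_le_iff exp_integral_nonneg)
qed

lemma riemann_sum_path_measurable:
  assumes T: "T \<ge> 0" and X: "\<And>s. s \<ge> 0 \<Longrightarrow> (\<lambda>x. X x s) \<in> borel_measurable M"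
  shows "(\<lambda>x. riemann_sum T n (X x)) \<in> borel_measurable M"
proof -
  have [measurable]: "(\<lambda>x. X x (real (Suc k) * (T / n))) \<in> borel_measurable M" for k
    using X T by simp
  show ?thesis unfolding riemann_sum_def by measurable
qed

lemma exp_integral_measurable:
  assumes T: "T > 0" and X: "\<And>s. s \<ge> 0 \<Longrightarrow> (\<lambda>x. X x s) \<in> borel_measurable M"
    and cad: "\<And>x. x \<in> space M \<Longrightarrow> cadlag (X x)"
  shows "(\<lambda>x. exp_integral T (X x)) \<in> borel_measurable M"
  by (rule borel_measurable_LIMSEQ_metric[OF riemann_sum_path_measurable[OF less_imp_le[OF T] X] riemann_sum_tendsto[OF cad T]])

text \<open>
  Measurable on the space of all paths, where the integral itself makes no sense; junk unless the
  Riemann sums converge.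
\<close>

definition path_exp_integral :: "real \<Rightarrow> (real \<Rightarrow> real) \<Rightarrow> real" where
  "path_exp_integral T g = lim (\<lambda>n. riemann_sum T n g)"

lemma path_exp_integral_measurable:
  assumes T: "T \<ge> 0" and X: "\<And>s. s \<ge> 0 \<Longrightarrow> (\<lambda>x. X x s) \<in> borel_measurable M"
  shows "(\<lambda>x. path_exp_integral T (X x)) \<in> borel_measurable M"
  unfolding path_exp_integral_def using riemann_sum_path_measurable[OF assms] by (rule borel_measurable_lim_metric)

lemma path_exp_integral_restrict:
  assumes g: "cadlag g" and T: "T > 0"
  shows "path_exp_integral T (restrict g {0..}) = exp_integral T g"
proof -
  have "riemann_sum T n (restrict g {0..}) = riemann_sum T n g" for n
    unfolding riemann_sum_def using T by (intro sum.cong) auto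
  then show ?thesis unfolding path_exp_integral_def using riemann_sum_tendsto[OF g T] by (simp add: limI)
qed

section \<open>The law of the conditioned process\<close>

lemma past_subalgebra:
  assumes X: "\<And>u. 0 \<le> u \<Longrightarrow> u \<le> s \<Longrightarrow> X u \<in> borel_measurable N"
  shows "subalgebra N (past N X s)"
    and "0 \<le> u \<Longrightarrow> u \<le> s \<Longrightarrow> X u \<in> borel_measurable (past N X s)"
proof -
  let ?G = "\<Union>u\<in>{0..s}. {X u -` B \<inter> space N |B. B \<in> sets borel}"
  have G: "?G \<subseteq> sets N" using X by (auto intro: measurable_sets)
  have Gp: "?G \<subseteq> Pow (space N)" by auto
  have sets_past: "sets (past N X s) = sigma_sets (space N) ?G"
    unfolding past_def using Gp by (rule sets_measure_of)
  have space_past: "space (past N X s) = space N"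
    unfolding past_def using Gp by (rule space_measure_of)
  show "subalgebra N (past N X s)"
    unfolding subalgebra_def space_past sets_past using sets.sigma_sets_subset[OF G] by simp
  show "X u \<in> borel_measurable (past N X s)" if "0 \<le> u" "u \<le> s"
  proof (rule measurableI)
    fix A :: "real set" assume "A \<in> sets borel"
    then show "X u -` A \<inter> space (past N X s) \<in> sets (past N X s)"
      unfolding sets_past space_past using that by (intro sigma_sets.Basic UN_I[of u]) auto
  qed simp
qed

text \<open>The kernel describes the conditional probability of one event \<open>A\<close> almost
  surely; integrating against a bounded function of the past removes the exceptional set, which
  depends on \<open>A\<close>.\<close>

lemma markov_process_one_step:
  assumes mp: "markov_process N X E P x" and s: "s \<ge> 0" and t: "t \<ge> 0" and A: "A \<in> sets borel"
    and F: "F \<in> borel_measurable (past N X s)" "\<And>\<omega>. 0 \<le> F \<omega>" "\<And>\<omega>. F \<omega> \<le> (1::real)"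
    and P: "(\<lambda>\<omega>. measure (P t (X s \<omega>)) A) \<in> borel_measurable N"
  shows "(\<integral>\<omega>. F \<omega> * indicator A (X (s + t) \<omega>) \<partial>N) = (\<integral>\<omega>. F \<omega> * measure (P t (X s \<omega>)) A \<partial>N)"
    and "integrable N (\<lambda>\<omega>. F \<omega> * measure (P t (X s \<omega>)) A)"
proof -
  interpret prob_space N using mp by (simp add: markov_process_def cadlag_process_def)
  have X: "X u \<in> borel_measurable N" if "u \<ge> 0" for u
    using mp that by (simp add: markov_process_def cadlag_process_def)
  interpret sub: finite_measure_subalgebra N "past N X s"
    by unfold_locales (rule past_subalgebra(1)[OF X])
  have F': "F \<in> borel_measurable N"
    by (rule measurable_from_subalg[OF sub.subalg F(1)])
  have ind: "(\<lambda>\<omega>. indicator A (X (s + t) \<omega>) :: real) \<in> borel_measurable N"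
    by (rule measurable_compose[OF X borel_measurable_indicator[OF A]]) (use s t in simp)
  have "integrable N (\<lambda>\<omega>. F \<omega> * indicator A (X (s + t) \<omega>))"
  proof (rule integrable_const_bound[where B=1])
    show "AE \<omega> in N. norm (F \<omega> * indicator A (X (s + t) \<omega>)) \<le> 1"
      using F(2,3) by (intro AE_I2) (simp add: indicator_def)
  qed (use F' ind in simp)
  note * = sub.real_cond_exp_intg[OF this F(1) ind]
  have "AE \<omega> in N. real_cond_exp N (past N X s) (\<lambda>\<omega>. indicator A (X (s + t) \<omega>)) \<omega> = measure (P t (X s \<omega>)) A"
    using mp s t A unfolding markov_process_def by blast
  then have ae: "AE \<omega> in N. F \<omega> * real_cond_exp N (past N X s) (\<lambda>\<omega>. indicator A (X (s + t) \<omega>)) \<omega> = F \<omega> * measure (P t (X s \<omega>)) A"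
    by eventually_elim simp
  have m1: "(\<lambda>\<omega>. F \<omega> * real_cond_exp N (past N X s) (\<lambda>\<omega>. indicator A (X (s + t) \<omega>)) \<omega>) \<in> borel_measurable N"
    using *(1) by (rule borel_measurable_integrable)
  have m2: "(\<lambda>\<omega>. F \<omega> * measure (P t (X s \<omega>)) A) \<in> borel_measurable N"
    using F' P by (rule borel_measurable_times)
  show "(\<integral>\<omega>. F \<omega> * indicator A (X (s + t) \<omega>) \<partial>N) = (\<integral>\<omega>. F \<omega> * measure (P t (X s \<omega>)) A \<partial>N)"
    unfolding *(2)[symmetric] by (rule integral_cong_AE[OF m1 m2 ae])
  show "integrable N (\<lambda>\<omega>. F \<omega> * measure (P t (X s \<omega>)) A)"
    using *(1) integrable_cong_AE[OF m1 m2 ae] by blast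
qed

section \<open>The process killed at zero\<close>

context levy begin

definition survival :: "real \<Rightarrow> real \<Rightarrow> 'a set" where
  "survival t x = {\<omega>\<in>space M. stays_pos t (\<lambda>s. x + V s \<omega>)}"

lemma V_add_cadlag: "\<omega> \<in> space M \<Longrightarrow> cadlag (\<lambda>s. x + V s \<omega>)"
  using cadlag_shift[OF V_cadlag, of \<omega> 0 x] by simp

lemma survival_rat: "t \<ge> 0 \<Longrightarrow> survival t x = {\<omega>\<in>space M. stays_pos_rat t (\<lambda>s. x + V s \<omega>)}"
  unfolding survival_def using stays_pos_rat_iff[OF V_add_cadlag] by auto

lemma survival_sets: "t \<ge> 0 \<Longrightarrow> survival t x \<in> sets M"
  unfolding survival_rat by (rule stays_pos_rat_measurable[unfolded pred_def]) simp_all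

lemma survival_INF: "t \<ge> 0 \<Longrightarrow> {\<omega>\<in>space M. 0 < (INF s\<in>{0..t}. x + V s \<omega>)} = survival t x"
  unfolding survival_def using stays_pos_iff_INF[OF V_add_cadlag] by auto

lemma survival_pos: "t \<ge> 0 \<Longrightarrow> \<omega> \<in> survival t x \<Longrightarrow> 0 < x + V t \<omega>"
  unfolding survival_def stays_pos_def by force

end

section \<open>Kernels of mass one and harmonicity of \<open>W\<close>\<close>

locale conditioned_levy = levy M V for M :: "'a measure" and V +
  fixes W :: "real \<Rightarrow> real" and N :: "real \<Rightarrow> 'b measure" and U :: "real \<Rightarrow> real \<Rightarrow> 'b \<Rightarrow> real"
  assumes W_nonneg: "\<And>x. x \<ge> 0 \<Longrightarrow> 0 \<le> W x"
    and W_mono: "mono_on {0..} W"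
    and up: "\<And>x. x > 0 \<Longrightarrow> markov_process (N x) (U x) {0<..} (up_kernel M V W) x"
begin

text \<open>The Borel version of \<open>W\<close>, whose values on the negative half-line are unspecified.\<close>

definition Wp :: "real \<Rightarrow> real" where
  "Wp y = indicator {0<..} y * W y"

lemma Wp_nonneg: "0 \<le> Wp y"
  using W_nonneg by (simp add: Wp_def indicator_def)

lemma Wp_mono: "mono Wp"
  using W_mono W_nonneg by (auto simp: mono_def Wp_def indicator_def mono_on_def)

lemma Wp_measurable[measurable]: "Wp \<in> borel_measurable borel"
  by (rule borel_measurable_mono[OF Wp_mono])

lemma Wp_pos_eq: "y > 0 \<Longrightarrow> Wp y = W y"
  by (simp add: Wp_def)

lemma up_kernel_emeasure:
  assumes t: "t \<ge> 0" and A: "A \<in> sets borel" and x: "x > 0"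
  shows "emeasure (up_kernel M V W t x) A =
    (\<integral>\<^sup>+\<omega>. indicator (survival t x) \<omega> * (indicator A (x + V t \<omega>) * ennreal (Wp (x + V t \<omega>) / Wp x)) \<partial>M)"
proof -
  have [measurable]: "V t \<in> borel_measurable M" "A \<in> sets borel" "survival t x \<in> sets M"
    using t A survival_sets by auto
  have eq: "indicator {0<..} y * (W y / W x) = Wp y / Wp x" for y
    using x by (simp add: Wp_def)
  have "emeasure (up_kernel M V W t x) A =
      emeasure (density (distr (density M (indicator (survival t x))) borel (\<lambda>\<omega>. x + V t \<omega>)) (\<lambda>y. ennreal (Wp y / Wp x))) A"
    unfolding up_kernel_def killed_law_def survival_INF[OF t] eq ..
  also have "\<dots> = (\<integral>\<^sup>+y. ennreal (Wp y / Wp x) * indicator A y \<partial>distr (density M (indicator (survival t x))) borel (\<lambda>\<omega>. x + V t \<omega>))"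
    by (rule emeasure_density) auto
  also have "\<dots> = (\<integral>\<^sup>+\<omega>. ennreal (Wp (x + V t \<omega>) / Wp x) * indicator A (x + V t \<omega>) \<partial>density M (indicator (survival t x)))"
    by (rule nn_integral_distr) measurable
  also have "\<dots> = (\<integral>\<^sup>+\<omega>. indicator (survival t x) \<omega> * (ennreal (Wp (x + V t \<omega>) / Wp x) * indicator A (x + V t \<omega>)) \<partial>M)"
    by (rule nn_integral_density) measurable
  finally show ?thesis by (simp only: mult.commute[of "indicator A _"])
qed

lemma U_prob_space: "x > 0 \<Longrightarrow> prob_space (N x)"
  using up by (simp add: markov_process_def cadlag_process_def)

lemma U_measurable: "x > 0 \<Longrightarrow> t \<ge> 0 \<Longrightarrow> U x t \<in> borel_measurable (N x)"
  using up[of x] by (simp add: markov_process_def cadlag_process_def)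

lemma U_pos: "x > 0 \<Longrightarrow> t \<ge> 0 \<Longrightarrow> \<omega> \<in> space (N x) \<Longrightarrow> U x t \<omega> > 0"
  using up[of x] unfolding markov_process_def by auto

lemma U_start: "x > 0 \<Longrightarrow> AE \<omega> in N x. U x 0 \<omega> = x"
  using up[of x] unfolding markov_process_def by auto

text \<open>Infinite lifetime in terms of the kernel: take the sure event in the Markov property at
  time 0. Its conditional probability is 1, and the starting point is \<open>x\<close> almost
  surely.\<close>

lemma up_kernel_mass:
  assumes x: "x > 0" and t: "t \<ge> 0"
  shows "emeasure (up_kernel M V W t x) UNIV = 1"
proof -
  interpret Nx: prob_space "N x" by (rule U_prob_space[OF x])
  have "AE \<omega> in N x. real_cond_exp (N x) (past (N x) (U x) 0) (\<lambda>\<omega>. indicator UNIV (U x (0 + t) \<omega>)) \<omega>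
      = measure (up_kernel M V W t (U x 0 \<omega>)) UNIV"
  proof -
    have "(UNIV :: real set) \<in> sets borel" "(0::real) \<le> 0" by simp_all
    then show ?thesis using up[OF x] t unfolding markov_process_def by blast
  qed
  note ke = this
  interpret sub: finite_measure_subalgebra "N x" "past (N x) (U x) 0"
    by unfold_locales (rule past_subalgebra(1)[OF U_measurable[OF x]])
  have one: "AE \<omega> in N x. real_cond_exp (N x) (past (N x) (U x) 0) (\<lambda>\<omega>. 1) \<omega> = 1"
    by (rule sub.real_cond_exp_F_meas) auto
  have "AE \<omega> in N x. measure (up_kernel M V W t x) UNIV = 1"
    using ke one U_start[OF x] by eventually_elim simp
  then have "measure (up_kernel M V W t x) UNIV = 1" by simp
  \<comment> \<open>The value 1 excludes infinite mass, for which \<open>measure\<close> would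
    return 0.\<close>
  then show ?thesis
    by (metis emeasure_eq_ennreal_measure ennreal_1 enn2real_top measure_def zero_neq_one)
qed

text \<open>Division by zero yields 0, so at a zero of \<open>W\<close> the kernel would have no
  mass, against \<open>up_kernel_mass\<close>.\<close>

lemma W_pos:
  assumes x: "x > 0" shows "0 < W x"
proof (rule ccontr)
  assume "\<not> 0 < W x"
  then have "Wp x = 0" using W_nonneg[of x] x by (simp add: Wp_def)
  then have "emeasure (up_kernel M V W 0 x) UNIV = 0"
    by (subst up_kernel_emeasure) (use x in auto)
  then show False using up_kernel_mass[OF x, of 0] by simp
qed

lemma Wp_pos: "x > 0 \<Longrightarrow> 0 < Wp x"
  using W_pos by (simp add: Wp_pos_eq)

lemma W_harmonic:
  assumes x: "x > 0" and t: "t \<ge> 0"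
  shows "(\<integral>\<^sup>+\<omega>. indicator (survival t x) \<omega> * ennreal (Wp (x + V t \<omega>)) \<partial>M) = ennreal (Wp x)"
proof -
  have [measurable]: "V t \<in> borel_measurable M" "survival t x \<in> sets M" using t survival_sets by auto
  have "ennreal (Wp x) = ennreal (Wp x) * (\<integral>\<^sup>+\<omega>. indicator (survival t x) \<omega> * ennreal (Wp (x + V t \<omega>) / Wp x) \<partial>M)"
    using up_kernel_mass[OF x t] by (subst (asm) up_kernel_emeasure) (use x t in auto)
  also have "\<dots> = (\<integral>\<^sup>+\<omega>. ennreal (Wp x) * (indicator (survival t x) \<omega> * ennreal (Wp (x + V t \<omega>) / Wp x)) \<partial>M)"
    by (rule nn_integral_cmult[symmetric]) measurable
  also have "\<dots> = (\<integral>\<^sup>+\<omega>. indicator (survival t x) \<omega> * ennreal (Wp (x + V t \<omega>)) \<partial>M)"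
  proof (rule nn_integral_cong)
    fix \<omega>
    show "ennreal (Wp x) * (indicator (survival t x) \<omega> * ennreal (Wp (x + V t \<omega>) / Wp x)) = indicator (survival t x) \<omega> * ennreal (Wp (x + V t \<omega>))"
      using Wp_pos[OF x] Wp_nonneg by (simp add: indicator_def ennreal_mult[symmetric])
  qed
  finally show ?thesis ..
qed

end

section \<open>Comparison of the two processes along a grid\<close>

context conditioned_levy begin

text \<open>The weight of one step of length \<open>d\<close> from \<open>u\<close>, as a function
  of the increment path \<open>f\<close>. Through \<open>stays_pos_rat\<close> it is measurable on
  the path space, so an independent future path can be inserted.\<close>

definition step_weight :: "real \<Rightarrow> real set \<Rightarrow> real \<Rightarrow> (real \<Rightarrow> real) \<Rightarrow> ennreal" where
  "step_weight d A u f =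
     (if stays_pos_rat d (\<lambda>s. u + f s) then indicator A (u + f d) * ennreal (Wp (u + f d) / Wp u) else 0)"

lemma step_weight_measurable:
  assumes d: "d \<ge> 0" and A: "A \<in> sets borel" and X: "X \<in> borel_measurable K"
    and F: "\<And>s. s \<ge> 0 \<Longrightarrow> (\<lambda>x. F x s) \<in> borel_measurable K"
  shows "(\<lambda>x. step_weight d A (X x) (F x)) \<in> borel_measurable K"
proof -
  have p: "Measurable.pred K (\<lambda>x. stays_pos_rat d (\<lambda>s. X x + F x s))"
    by (rule stays_pos_rat_measurable[OF d]) (intro borel_measurable_add X F)
  have [measurable]: "X \<in> borel_measurable K" "(\<lambda>x. F x d) \<in> borel_measurable K" "A \<in> sets borel"
    using X F[OF d] A by auto
  have "(\<lambda>x. indicator A (X x + F x d) * ennreal (Wp (X x + F x d) / Wp (X x))) \<in> borel_measurable K"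
    by measurable
  then show ?thesis
    unfolding step_weight_def by (rule measurable_If[OF _ borel_measurable_const p[unfolded pred_def]])
qed

definition step_kernel :: "real \<Rightarrow> real set \<Rightarrow> real \<Rightarrow> ennreal" where
  "step_kernel d A u = (\<integral>\<^sup>+\<omega>. step_weight d A u (\<lambda>s. V s \<omega>) \<partial>M)"

lemma step_kernel_measurable:
  assumes d: "d \<ge> 0" and A: "A \<in> sets borel"
  shows "step_kernel d A \<in> borel_measurable borel"
proof -
  have "(\<lambda>p. step_weight d A (fst p) (\<lambda>s. V s (snd p))) \<in> borel_measurable (borel \<Otimes>\<^sub>M M)"
    by (rule step_weight_measurable[OF d A measurable_fst]) (rule measurable_compose[OF measurable_snd V_measurable])
  then show ?thesis unfolding step_kernel_def
    by (intro borel_measurable_nn_integral) (simp add: case_prod_beta)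
qed

lemma up_kernel_step_kernel:
  assumes d: "d \<ge> 0" and A: "A \<in> sets borel" and u: "u > 0"
  shows "emeasure (up_kernel M V W d u) A = step_kernel d A u"
  unfolding up_kernel_emeasure[OF d A u] step_kernel_def step_weight_def survival_rat[OF d]
  by (rule nn_integral_cong) (simp add: indicator_def)

text \<open>The Markov property is stated with the real-valued \<open>measure\<close>; total mass 1
  makes the passage to \<open>ennreal\<close> faithful.\<close>

lemma up_kernel_measure:
  assumes d: "d \<ge> 0" and A: "A \<in> sets borel" and u: "u > 0"
  shows "ennreal (measure (up_kernel M V W d u) A) = step_kernel d A u"
proof -
  have "emeasure (up_kernel M V W d u) A \<le> emeasure (up_kernel M V W d u) UNIV"
    by (rule emeasure_mono) (auto simp: up_kernel_def killed_law_def)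
  then have "emeasure (up_kernel M V W d u) A \<noteq> \<top>" using up_kernel_mass[OF u d] by (auto simp: top_unique)
  then show ?thesis using emeasure_eq_ennreal_measure up_kernel_step_kernel[OF assms] by metis
qed

text \<open>The Markov property of \<open>U x\<close> integrates out the last position and leaves a
  function of the position before it. \<open>chain_step_levy\<close> is the reverse operation for
  \<open>V\<close>; between the two, an induction hypothesis moves the rest of the chain from
  \<open>N x\<close> to \<open>M\<close>.\<close>

lemma chain_step:
  assumes x: "x > 0" and d: "d \<ge> 0" and B: "\<And>k. B k \<in> sets borel" and A: "A \<in> sets borel"
  shows "(\<integral>\<^sup>+\<omega>. indicator {\<omega>\<in>space (N x). \<forall>k<Suc n. U x (real k * d) \<omega> \<in> B k} \<omega> *
       indicator A (U x (real (Suc n) * d) \<omega>) \<partial>N x) =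
    (\<integral>\<^sup>+\<omega>. indicator {\<omega>\<in>space (N x). \<forall>k<n. U x (real k * d) \<omega> \<in> B k} \<omega> *
       (indicator (B n) (U x (real n * d) \<omega>) * step_kernel d A (U x (real n * d) \<omega>)) \<partial>N x)"
proof -
  interpret Nx: prob_space "N x" by (rule U_prob_space[OF x])
  define E where "E = {\<omega>\<in>space (N x). \<forall>k<Suc n. U x (real k * d) \<omega> \<in> B k}"
  define s where "s = real n * d"
  have s: "s \<ge> 0" using d by (simp add: s_def)
  have kd: "0 \<le> real k * d" "k < Suc n \<Longrightarrow> real k * d \<le> s" for k
    using d unfolding s_def by (auto intro: mult_right_mono)
  have ssuc: "real (Suc n) * d = s + d" unfolding s_def by (simp add: distrib_right)
  have sub: "subalgebra (N x) (past (N x) (U x) s)"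
    by (rule past_subalgebra(1)[OF U_measurable[OF x]])
  have E: "E \<in> sets (past (N x) (U x) s)"
  proof -
    have "{\<omega>\<in>space (past (N x) (U x) s). \<forall>k\<in>{..<Suc n}. U x (real k * d) \<omega> \<in> B k} \<in> sets (past (N x) (U x) s)"
      using kd by (intro sets_Collect_finite_Ball_in[where N=borel] past_subalgebra(2) U_measurable[OF x] B) auto
    moreover have "space (past (N x) (U x) s) = space (N x)" using sub by (simp add: subalgebra_def)
    ultimately show ?thesis unfolding E_def by (simp only: lessThan_iff Ball_def)
  qed
  then have EN: "E \<in> sets (N x)" using sub unfolding subalgebra_def by auto
  have Us: "U x s \<in> borel_measurable (N x)" by (rule U_measurable[OF x s])
  have meq: "measure (up_kernel M V W d (U x s \<omega>)) A = enn2real (step_kernel d A (U x s \<omega>))" if "\<omega> \<in> space (N x)" for \<omega>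
    using up_kernel_measure[OF d A U_pos[OF x s that]] by (metis enn2real_ennreal measure_nonneg)
  have P: "(\<lambda>\<omega>. measure (up_kernel M V W d (U x s \<omega>)) A) \<in> borel_measurable (N x)"
    by (subst measurable_cong[OF meq])
      (auto intro!: borel_measurable_enn2real measurable_compose[OF Us step_kernel_measurable[OF d A]])
  have F: "(indicator E :: _ \<Rightarrow> real) \<in> borel_measurable (past (N x) (U x) s)" "\<And>\<omega>. 0 \<le> (indicator E \<omega> :: real)" "\<And>\<omega>. indicator E \<omega> \<le> (1 :: real)"
    using E by (auto simp: indicator_def)
  note os = markov_process_one_step[OF up[OF x] s d A F P]
  have int: "integrable (N x) (\<lambda>\<omega>. indicator E \<omega> * indicator A (U x (s + d) \<omega>) :: real)"
  proof (rule Nx.integrable_const_bound[where B=1])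
    show "(\<lambda>\<omega>. indicator E \<omega> * indicator A (U x (s + d) \<omega>) :: real) \<in> borel_measurable (N x)"
      using EN U_measurable[OF x, of "s + d"] s d A
      by (intro borel_measurable_times borel_measurable_indicator measurable_compose[OF _ borel_measurable_indicator[OF A]]) auto
  qed (simp add: indicator_def)
  have "(\<integral>\<^sup>+\<omega>. indicator E \<omega> * indicator A (U x (s + d) \<omega>) \<partial>N x) =
     (\<integral>\<^sup>+\<omega>. ennreal (indicator E \<omega> * indicator A (U x (s + d) \<omega>)) \<partial>N x)"
    by (rule nn_integral_cong) (simp add: indicator_def)
  also have "\<dots> = ennreal (\<integral>\<omega>. indicator E \<omega> * indicator A (U x (s + d) \<omega>) \<partial>N x)"
    by (rule nn_integral_eq_integral[OF int]) (simp add: indicator_def)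
  also have "\<dots> = ennreal (\<integral>\<omega>. indicator E \<omega> * measure (up_kernel M V W d (U x s \<omega>)) A \<partial>N x)"
    unfolding os(1) ..
  also have "\<dots> = (\<integral>\<^sup>+\<omega>. ennreal (indicator E \<omega> * measure (up_kernel M V W d (U x s \<omega>)) A) \<partial>N x)"
    by (rule nn_integral_eq_integral[OF os(2), symmetric]) (simp add: indicator_def)
  also have "\<dots> = (\<integral>\<^sup>+\<omega>. indicator {\<omega>\<in>space (N x). \<forall>k<n. U x (real k * d) \<omega> \<in> B k} \<omega> *
       (indicator (B n) (U x s \<omega>) * step_kernel d A (U x s \<omega>)) \<partial>N x)"
  proof (rule nn_integral_cong)
    fix \<omega> assume w: "\<omega> \<in> space (N x)"
    have "\<omega> \<in> E \<longleftrightarrow> \<omega> \<in> {\<omega>\<in>space (N x). \<forall>k<n. U x (real k * d) \<omega> \<in> B k} \<and> U x s \<omega> \<in> B n"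
      unfolding E_def s_def using less_Suc_eq by auto
    then show "ennreal (indicator E \<omega> * measure (up_kernel M V W d (U x s \<omega>)) A) =
      indicator {\<omega>\<in>space (N x). \<forall>k<n. U x (real k * d) \<omega> \<in> B k} \<omega> * (indicator (B n) (U x s \<omega>) * step_kernel d A (U x s \<omega>))"
      unfolding up_kernel_measure[OF d A U_pos[OF x s w], symmetric]
      by (cases "\<omega> \<in> E") (auto simp: indicator_def)
  qed
  finally show ?thesis unfolding E_def ssuc s_def .
qed

text \<open>
  The weights \<open>Wp(\<cdot>) / Wp(\<cdot>)\<close> telescope along the grid, which leaves a single ratio.
\<close>

lemma chain_step_levy:
  assumes x: "x > 0" and d: "d \<ge> 0" and B: "\<And>k. B k \<in> sets borel" and A: "A \<in> sets borel"
  shows "(\<integral>\<^sup>+\<omega>. indicator {\<omega>\<in>space M. \<forall>k<n. x + V (real k * d) \<omega> \<in> B k} \<omega> *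
       (indicator (survival (real n * d) x) \<omega> * (indicator (B n) (x + V (real n * d) \<omega>) * step_kernel d A (x + V (real n * d) \<omega>) *
         ennreal (Wp (x + V (real n * d) \<omega>) / Wp x))) \<partial>M) =
    (\<integral>\<^sup>+\<omega>. indicator {\<omega>\<in>space M. \<forall>k<Suc n. x + V (real k * d) \<omega> \<in> B k} \<omega> *
       (indicator (survival (real (Suc n) * d) x) \<omega> * (indicator A (x + V (real (Suc n) * d) \<omega>) *
         ennreal (Wp (x + V (real (Suc n) * d) \<omega>) / Wp x))) \<partial>M)"
proof -
  define s where "s = real n * d"
  have s: "s \<ge> 0" using d by (simp add: s_def)
  have kd: "0 \<le> real k * d" "k \<le> n \<Longrightarrow> real k * d \<le> s" for k
    using d unfolding s_def by (auto intro: mult_right_mono)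
  have ssuc: "real (Suc n) * d = s + d" unfolding s_def by (simp add: distrib_right)
  define Q where "Q p \<longleftrightarrow> (\<forall>k\<in>{..<Suc n}. x + p (real k * d) \<in> B k) \<and> stays_pos_rat s (\<lambda>r. x + p r)" for p
  \<comment> \<open>The whole integrand as a function of the past up to \<open>s\<close> and the
    increments after \<open>s\<close>, so that independence can be applied to it at once.\<close>
  define H where "H = (\<lambda>(p, f). if Q p then step_weight d A (x + p s) f * ennreal (Wp (x + p s) / Wp x) else 0)"
  have comp: "(\<lambda>p. fst p r) \<in> borel_measurable (path_space \<Otimes>\<^sub>M path_space)"
     "(\<lambda>p. snd p r) \<in> borel_measurable (path_space \<Otimes>\<^sub>M path_space)" if "r \<ge> 0" for r
    using measurable_compose[OF measurable_fst measurable_path_component[OF that]]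
      measurable_compose[OF measurable_snd measurable_path_component[OF that]] by auto
  have Q: "Measurable.pred (path_space \<Otimes>\<^sub>M path_space) (\<lambda>p. Q (fst p))"
  proof -
    have 1: "Measurable.pred (path_space \<Otimes>\<^sub>M path_space) (\<lambda>p. \<forall>k\<in>{..<Suc n}. x + fst p (real k * d) \<in> B k)"
      unfolding pred_def using kd B
      by (intro sets_Collect_finite_Ball_in[where N=borel] borel_measurable_add borel_measurable_const comp) auto
    have 2: "Measurable.pred (path_space \<Otimes>\<^sub>M path_space) (\<lambda>p. stays_pos_rat s (\<lambda>r. x + fst p r))"
      by (rule stays_pos_rat_measurable[OF s]) (intro borel_measurable_add borel_measurable_const comp)
    show ?thesis unfolding Q_def by (rule pred_intros_logic(3)[OF 1 2])
  qed
  have H: "H \<in> borel_measurable (path_space \<Otimes>\<^sub>M path_space)"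
    unfolding H_def case_prod_beta
  proof (rule measurable_If[OF _ borel_measurable_const Q[unfolded pred_def]])
    have [measurable]: "(\<lambda>p. fst p s) \<in> borel_measurable (path_space \<Otimes>\<^sub>M path_space)" by (rule comp(1)[OF s])
    have "(\<lambda>p. step_weight d A (x + fst p s) (snd p)) \<in> borel_measurable (path_space \<Otimes>\<^sub>M path_space)"
      by (rule step_weight_measurable[OF d A]) (auto intro: comp)
    moreover have "(\<lambda>p. ennreal (Wp (x + fst p s) / Wp x)) \<in> borel_measurable (path_space \<Otimes>\<^sub>M path_space)"
      by measurable
    ultimately show "(\<lambda>p. step_weight d A (x + fst p s) (snd p) * ennreal (Wp (x + fst p s) / Wp x))
        \<in> borel_measurable (path_space \<Otimes>\<^sub>M path_space)"
      by (rule borel_measurable_times_ennreal)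
  qed
  have pastv: "past_path s \<omega> r = V r \<omega>" if "0 \<le> r" "r \<le> s" for r \<omega>
    using that by (simp add: past_path_def)
  have futv: "future_path s \<omega> r = V (s + r) \<omega> - V s \<omega>" if "0 \<le> r" for r \<omega>
    using that by (simp add: future_path_def)
  have futv0: "future_path 0 \<omega> r = V r \<omega>" if "0 \<le> r" "\<omega> \<in> space M" for r \<omega>
    using that by (simp add: future_path_def start)
  have Qiff: "Q (past_path s \<omega>) \<longleftrightarrow> (\<forall>k<n. x + V (real k * d) \<omega> \<in> B k) \<and> x + V s \<omega> \<in> B n \<and> \<omega> \<in> survival s x"
    if w: "\<omega> \<in> space M" for \<omega>
  proof -
    have "stays_pos_rat s (\<lambda>r. x + past_path s \<omega> r) \<longleftrightarrow> \<omega> \<in> survival s x"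
      unfolding survival_rat[OF s] using w stays_pos_rat_cong[OF s, of "\<lambda>r. x + past_path s \<omega> r" "\<lambda>r. x + V r \<omega>"] pastv by simp
    moreover have "(\<forall>k\<in>{..<Suc n}. x + past_path s \<omega> (real k * d) \<in> B k) \<longleftrightarrow> (\<forall>k<Suc n. x + V (real k * d) \<omega> \<in> B k)"
      using pastv kd by auto
    ultimately show ?thesis unfolding Q_def s_def using less_Suc_eq by auto
  qed
  have 1: "indicator {\<omega>\<in>space M. \<forall>k<n. x + V (real k * d) \<omega> \<in> B k} \<omega> *
       (indicator (survival s x) \<omega> * (indicator (B n) (x + V s \<omega>) * step_kernel d A (x + V s \<omega>) *
         ennreal (Wp (x + V s \<omega>) / Wp x))) = (\<integral>\<^sup>+\<omega>'. H (past_path s \<omega>, future_path 0 \<omega>') \<partial>M)"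
    if w: "\<omega> \<in> space M" for \<omega>
  proof (cases "Q (past_path s \<omega>)")
    case True
    have m: "(\<lambda>\<omega>'. step_weight d A (x + V s \<omega>) (\<lambda>s. V s \<omega>')) \<in> borel_measurable M"
      by (rule step_weight_measurable[OF d A]) auto
    have "(\<integral>\<^sup>+\<omega>'. H (past_path s \<omega>, future_path 0 \<omega>') \<partial>M) =
      (\<integral>\<^sup>+\<omega>'. step_weight d A (x + V s \<omega>) (\<lambda>s. V s \<omega>') * ennreal (Wp (x + V s \<omega>) / Wp x) \<partial>M)"
    proof (rule nn_integral_cong)
      fix \<omega>' assume w': "\<omega>' \<in> space M"
      have "stays_pos_rat d (\<lambda>r. x + V s \<omega> + future_path 0 \<omega>' r) \<longleftrightarrow> stays_pos_rat d (\<lambda>r. x + V s \<omega> + V r \<omega>')"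
        by (rule stays_pos_rat_cong[OF d]) (use futv0 w' in simp)
      then show "H (past_path s \<omega>, future_path 0 \<omega>') = step_weight d A (x + V s \<omega>) (\<lambda>s. V s \<omega>') * ennreal (Wp (x + V s \<omega>) / Wp x)"
        using True pastv[OF s order.refl] futv0[OF d w'] by (simp add: H_def step_weight_def)
    qed
    also have "\<dots> = step_kernel d A (x + V s \<omega>) * ennreal (Wp (x + V s \<omega>) / Wp x)"
      unfolding step_kernel_def by (rule nn_integral_multc[OF m])
    finally show ?thesis using True w unfolding Qiff[OF w] by simp
  next
    case False
    then have "(\<integral>\<^sup>+\<omega>'. H (past_path s \<omega>, future_path 0 \<omega>') \<partial>M) = 0"
      by (simp add: H_def)
    then show ?thesis using False Qiff[OF w] w by (auto simp: indicator_def)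
  qed
  have 2: "H (past_path s \<omega>, future_path s \<omega>) = indicator {\<omega>\<in>space M. \<forall>k<Suc n. x + V (real k * d) \<omega> \<in> B k} \<omega> *
       (indicator (survival (s + d) x) \<omega> * (indicator A (x + V (s + d) \<omega>) * ennreal (Wp (x + V (s + d) \<omega>) / Wp x)))"
    if w: "\<omega> \<in> space M" for \<omega>
  proof -
    have iff: "Q (past_path s \<omega>) \<and> stays_pos_rat d (\<lambda>r. x + V s \<omega> + future_path s \<omega> r) \<longleftrightarrow>
      (\<forall>k<Suc n. x + V (real k * d) \<omega> \<in> B k) \<and> \<omega> \<in> survival (s + d) x"
    proof -
      have "stays_pos_rat d (\<lambda>r. x + V s \<omega> + future_path s \<omega> r) \<longleftrightarrow> stays_pos_rat d (\<lambda>r. x + V (s + r) \<omega>)"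
        by (rule stays_pos_rat_cong[OF d]) (use futv in simp)
      also have "\<dots> \<longleftrightarrow> stays_pos d (\<lambda>r. x + V (s + r) \<omega>)"
        by (rule stays_pos_rat_iff[OF cadlag_shift[OF V_cadlag[OF w] s] d])
      finally have "stays_pos_rat d (\<lambda>r. x + V s \<omega> + future_path s \<omega> r) \<longleftrightarrow> stays_pos d (\<lambda>r. x + V (s + r) \<omega>)" .
      then show ?thesis unfolding Qiff[OF w] using w stays_pos_add[OF s d, of "\<lambda>r. x + V r \<omega>"] less_Suc_eq
        unfolding survival_def s_def by auto
    qed
    show ?thesis
    proof (cases "Q (past_path s \<omega>) \<and> stays_pos_rat d (\<lambda>r. x + V s \<omega> + future_path s \<omega> r)")
      case True
      then have "\<omega> \<in> survival s x" using Qiff[OF w] by simp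
      \<comment> \<open>Survival up to \<open>s\<close> makes the position at \<open>s\<close>
        positive, so the intermediate value of \<open>Wp\<close> cancels.\<close>
      then have "0 < Wp (x + V s \<omega>)" using survival_pos[OF s] Wp_pos by blast
      then have "ennreal (Wp (x + V (s + d) \<omega>) / Wp (x + V s \<omega>)) * ennreal (Wp (x + V s \<omega>) / Wp x) = ennreal (Wp (x + V (s + d) \<omega>) / Wp x)"
        using Wp_nonneg Wp_pos[OF x] by (subst ennreal_mult[symmetric]) (auto simp: field_simps)
      then show ?thesis
        using True iff w pastv[OF s order.refl] futv[OF d] unfolding H_def step_weight_def
        by (simp add: mult.assoc)
    next
      case False
      then show ?thesis using iff pastv[OF s order.refl] unfolding H_def step_weight_def
        by (auto simp: indicator_def)
    qed
  qed
  show ?thesis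
    unfolding ssuc unfolding s_def[symmetric]
    by (rule trans, rule nn_integral_cong, erule 1, rule trans, rule markov_nn_integral[OF s H, symmetric],
        rule nn_integral_cong, erule 2)
qed

text \<open>The inductive step is available for indicators only, since kernels are tested on events.
  Both sides are then read as laws of the last position; they agree as measures, and a general
  \<open>g\<close> can be integrated.\<close>

lemma chain:
  assumes x: "x > 0" and d: "d \<ge> 0" and B: "\<And>k. B k \<in> sets borel" and g: "g \<in> borel_measurable borel"
  shows "(\<integral>\<^sup>+\<omega>. indicator {\<omega>\<in>space (N x). \<forall>k<n. U x (real k * d) \<omega> \<in> B k} \<omega> * g (U x (real n * d) \<omega>) \<partial>N x) =
    (\<integral>\<^sup>+\<omega>. indicator {\<omega>\<in>space M. \<forall>k<n. x + V (real k * d) \<omega> \<in> B k} \<omega> *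
       (indicator (survival (real n * d) x) \<omega> * (g (x + V (real n * d) \<omega>) *
         ennreal (Wp (x + V (real n * d) \<omega>) / Wp x))) \<partial>M)"
  using g
proof (induction n arbitrary: g)
  case 0
  interpret Nx: prob_space "N x" by (rule U_prob_space[OF x])
  have "(\<integral>\<^sup>+\<omega>. indicator {\<omega>\<in>space (N x). \<forall>k<0. U x (real k * d) \<omega> \<in> B k} \<omega> * g (U x (real 0 * d) \<omega>) \<partial>N x) = (\<integral>\<^sup>+\<omega>. g x \<partial>N x)"
    by (rule nn_integral_cong_AE) (use AE_space U_start[OF x] in \<open>eventually_elim, simp\<close>)
  also have "\<dots> = g x" by (simp add: Nx.emeasure_space_1)
  finally have l: "(\<integral>\<^sup>+\<omega>. indicator {\<omega>\<in>space (N x). \<forall>k<0. U x (real k * d) \<omega> \<in> B k} \<omega> * g (U x (real 0 * d) \<omega>) \<partial>N x) = g x" .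
  have s0: "survival 0 x = space M" using x start by (auto simp: survival_def stays_pos_def intro!: exI[of _ x])
  have "(\<integral>\<^sup>+\<omega>. indicator {\<omega>\<in>space M. \<forall>k<0. x + V (real k * d) \<omega> \<in> B k} \<omega> *
       (indicator (survival (real 0 * d) x) \<omega> * (g (x + V (real 0 * d) \<omega>) *
         ennreal (Wp (x + V (real 0 * d) \<omega>) / Wp x))) \<partial>M) = (\<integral>\<^sup>+\<omega>. g x \<partial>M)"
    by (rule nn_integral_cong) (use Wp_pos[OF x] in \<open>simp add: s0 start\<close>)
  then show ?case unfolding l by (simp add: emeasure_space_1)
next
  case (Suc n)
  define sn where "sn = real (Suc n) * d"
  define E where "E = {\<omega>\<in>space (N x). \<forall>k<Suc n. U x (real k * d) \<omega> \<in> B k}"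
  define E' where "E' = {\<omega>\<in>space M. \<forall>k<Suc n. x + V (real k * d) \<omega> \<in> B k}"
  define h where "h \<omega> = indicator E' \<omega> * (indicator (survival sn x) \<omega> * ennreal (Wp (x + V sn \<omega>) / Wp x))" for \<omega>
  have kd: "0 \<le> real k * d" for k using d by simp
  have sn: "0 \<le> sn" unfolding sn_def by (rule kd)
  have E: "E \<in> sets (N x)"
  proof -
    have "{\<omega>\<in>space (N x). \<forall>k\<in>{..<Suc n}. U x (real k * d) \<omega> \<in> B k} \<in> sets (N x)"
      using kd by (intro sets_Collect_finite_Ball_in[where N=borel] U_measurable[OF x] B) auto
    then show ?thesis unfolding E_def by (simp only: lessThan_iff Ball_def)
  qed
  have E': "E' \<in> sets M"
  proof -
    have "{\<omega>\<in>space M. \<forall>k\<in>{..<Suc n}. x + V (real k * d) \<omega> \<in> B k} \<in> sets M"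
      using kd by (intro sets_Collect_finite_Ball_in[where N=borel] borel_measurable_add borel_measurable_const V_measurable B) auto
    then show ?thesis unfolding E'_def by (simp only: lessThan_iff Ball_def)
  qed
  have U: "U x sn \<in> borel_measurable (N x)" by (rule U_measurable[OF x sn])
  have V: "(\<lambda>\<omega>. x + V sn \<omega>) \<in> borel_measurable M" by (intro borel_measurable_add borel_measurable_const V_measurable sn)
  have h: "h \<in> borel_measurable M"
  proof -
    have [measurable]: "E' \<in> sets M" "survival sn x \<in> sets M" "V sn \<in> borel_measurable M"
      using E' survival_sets[OF sn] V_measurable[OF sn] by auto
    show ?thesis unfolding h_def by measurable
  qed
  have ind: "(\<integral>\<^sup>+\<omega>. indicator E \<omega> * indicator A (U x sn \<omega>) \<partial>N x) = (\<integral>\<^sup>+\<omega>. h \<omega> * indicator A (x + V sn \<omega>) \<partial>M)"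
    if A: "A \<in> sets borel" for A
  proof -
    \<comment> \<open>The induction hypothesis is applied to this function instead of
      \<open>g\<close>, whence the induction over arbitrary \<open>g\<close>.\<close>
    have gm: "(\<lambda>u. indicator (B n) u * step_kernel d A u) \<in> borel_measurable borel"
      using step_kernel_measurable[OF d A] B by (intro borel_measurable_times_ennreal borel_measurable_indicator) auto
    show ?thesis
      unfolding E_def sn_def
      by (rule trans[OF chain_step[OF x d B A]], rule trans[OF Suc.IH[OF gm]], rule trans[OF chain_step_levy[OF x d B A]],
          rule nn_integral_cong) (simp add: h_def E'_def sn_def mult_ac)
  qed
  have "distr (density (N x) (indicator E)) borel (U x sn) = distr (density M h) borel (\<lambda>\<omega>. x + V sn \<omega>)"
  proof (rule measure_eqI)
    fix A assume "A \<in> sets (distr (density (N x) (indicator E)) borel (U x sn))"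
    then have A: "A \<in> sets borel" by simp
    have "emeasure (distr (density (N x) (indicator E)) borel (U x sn)) A = (\<integral>\<^sup>+\<omega>. indicator E \<omega> * indicator A (U x sn \<omega>) \<partial>N x)"
      using A U E by (simp add: emeasure_distr emeasure_density measurable_sets) (rule nn_integral_cong, simp add: indicator_def)
    also have "\<dots> = emeasure (distr (density M h) borel (\<lambda>\<omega>. x + V sn \<omega>)) A"
      unfolding ind[OF A] using A V h
      by (subst emeasure_distr) (simp_all add: emeasure_density measurable_sets, intro nn_integral_cong, simp add: indicator_def)
    finally show "emeasure (distr (density (N x) (indicator E)) borel (U x sn)) A = emeasure (distr (density M h) borel (\<lambda>\<omega>. x + V sn \<omega>)) A" .
  qed simp
  then have "(\<integral>\<^sup>+u. g u \<partial>distr (density (N x) (indicator E)) borel (U x sn)) = (\<integral>\<^sup>+u. g u \<partial>distr (density M h) borel (\<lambda>\<omega>. x + V sn \<omega>))"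
    by simp
  also have "(\<integral>\<^sup>+u. g u \<partial>distr (density (N x) (indicator E)) borel (U x sn)) = (\<integral>\<^sup>+\<omega>. indicator E \<omega> * g (U x sn \<omega>) \<partial>N x)"
    using U E Suc.prems by (simp add: nn_integral_distr nn_integral_density measurable_compose[OF U])
  also have "(\<integral>\<^sup>+u. g u \<partial>distr (density M h) borel (\<lambda>\<omega>. x + V sn \<omega>)) = (\<integral>\<^sup>+\<omega>. h \<omega> * g (x + V sn \<omega>) \<partial>M)"
    using V h Suc.prems by (simp add: nn_integral_distr nn_integral_density measurable_compose[OF V])
  also have "\<dots> = (\<integral>\<^sup>+\<omega>. indicator E' \<omega> * (indicator (survival sn x) \<omega> * (g (x + V sn \<omega>) * ennreal (Wp (x + V sn \<omega>) / Wp x))) \<partial>M)"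
    by (rule nn_integral_cong) (simp add: h_def mult_ac)
  finally show ?case unfolding E_def E'_def sn_def .
qed

end

context conditioned_levy begin

text \<open>Cylinders determine the joint law of the grid positions, and \<open>chain\<close>
  evaluates them. The law of \<open>U x\<close> on the grid thus has a density with respect to that
  of the killed process, and this density involves only the final position.\<close>

lemma grid_law:
  assumes x: "x > 0" and d: "d \<ge> 0" and F: "F \<in> borel_measurable (PiM {..n} (\<lambda>_. borel))"
  shows "(\<integral>\<^sup>+\<omega>. F (\<lambda>k\<in>{..n}. U x (real k * d) \<omega>) \<partial>N x) =
    (\<integral>\<^sup>+\<omega>. indicator (survival (real n * d) x) \<omega> * ennreal (Wp (x + V (real n * d) \<omega>) / Wp x) *
       F (\<lambda>k\<in>{..n}. x + V (real k * d) \<omega>) \<partial>M)"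
proof -
  let ?X = "\<lambda>\<omega>. \<lambda>k\<in>{..n}. U x (real k * d) \<omega>"
  let ?Y = "\<lambda>\<omega>. \<lambda>k\<in>{..n}. x + V (real k * d) \<omega>"
  interpret Nx: prob_space "N x" by (rule U_prob_space[OF x])
  let ?P = "PiM {..n} (\<lambda>_. borel :: real measure)"
  define s where "s = real n * d"
  define h where "h \<omega> = indicator (survival s x) \<omega> * ennreal (Wp (x + V s \<omega>) / Wp x)" for \<omega>
  have kd: "0 \<le> real k * d" for k using d by simp
  have s: "0 \<le> s" unfolding s_def by (rule kd)
  have h: "h \<in> borel_measurable M"
  proof -
    have [measurable]: "survival s x \<in> sets M" "V s \<in> borel_measurable M"
      using survival_sets[OF s] V_measurable[OF s] by auto
    show ?thesis unfolding h_def by measurable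
  qed
  have X: "?X \<in> measurable (N x) ?P"
    by (rule measurable_restrict) (rule U_measurable[OF x kd])
  have Y: "?Y \<in> measurable M ?P"
    by (rule measurable_restrict) (intro borel_measurable_add borel_measurable_const V_measurable kd)
  have "distr (N x) ?P ?X = distr (density M h) ?P ?Y"
  proof (rule measure_eqI_PiM_infinite[of _ "{..n}" "\<lambda>_. borel"])
    show "finite_measure (distr (N x) ?P ?X)"
      using prob_space.finite_measure[OF Nx.prob_space_distr[OF X]] .
    fix A :: "nat \<Rightarrow> real set" and J assume J: "finite J" "J \<subseteq> {..n}" and A: "\<And>i. i \<in> J \<Longrightarrow> A i \<in> sets borel"
    \<comment> \<open>Unconstrained grid points receive \<open>UNIV\<close>, which turns a cylinder
      over \<open>J\<close> into a condition at every grid point.\<close>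
    define B where "B k = (if k \<in> J then A k else UNIV)" for k
    have B: "B k \<in> sets borel" for k using A by (simp add: B_def)
    let ?C = "prod_emb {..n} (\<lambda>_. borel :: real measure) J (Pi\<^sub>E J A)"
    have C: "?C \<in> sets ?P" by (rule sets_PiM_I[OF J]) (use A in simp)
    have memb: "restrict f {..n} \<in> ?C \<longleftrightarrow> (\<forall>k<n. f k \<in> B k) \<and> f n \<in> B n" for f
    proof -
      have "restrict f {..n} \<in> ?C \<longleftrightarrow> (\<forall>k\<in>J. f k \<in> A k)"
        using J(2) by (auto simp: prod_emb_iff PiE_iff subset_iff)
      also have "\<dots> \<longleftrightarrow> (\<forall>k\<le>n. f k \<in> B k)" using J(2) unfolding B_def by (auto simp: subset_iff)
      finally show ?thesis using le_less by auto
    qed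
    have "emeasure (distr (N x) ?P ?X) ?C =
        emeasure (N x) (?X -` ?C \<inter> space (N x))"
      by (rule emeasure_distr[OF X C])
    also have "\<dots> = (\<integral>\<^sup>+\<omega>. indicator (?X -` ?C \<inter> space (N x)) \<omega> \<partial>N x)"
      by (rule nn_integral_indicator[symmetric]) (rule measurable_sets[OF X C])
    also have "\<dots> = (\<integral>\<^sup>+\<omega>. indicator {\<omega>\<in>space (N x). \<forall>k<n. U x (real k * d) \<omega> \<in> B k} \<omega> * indicator (B n) (U x (real n * d) \<omega>) \<partial>N x)"
      by (rule nn_integral_cong) (simp add: indicator_def memb)
    also have "\<dots> = (\<integral>\<^sup>+\<omega>. indicator {\<omega>\<in>space M. \<forall>k<n. x + V (real k * d) \<omega> \<in> B k} \<omega> *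
       (indicator (survival (real n * d) x) \<omega> * (indicator (B n) (x + V (real n * d) \<omega>) *
         ennreal (Wp (x + V (real n * d) \<omega>) / Wp x))) \<partial>M)"
      by (rule chain[OF x d B borel_measurable_indicator[OF B]])
    also have "\<dots> = (\<integral>\<^sup>+\<omega>. h \<omega> * indicator (?Y -` ?C \<inter> space M) \<omega> \<partial>M)"
      by (rule nn_integral_cong) (simp add: indicator_def memb h_def s_def)
    also have "\<dots> = emeasure (density M h) (?Y -` ?C \<inter> space M)"
      by (rule emeasure_density[OF h measurable_sets[OF Y C], symmetric])
    also have "\<dots> = emeasure (distr (density M h) ?P ?Y) ?C"
      using emeasure_distr[of _ "density M h" ?P ?C] Y C by simp
    finally show "emeasure (distr (N x) ?P ?X) ?C =
      emeasure (distr (density M h) ?P ?Y) ?C" .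
  qed simp_all
  then have "(\<integral>\<^sup>+f. F f \<partial>distr (N x) ?P ?X) =
      (\<integral>\<^sup>+f. F f \<partial>distr (density M h) ?P ?Y)" by simp
  also have "(\<integral>\<^sup>+f. F f \<partial>distr (N x) ?P ?X) =
      (\<integral>\<^sup>+\<omega>. F (?X \<omega>) \<partial>N x)"
    using nn_integral_distr[OF X, of F] F by simp
  also have "(\<integral>\<^sup>+f. F f \<partial>distr (density M h) ?P ?Y) =
      (\<integral>\<^sup>+\<omega>. F (?Y \<omega>) \<partial>density M h)"
    using nn_integral_distr[of ?Y "density M h" ?P F] Y F by simp
  also have "\<dots> = (\<integral>\<^sup>+\<omega>. h \<omega> * F (?Y \<omega>) \<partial>M)"
    by (rule nn_integral_density[OF h measurable_compose[OF Y F]])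
  finally show ?thesis unfolding h_def s_def .
qed

end

section \<open>The event of staying positive forever\<close>

context levy begin

text \<open>The margin may depend on the horizon, which makes this a countable intersection. For a
  path that drifts to plus infinity it amounts to a positive infimum over all times.\<close>

definition forever_pos :: "real \<Rightarrow> 'a set" where
  "forever_pos x = (\<Inter>n::nat. survival (real n) x)"

lemma forever_pos_sets: "forever_pos x \<in> sets M"
  unfolding forever_pos_def using survival_sets by (intro sets.countable_INT) auto

lemma forever_pos_subset: "t \<ge> 0 \<Longrightarrow> forever_pos x \<subseteq> survival t x"
proof
  fix \<omega> assume t: "t \<ge> 0" and w: "\<omega> \<in> forever_pos x"
  obtain n :: nat where "t \<le> real n" using real_arch_simple by blast
  moreover have "\<omega> \<in> survival (real n) x" using w by (simp add: forever_pos_def)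
  ultimately show "\<omega> \<in> survival t x" unfolding survival_def using stays_pos_mono by blast
qed

lemma survival_tendsto_forever_pos:
  assumes "d > 0"
  shows "(\<lambda>n. indicator (survival (real n * d) x) \<omega> :: real) \<longlonglongrightarrow> indicator (forever_pos x) \<omega>"
proof (cases "\<omega> \<in> forever_pos x")
  case True
  then have "\<omega> \<in> survival (real n * d) x" for n using forever_pos_subset[of "real n * d" x] assms by auto
  then show ?thesis using True by simp
next
  case False
  then obtain m :: nat where m: "\<omega> \<notin> survival (real m) x" by (auto simp: forever_pos_def)
  obtain k :: nat where k: "real m / d \<le> real k" using real_arch_simple by blast
  have "\<omega> \<notin> survival (real n * d) x" if "n \<ge> k" for n
  proof
    assume w: "\<omega> \<in> survival (real n * d) x"
    have "real m \<le> real k * d" using k assms by (simp add: pos_divide_le_eq)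
    also have "\<dots> \<le> real n * d" using that assms by (intro mult_right_mono) auto
    finally show False using m w stays_pos_mono unfolding survival_def by blast
  qed
  then have "eventually (\<lambda>n. indicator (survival (real n * d) x) \<omega> = (0::real)) sequentially"
    unfolding eventually_sequentially by (intro exI[of _ k]) auto
  then show ?thesis using False by (simp add: tendsto_eventually)
qed

end

section \<open>The conditioned law under drift to plus infinity\<close>

locale conditioned_levy_drift = conditioned_levy M V W N U
  for M :: "'a measure" and V W and N :: "real \<Rightarrow> 'b measure" and U +
  assumes drift: "drifts_to_plus_infinity M V"
begin

text \<open>Almost every path is bounded below: cadlag paths are bounded up to any time, and the
  drift makes them nonnegative from some time on. Hence almost every path stays positive from some
  start \<open>Suc n\<close>, and countably many null sets cannot cover this.\<close>

lemma forever_pos_exists: "\<exists>x>0. prob (forever_pos x) > 0"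
proof (rule ccontr)
  assume neg: "\<not> (\<exists>x>0. prob (forever_pos x) > 0)"
  have "prob (forever_pos (real (Suc n))) = 0" for n
  proof -
    have "\<not> (0 < real (Suc n) \<and> 0 < prob (forever_pos (real (Suc n))))" using neg by blast
    then have "\<not> 0 < prob (forever_pos (real (Suc n)))" using of_nat_0_less_iff by blast
    then show ?thesis using measure_nonneg[of M "forever_pos (real (Suc n))"] by linarith
  qed
  then have "emeasure M (forever_pos (real (Suc n))) = 0" for n
    by (simp add: emeasure_eq_measure)
  then have "forever_pos (real (Suc n)) \<in> null_sets M" for n
    using forever_pos_sets by (auto simp: null_sets_def)
  then have "(\<Union>n. forever_pos (real (Suc n))) \<in> null_sets M" by (intro null_sets_UN) auto
  then have "AE \<omega> in M. \<omega> \<notin> (\<Union>n. forever_pos (real (Suc n)))" by (rule AE_not_in)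
  moreover have "AE \<omega> in M. filterlim (\<lambda>t. V t \<omega>) at_top at_top"
    using drift by (simp add: drifts_to_plus_infinity_def)
  ultimately have "AE \<omega> in M. False"
    using AE_space
  proof eventually_elim
    fix \<omega> assume w: "\<omega> \<notin> (\<Union>n. forever_pos (real (Suc n)))" "filterlim (\<lambda>t. V t \<omega>) at_top at_top" "\<omega> \<in> space M"
    from w(2) have "eventually (\<lambda>t. 0 \<le> V t \<omega>) at_top" by (auto simp: filterlim_at_top)
    then obtain T0 where T0: "\<And>t. t \<ge> T0 \<Longrightarrow> 0 \<le> V t \<omega>" unfolding eventually_at_top_linorder by blast
    define T where "T = max 0 T0"
    obtain B where B: "\<And>s. 0 \<le> s \<Longrightarrow> s \<le> T \<Longrightarrow> \<bar>V s \<omega>\<bar> \<le> B"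
      using cadlag_bounded[OF V_cadlag[OF w(3)], of T] unfolding T_def by auto
    obtain n :: nat where n: "B \<le> real n" using real_arch_simple by blast
    have "1 \<le> real (Suc n) + V s \<omega>" if "0 \<le> s" for s
    proof (cases "s \<le> T")
      case True
      then have "\<bar>V s \<omega>\<bar> \<le> B" using B that by blast
      then show ?thesis using n unfolding of_nat_Suc by linarith
    next
      case False
      then have "0 \<le> V s \<omega>" unfolding T_def by (intro T0) simp
      then show ?thesis unfolding of_nat_Suc by simp
    qed
    then have "stays_pos (real m) (\<lambda>s. real (Suc n) + V s \<omega>)" for m :: nat
      unfolding stays_pos_def by (meson atLeastAtMost_iff zero_less_one)
    then have "\<omega> \<in> forever_pos (real (Suc n))"
      unfolding forever_pos_def survival_def using w(3) by blast
    then show False using w(1) by blast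
  qed
  then show False by simp
qed

lemma W_harmonic_real:
  assumes x: "x > 0" and t: "t \<ge> 0"
  shows "integrable M (\<lambda>\<omega>. indicator (survival t x) \<omega> * Wp (x + V t \<omega>))"
    and "(\<integral>\<omega>. indicator (survival t x) \<omega> * Wp (x + V t \<omega>) \<partial>M) = Wp x"
proof -
  have [measurable]: "survival t x \<in> sets M" "V t \<in> borel_measurable M"
    using survival_sets[OF t] V_measurable[OF t] by auto
  have m: "(\<lambda>\<omega>. indicator (survival t x) \<omega> * Wp (x + V t \<omega>)) \<in> borel_measurable M" by measurable
  have eq: "(\<integral>\<^sup>+\<omega>. ennreal (indicator (survival t x) \<omega> * Wp (x + V t \<omega>)) \<partial>M) = ennreal (Wp x)"
    unfolding W_harmonic[OF x t, symmetric]
    by (rule nn_integral_cong) (simp add: indicator_def)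
  show i: "integrable M (\<lambda>\<omega>. indicator (survival t x) \<omega> * Wp (x + V t \<omega>))"
    using m eq Wp_nonneg by (intro integrableI_nonneg) auto
  show "(\<integral>\<omega>. indicator (survival t x) \<omega> * Wp (x + V t \<omega>) \<partial>M) = Wp x"
    using m eq Wp_nonneg by (intro integral_eq_nn_integral[THEN trans]) (auto simp: )
qed

lemma V_seq_at_top: "AE \<omega> in M. filterlim (\<lambda>n. x + V (real n * d) \<omega>) at_top sequentially" if "d > 0"
proof -
  have "AE \<omega> in M. filterlim (\<lambda>t. V t \<omega>) at_top at_top"
    using drift by (simp add: drifts_to_plus_infinity_def)
  then show ?thesis
  proof eventually_elim
    fix \<omega> assume w: "filterlim (\<lambda>t. V t \<omega>) at_top at_top"
    have "filterlim (\<lambda>n. real n * d) at_top sequentially"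
      using filterlim_tendsto_pos_mult_at_top[OF tendsto_const that filterlim_real_sequentially]
      by (simp add: mult.commute)
    then have "filterlim (\<lambda>n. V (real n * d) \<omega>) at_top sequentially"
      by (rule filterlim_compose[OF w])
    then show "filterlim (\<lambda>n. x + V (real n * d) \<omega>) at_top sequentially"
      by (rule filterlim_tendsto_add_at_top[OF tendsto_const])
  qed
qed

text \<open>
  Harmonicity gives \<open>W(x) \<ge> W(K) P(inf V\<^sub>x > 0, V\<^sub>x(n) \<ge> K)\<close>, and the probability tends to
  \<open>P(inf V\<^sub>x > 0)\<close> since \<open>V\<close> drifts to \<open>+\<infinity>\<close>.
\<close>

lemma Wp_bounded: "\<exists>C. \<forall>y. Wp y \<le> C"
proof -
  obtain x where x: "x > 0" "prob (forever_pos x) > 0" using forever_pos_exists by blast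
  have "Wp K * prob (forever_pos x) \<le> Wp x" for K
  proof (rule LIMSEQ_le_const2)
    \<comment> \<open>A minorant of the harmonic integrand: \<open>forever_pos x\<close> replaces
      survival up to time \<open>n\<close>, and monotonicity of \<open>Wp\<close> replaces the
      position by \<open>K\<close>.\<close>
    define f where "f n \<omega> = Wp K * (indicator (forever_pos x) \<omega> * indicator {K..} (x + V (real n) \<omega>))" for n \<omega>
    have fm: "f n \<in> borel_measurable M" for n
    proof -
      have [measurable]: "forever_pos x \<in> sets M" "V (real n) \<in> borel_measurable M" using forever_pos_sets by auto
      show ?thesis unfolding f_def by measurable
    qed
    have "(\<lambda>n. \<integral>\<omega>. f n \<omega> \<partial>M) \<longlonglongrightarrow> (\<integral>\<omega>. Wp K * indicator (forever_pos x) \<omega> \<partial>M)"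
    proof (rule integral_dominated_convergence[where w="\<lambda>_. Wp K"])
      show "(\<lambda>\<omega>. Wp K * indicator (forever_pos x) \<omega>) \<in> borel_measurable M" using forever_pos_sets by measurable
      show "AE \<omega> in M. norm (f n \<omega>) \<le> Wp K" for n
        using Wp_nonneg by (intro AE_I2) (simp add: f_def indicator_def)
      show "AE \<omega> in M. (\<lambda>n. f n \<omega>) \<longlonglongrightarrow> Wp K * indicator (forever_pos x) \<omega>"
        using V_seq_at_top[OF zero_less_one, of x]
      proof eventually_elim
        fix \<omega> assume "filterlim (\<lambda>n. x + V (real n * 1) \<omega>) at_top sequentially"
        then have "eventually (\<lambda>n. K \<le> x + V (real n) \<omega>) sequentially" by (simp add: filterlim_at_top)
        then have "eventually (\<lambda>n. f n \<omega> = Wp K * indicator (forever_pos x) \<omega>) sequentially"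
          by eventually_elim (simp add: f_def)
        then show "(\<lambda>n. f n \<omega>) \<longlonglongrightarrow> Wp K * indicator (forever_pos x) \<omega>" by (rule tendsto_eventually)
      qed
    qed (use fm in simp_all)
    then show "(\<lambda>n. \<integral>\<omega>. f n \<omega> \<partial>M) \<longlonglongrightarrow> Wp K * prob (forever_pos x)"
      using forever_pos_sets sets.Int_space_eq2[OF forever_pos_sets] by simp
    have "(\<integral>\<omega>. f n \<omega> \<partial>M) \<le> Wp x" for n
    proof -
      have "(\<integral>\<omega>. f n \<omega> \<partial>M) \<le> (\<integral>\<omega>. indicator (survival (real n) x) \<omega> * Wp (x + V (real n) \<omega>) \<partial>M)"
      proof (rule integral_mono)
        show "integrable M (f n)"
          using fm Wp_nonneg by (intro integrable_const_bound[where B="Wp K"] AE_I2) (simp_all add: f_def indicator_def)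
        show "integrable M (\<lambda>\<omega>. indicator (survival (real n) x) \<omega> * Wp (x + V (real n) \<omega>))"
          by (rule W_harmonic_real(1)[OF x(1)]) simp
        fix \<omega>
        have "Wp K \<le> Wp (x + V (real n) \<omega>)" if "K \<le> x + V (real n) \<omega>"
          using that by (rule monoD[OF Wp_mono])
        then show "f n \<omega> \<le> indicator (survival (real n) x) \<omega> * Wp (x + V (real n) \<omega>)"
          using Wp_nonneg forever_pos_subset[of "real n" x] by (auto simp: f_def indicator_def)
      qed
      then show ?thesis by (simp add: W_harmonic_real(2)[OF x(1)])
    qed
    then show "\<exists>N. \<forall>n\<ge>N. (\<integral>\<omega>. f n \<omega> \<partial>M) \<le> Wp x" by blast
  qed
  then have "Wp K \<le> Wp x / prob (forever_pos x)" for K using x(2) by (simp add: pos_le_divide_eq)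
  then show ?thesis by blast
qed

definition W_inf :: real where
  "W_inf = (SUP n::nat. Wp (real n))"

lemma Wp_le_W_inf: "Wp y \<le> W_inf"
proof -
  obtain C where C: "\<And>y. Wp y \<le> C" using Wp_bounded by blast
  obtain n :: nat where "y \<le> real n" using real_arch_simple by blast
  then have "Wp y \<le> Wp (real n)" by (rule monoD[OF Wp_mono])
  also have "\<dots> \<le> W_inf" unfolding W_inf_def using C by (intro cSUP_upper bdd_aboveI2) auto
  finally show ?thesis .
qed

lemma Wp_tendsto: "(Wp \<longlongrightarrow> W_inf) at_top"
proof (rule order_tendstoI)
  fix a assume "a < W_inf"
  moreover obtain C where C: "\<And>y. Wp y \<le> C" using Wp_bounded by blast
  have "bdd_above (range (\<lambda>n::nat. Wp (real n)))" using C by (intro bdd_aboveI2) auto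
  ultimately obtain n :: nat where n: "a < Wp (real n)" unfolding W_inf_def by (auto simp: less_cSUP_iff)
  have "a < Wp y" if "y \<ge> real n" for y using n monoD[OF Wp_mono that] by linarith
  then show "eventually (\<lambda>y. a < Wp y) at_top" unfolding eventually_at_top_linorder by blast
next
  fix a assume "W_inf < a"
  then show "eventually (\<lambda>y. Wp y < a) at_top" using Wp_le_W_inf by (intro always_eventually allI) (rule le_less_trans)
qed

text \<open>\<open>Wp\<close> is bounded by its limit \<open>W_inf\<close>, so dominated convergence
  applies; survival decreases to \<open>forever_pos x\<close>. Taking \<open>G = 1\<close>
  identifies \<open>Wp x\<close>, and taking \<open>G\<close> a function of grid positions
  identifies the law of \<open>U x\<close>.\<close>

lemma survival_weight_tendsto:
  assumes d: "d > 0" and G: "G \<in> borel_measurable M" "\<And>\<omega>. 0 \<le> G \<omega>" "\<And>\<omega>. G \<omega> \<le> (1::real)"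
  shows "(\<lambda>n. \<integral>\<omega>. indicator (survival (real n * d) x) \<omega> * Wp (x + V (real n * d) \<omega>) * G \<omega> \<partial>M)
    \<longlonglongrightarrow> (\<integral>\<omega>. indicator (forever_pos x) \<omega> * W_inf * G \<omega> \<partial>M)"
proof (rule integral_dominated_convergence[where w="\<lambda>_. W_inf"])
  let ?k = "\<lambda>n \<omega>. indicator (survival (real n * d) x) \<omega> * Wp (x + V (real n * d) \<omega>) * G \<omega>"
  have [measurable]: "survival (real n * d) x \<in> sets M" "V (real n * d) \<in> borel_measurable M" "forever_pos x \<in> sets M"
     "G \<in> borel_measurable M" for n
    using survival_sets V_measurable d forever_pos_sets G by auto
  show "(\<lambda>\<omega>. indicator (forever_pos x) \<omega> * W_inf * G \<omega>) \<in> borel_measurable M" by measurable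
  show "(\<lambda>\<omega>. ?k n \<omega>) \<in> borel_measurable M" for n
    by measurable
  show "AE \<omega> in M. norm (?k n \<omega>) \<le> W_inf" for n
  proof (rule AE_I2)
    fix \<omega>
    have "Wp (x + V (real n * d) \<omega>) * G \<omega> \<le> W_inf * 1"
      using Wp_le_W_inf Wp_nonneg G by (intro mult_mono) (auto intro: order.trans[OF Wp_nonneg Wp_le_W_inf])
    moreover have "0 \<le> W_inf" using order.trans[OF Wp_nonneg Wp_le_W_inf] .
    ultimately show "norm (?k n \<omega>) \<le> W_inf"
      using Wp_nonneg G(2) by (simp add: indicator_def)
  qed
  show "AE \<omega> in M. (\<lambda>n. ?k n \<omega>) \<longlonglongrightarrow>
      indicator (forever_pos x) \<omega> * W_inf * G \<omega>"
    using V_seq_at_top[OF d, of x]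
  proof eventually_elim
    fix \<omega> assume "filterlim (\<lambda>n. x + V (real n * d) \<omega>) at_top sequentially"
    then have "(\<lambda>n. Wp (x + V (real n * d) \<omega>)) \<longlonglongrightarrow> W_inf" by (rule filterlim_compose[OF Wp_tendsto])
    then show "(\<lambda>n. ?k n \<omega>) \<longlonglongrightarrow>
      indicator (forever_pos x) \<omega> * W_inf * G \<omega>"
      by (intro tendsto_intros survival_tendsto_forever_pos[OF d])
  qed
qed simp

text \<open>By harmonicity the sequence of integrals is constant, and its limit is known.\<close>

lemma W_forever_pos:
  assumes x: "x > 0"
  shows "Wp x = W_inf * prob (forever_pos x)"
proof (rule LIMSEQ_unique)
  show "(\<lambda>n. \<integral>\<omega>. indicator (survival (real n * 1) x) \<omega> * Wp (x + V (real n * 1) \<omega>) * 1 \<partial>M) \<longlonglongrightarrow> Wp x"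
    using W_harmonic_real(2)[OF x] by simp
  have "(\<integral>\<omega>. indicator (forever_pos x) \<omega> * W_inf * 1 \<partial>M) = W_inf * prob (forever_pos x)"
    using forever_pos_sets sets.Int_space_eq2[OF forever_pos_sets] by (simp add: mult.commute)
  then show "(\<lambda>n. \<integral>\<omega>. indicator (survival (real n * 1) x) \<omega> * Wp (x + V (real n * 1) \<omega>) * 1 \<partial>M) \<longlonglongrightarrow> W_inf * prob (forever_pos x)"
    using survival_weight_tendsto[of 1 "\<lambda>_. 1" x] by (simp only: zero_less_one borel_measurable_const zero_le_one order.refl simp_thms)
qed

lemma forever_pos_prob: "x > 0 \<Longrightarrow> prob (forever_pos x) > 0"
  using W_forever_pos[of x] Wp_pos[of x] measure_nonneg[of M "forever_pos x"] by (auto simp: order_le_less)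

text \<open>A function of the first \<open>n\<close> grid positions is also one of the first
  \<open>m \<ge> n\<close>, so the density may be taken at the later time \<open>m * d\<close>. The
  left side does not change as \<open>m\<close> grows, while the density tends to
  \<open>W_inf\<close> on \<open>forever_pos x\<close> and 0 elsewhere.\<close>

lemma grid_expectation:
  assumes x: "x > 0" and d: "d > 0" and F: "F \<in> borel_measurable (PiM {..n} (\<lambda>_. borel))"
    and F01: "\<And>f. 0 \<le> F f" "\<And>f. F f \<le> (1::real)"
  shows "(\<integral>\<omega>. F (\<lambda>k\<in>{..n}. U x (real k * d) \<omega>) \<partial>N x) * prob (forever_pos x) =
    (\<integral>\<omega>. indicator (forever_pos x) \<omega> * F (\<lambda>k\<in>{..n}. x + V (real k * d) \<omega>) \<partial>M)"
proof -
  let ?F = "\<lambda>\<omega>. F (\<lambda>k\<in>{..n}. U x (real k * d) \<omega>)"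
  let ?k = "\<lambda>m \<omega>. indicator (survival (real m * d) x) \<omega> * Wp (x + V (real m * d) \<omega>)"
  interpret Nx: prob_space "N x" by (rule U_prob_space[OF x])
  have kd: "0 \<le> real k * d" for k using d by simp
  let ?G = "\<lambda>\<omega>. F (\<lambda>k\<in>{..n}. x + V (real k * d) \<omega>)"
  have X: "?F \<in> borel_measurable (N x)"
    by (rule measurable_compose[OF measurable_restrict F]) (rule U_measurable[OF x kd])
  have Y: "?G \<in> borel_measurable M"
    by (rule measurable_compose[OF measurable_restrict F]) (intro borel_measurable_add borel_measurable_const V_measurable kd)
  have eq: "(\<integral>\<omega>. ?F \<omega> \<partial>N x) * Wp x =
    (\<integral>\<omega>. ?k m \<omega> * ?G \<omega> \<partial>M)" if m: "m \<ge> n" for m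
  proof -
    define F' where "F' f = F (restrict f {..n})" for f
    have F': "(\<lambda>f. ennreal (F' f)) \<in> borel_measurable (PiM {..m} (\<lambda>_. borel))"
      unfolding F'_def using measurable_compose[OF measurable_restrict_subset[of "{..n}" "{..m}"] F] m by simp
    have rr: "F' (\<lambda>k\<in>{..m}. f k) = F (\<lambda>k\<in>{..n}. f k)" for f
    proof -
      have "restrict (\<lambda>k\<in>{..m}. f k) {..n} = (\<lambda>k\<in>{..n}. f k)" using m by (auto simp: restrict_def fun_eq_iff)
      then show ?thesis by (simp add: F'_def)
    qed
    have [measurable]: "survival (real m * d) x \<in> sets M" "V (real m * d) \<in> borel_measurable M" "?G \<in> borel_measurable M"
      using survival_sets[OF kd] V_measurable[OF kd] Y by auto
    have "ennreal (\<integral>\<omega>. ?F \<omega> \<partial>N x) = (\<integral>\<^sup>+\<omega>. ennreal (?F \<omega>) \<partial>N x)"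
      using X F01 by (intro nn_integral_eq_integral[symmetric] Nx.integrable_const_bound[where B=1] AE_I2) auto
    also have "\<dots> = (\<integral>\<^sup>+\<omega>. indicator (survival (real m * d) x) \<omega> * ennreal (Wp (x + V (real m * d) \<omega>) / Wp x) * ennreal (?G \<omega>) \<partial>M)"
      using grid_law[OF x less_imp_le[OF d] F'] unfolding rr .
    also have "\<dots> = (\<integral>\<^sup>+\<omega>. ennreal (?k m \<omega> * ?G \<omega> / Wp x) \<partial>M)"
      using Wp_nonneg F01 by (intro nn_integral_cong) (auto simp: indicator_def ennreal_mult[symmetric])
    also have "\<dots> = ennreal (\<integral>\<omega>. ?k m \<omega> * ?G \<omega> / Wp x \<partial>M)"
    proof (rule nn_integral_eq_integral)
      show "integrable M (\<lambda>\<omega>. ?k m \<omega> * ?G \<omega> / Wp x)"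
      proof (intro integrable_divide, rule Bochner_Integration.integrable_bound[OF W_harmonic_real(1)[OF x kd[of m]]])
        show "AE \<omega> in M. norm (?k m \<omega> * ?G \<omega>)
           \<le> norm (?k m \<omega>)"
          using F01 Wp_nonneg by (intro AE_I2) (simp add: indicator_def mult_left_le)
      qed measurable
      show "AE \<omega> in M. 0 \<le> ?k m \<omega> * ?G \<omega> / Wp x"
        using F01 Wp_nonneg by (intro AE_I2 divide_nonneg_nonneg mult_nonneg_nonneg) auto
    qed
    finally have "(\<integral>\<omega>. ?F \<omega> \<partial>N x) =
       (\<integral>\<omega>. ?k m \<omega> * ?G \<omega> / Wp x \<partial>M)"
      using F01 Wp_nonneg
      by (subst (asm) ennreal_inj) (auto intro!: integral_nonneg_AE AE_I2 divide_nonneg_nonneg mult_nonneg_nonneg)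
    then show ?thesis using Wp_pos[OF x] by simp
  qed
  have "(\<lambda>m. \<integral>\<omega>. ?k m \<omega> * ?G \<omega> \<partial>M)
    \<longlonglongrightarrow> (\<integral>\<omega>. ?F \<omega> \<partial>N x) * Wp x"
    by (rule tendsto_eventually) (use eq in \<open>auto simp: eventually_sequentially intro!: exI[of _ n]\<close>)
  from LIMSEQ_unique[OF this survival_weight_tendsto[OF d Y F01]]
  have "(\<integral>\<omega>. ?F \<omega> \<partial>N x) * Wp x = (\<integral>\<omega>. indicator (forever_pos x) \<omega> * W_inf * ?G \<omega> \<partial>M)" .
  also have "\<dots> = (\<integral>\<omega>. W_inf * (indicator (forever_pos x) \<omega> * ?G \<omega>) \<partial>M)"
    by (rule Bochner_Integration.integral_cong) (simp_all add: mult_ac)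
  also have "\<dots> = W_inf * (\<integral>\<omega>. indicator (forever_pos x) \<omega> * ?G \<omega> \<partial>M)"
    by simp
  finally have "W_inf * ((\<integral>\<omega>. ?F \<omega> \<partial>N x) * prob (forever_pos x)) = W_inf * (\<integral>\<omega>. indicator (forever_pos x) \<omega> * ?G \<omega> \<partial>M)"
    unfolding W_forever_pos[OF x] by (simp add: mult_ac)
  moreover have "W_inf > 0" using Wp_pos[OF x] Wp_le_W_inf[of x] by linarith
  ultimately show ?thesis by simp
qed

text \<open>A Riemann sum depends on the path through a grid of step \<open>T / Suc n\<close>, where
  the laws have been compared. Pathwise convergence and the bound 1 carry the identity to the
  integral.\<close>

lemma ramp_exp_integral_expectation:
  assumes x: "x > 0" and T: "T > 0" and ab: "a < b"
  shows "(\<integral>\<omega>. ramp a b (exp_integral T (\<lambda>t. U x t \<omega>)) \<partial>N x) * prob (forever_pos x) =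
    (\<integral>\<omega>. indicator (forever_pos x) \<omega> * ramp a b (exp_integral T (\<lambda>t. x + V t \<omega>)) \<partial>M)"
proof -
  let ?u = "\<lambda>n \<omega>. ramp a b (riemann_sum T (Suc n) (\<lambda>t. U x t \<omega>))"
  let ?v = "\<lambda>n \<omega>. ramp a b (riemann_sum T (Suc n) (\<lambda>t. x + V t \<omega>))"
  let ?uu = "\<lambda>\<omega>. ramp a b (exp_integral T (\<lambda>t. U x t \<omega>))"
  let ?vv = "\<lambda>\<omega>. ramp a b (exp_integral T (\<lambda>t. x + V t \<omega>))"
  interpret Nx: prob_space "N x" by (rule U_prob_space[OF x])
  have rm[measurable]: "ramp a b \<in> borel_measurable borel"
    using continuous_on_ramp[OF ab] by (rule borel_measurable_continuous_onI)
  have Ucad: "cadlag (\<lambda>t. U x t \<omega>)" if "\<omega> \<in> space (N x)" for \<omega>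
    using up[OF x] that by (simp add: markov_process_def cadlag_process_def)
  define F where "F n f = ramp a b (\<Sum>k<n. exp (- f (Suc k)) * (T / real n))" for n f
  have F: "F n \<in> borel_measurable (PiM {..n} (\<lambda>_. borel))" for n
  proof -
    have [measurable]: "(\<lambda>f. f (Suc k)) \<in> borel_measurable (PiM {..n} (\<lambda>_. borel :: real measure))" if "k < n" for k
      using that by (intro measurable_component_singleton) auto
    have "(\<lambda>f. \<Sum>k<n. exp (- f (Suc k)) * (T / real n)) \<in> borel_measurable (PiM {..n} (\<lambda>_. borel :: real measure))"
      by (rule borel_measurable_sum) measurable
    then show ?thesis unfolding F_def by (rule measurable_compose[OF _ rm])
  qed
  have Feq: "F n (\<lambda>k\<in>{..n}. g (real k * (T / real n))) = ramp a b (riemann_sum T n g)" for n g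
    unfolding F_def riemann_sum_def by (intro arg_cong[of _ _ "ramp a b"] sum.cong) auto
  have id: "(\<integral>\<omega>. ?u n \<omega> \<partial>N x) * prob (forever_pos x) =
    (\<integral>\<omega>. indicator (forever_pos x) \<omega> * ?v n \<omega> \<partial>M)" for n
    using grid_expectation[OF x _ F[of "Suc n"], of "T / real (Suc n)"] T
    unfolding Feq[of "Suc n" "\<lambda>t. U x t _"] Feq[of "Suc n" "\<lambda>t. x + V t _"]
    by (simp add: F_def ramp_bounds del: of_nat_Suc)
  have lim: "(\<lambda>n. ramp a b (riemann_sum T (Suc n) g)) \<longlonglongrightarrow> ramp a b (exp_integral T g)" if "cadlag g" for g
    using continuous_on_tendsto_compose[OF continuous_on_ramp[OF ab] LIMSEQ_Suc[OF riemann_sum_tendsto[OF that T]]] by simp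
  have 1: "(\<lambda>n. \<integral>\<omega>. ?u n \<omega> \<partial>N x) \<longlonglongrightarrow> (\<integral>\<omega>. ?uu \<omega> \<partial>N x)"
  proof (rule integral_dominated_convergence[where w="\<lambda>_. 1"])
    show "(\<lambda>\<omega>. ?uu \<omega>) \<in> borel_measurable (N x)"
      by (rule measurable_compose[OF exp_integral_measurable[OF T U_measurable[OF x] Ucad] rm])
    show "(\<lambda>\<omega>. ?u n \<omega>) \<in> borel_measurable (N x)" for n
      by (rule measurable_compose[OF riemann_sum_path_measurable[OF less_imp_le[OF T] U_measurable[OF x]] rm])
    show "AE \<omega> in N x. (\<lambda>n. ?u n \<omega>) \<longlonglongrightarrow> ?uu \<omega>"
      by (rule AE_I2) (rule lim[OF Ucad])
    show "AE \<omega> in N x. norm (?u n \<omega>) \<le> 1" for n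
      by (rule AE_I2) (simp add: ramp_bounds)
  qed simp
  have Vm: "(\<lambda>\<omega>. x + V t \<omega>) \<in> borel_measurable M" if "t \<ge> 0" for t
    using that by (intro borel_measurable_add borel_measurable_const V_measurable)
  have 2: "(\<lambda>n. \<integral>\<omega>. indicator (forever_pos x) \<omega> * ?v n \<omega> \<partial>M) \<longlonglongrightarrow>
      (\<integral>\<omega>. indicator (forever_pos x) \<omega> * ?vv \<omega> \<partial>M)"
  proof (rule integral_dominated_convergence[where w="\<lambda>_. 1"])
    have fm: "(indicator (forever_pos x) :: _ \<Rightarrow> real) \<in> borel_measurable M" using forever_pos_sets by (rule borel_measurable_indicator)
    show "(\<lambda>\<omega>. indicator (forever_pos x) \<omega> * ?vv \<omega>) \<in> borel_measurable M"
      by (rule borel_measurable_times[OF fm measurable_compose[OF exp_integral_measurable[OF T Vm V_add_cadlag] rm]])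
    show "(\<lambda>\<omega>. indicator (forever_pos x) \<omega> * ?v n \<omega>) \<in> borel_measurable M" for n
      by (rule borel_measurable_times[OF fm measurable_compose[OF riemann_sum_path_measurable[OF less_imp_le[OF T] Vm] rm]])
    show "AE \<omega> in M. (\<lambda>n. indicator (forever_pos x) \<omega> * ?v n \<omega>) \<longlonglongrightarrow>
        indicator (forever_pos x) \<omega> * ?vv \<omega>"
      by (rule AE_I2) (intro tendsto_mult tendsto_const lim V_add_cadlag)
    show "AE \<omega> in M. norm (indicator (forever_pos x) \<omega> * ?v n \<omega>) \<le> 1" for n
      by (rule AE_I2) (simp add: ramp_bounds indicator_def)
  qed simp
  show ?thesis
    by (rule LIMSEQ_unique[OF tendsto_mult[OF 1 tendsto_const, of "prob (forever_pos x)"]]) (use 2 in \<open>simp only: id\<close>)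
qed

end

section \<open>Restarting at grid times\<close>

lemma sets_Collect_pred: "Measurable.pred M P \<Longrightarrow> {x\<in>space M. P x} \<in> sets M"
  by (simp add: pred_def)

text \<open>Horizons \<open>Suc n\<close> stay within the positive \<open>T\<close> for which
  Riemann sums have been compared with the integral.\<close>

definition path_exp_le :: "real \<Rightarrow> (real \<Rightarrow> real) set" where
  "path_exp_le c = {g\<in>space path_space. \<forall>n::nat. path_exp_integral (real (Suc n)) g \<le> c}"

lemma path_exp_le_sets: "path_exp_le c \<in> sets path_space"
  unfolding path_exp_le_def
proof (intro sets_Collect_pred pred_intros_countable)
  fix n :: nat
  have "(\<lambda>g. path_exp_integral (real (Suc n)) g) \<in> borel_measurable path_space"
    by (rule path_exp_integral_measurable) (auto intro: measurable_path_component)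
  then show "Measurable.pred path_space (\<lambda>g. path_exp_integral (real (Suc n)) g \<le> c)"
    unfolding pred_def by (rule borel_measurable_le[OF _ borel_measurable_const])
qed

lemma exp_integral_ge_const:
  assumes g: "cadlag g" and T: "0 \<le> T" and le: "\<And>t. 0 \<le> t \<Longrightarrow> t \<le> T \<Longrightarrow> g t \<le> y"
  shows "T * exp (- y) \<le> exp_integral T g"
proof -
  have "T * exp (- y) = (LINT t:{0..T}|lborel. exp (- y))"
    using T by (simp add: set_lebesgue_integral_def)
  also have "\<dots> \<le> exp_integral T g"
    unfolding exp_integral_def
  proof (rule set_integral_mono)
    show "set_integrable lborel {0..T} (\<lambda>t. exp (- y))"
      using T by (simp add: set_integrable_def)
    show "exp (- y) \<le> exp (- g t)" if "t \<in> {0..T}" for t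
      using le[of t] that by simp
  qed (rule exp_integral_integrable[OF g T])
  finally show ?thesis .
qed

section \<open>Restarting below the starting point: positive correlation with staying
  positive\<close>

context levy begin

definition exp_le :: "real \<Rightarrow> 'a set" where
  "exp_le c = {\<omega>\<in>space M. \<forall>n::nat. exp_integral (real (Suc n)) (\<lambda>t. V t \<omega>) \<le> c}"

lemma future_cadlag: "\<omega> \<in> space M \<Longrightarrow> s \<ge> 0 \<Longrightarrow> cadlag (\<lambda>u. V (s + u) \<omega> - V s \<omega>)"
  using cadlag_shift[OF V_cadlag, of \<omega> s "- V s \<omega>"] by simp

lemma path_exp_integral_future:
  assumes "\<omega> \<in> space M" "s \<ge> 0" "T > 0"
  shows "path_exp_integral T (future_path s \<omega>) = exp_integral T (\<lambda>u. V (s + u) \<omega> - V s \<omega>)"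
  unfolding future_path_def by (rule path_exp_integral_restrict[OF future_cadlag[OF assms(1,2)] assms(3)])

lemma future_path_exp_le:
  assumes "\<omega> \<in> space M" "s \<ge> 0"
  shows "future_path s \<omega> \<in> path_exp_le c \<longleftrightarrow> (\<forall>n::nat. exp_integral (real (Suc n)) (\<lambda>u. V (s + u) \<omega> - V s \<omega>) \<le> c)"
  unfolding path_exp_le_def using path_exp_integral_future[OF assms] measurable_space[OF future_path_measurable[OF assms(2)] assms(1)]
  by (simp del: of_nat_Suc)

lemma exp_le_future: "{\<omega>\<in>space M. future_path 0 \<omega> \<in> path_exp_le c} = exp_le c"
  unfolding exp_le_def using future_path_exp_le[of _ 0 c] by (auto simp: start simp del: of_nat_Suc)

lemma exp_le_sets: "exp_le c \<in> sets M"
proof -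
  have "{\<omega>\<in>space M. future_path 0 \<omega> \<in> path_exp_le c} = future_path 0 -` path_exp_le c \<inter> space M" by auto
  then show ?thesis unfolding exp_le_future using measurable_sets[OF future_path_measurable path_exp_le_sets] by simp
qed

lemma future_exp_integral:
  assumes "\<omega> \<in> space M" "s \<ge> 0"
  shows "exp_integral T (\<lambda>u. V (s + u) \<omega> - V s \<omega>) = exp (V s \<omega> + z) * exp_integral T (\<lambda>u. z + V (s + u) \<omega>)"
proof -
  have "exp_integral T (\<lambda>u. - (V s \<omega> + z) + (z + V (s + u) \<omega>)) = exp (V s \<omega> + z) * exp_integral T (\<lambda>u. z + V (s + u) \<omega>)"
    by (subst exp_integral_add_const) simp
  then show ?thesis by simp
qed

text \<open>Restarting drops the nonnegative contribution before \<open>s\<close> and rescales the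
  rest by the exponential of the height at restart. It serves with \<open>m = 0\<close> for a
  restart below 0 and with \<open>m = 2 * y\<close> after a passage above \<open>y\<close>.\<close>

lemma future_exp_integral_le:
  assumes w: "\<omega> \<in> space M" and s: "s \<ge> 0" and T: "T \<ge> 0" "s + T \<le> T'" and z: "V s \<omega> + z \<le> m"
  shows "exp_integral T (\<lambda>u. V (s + u) \<omega> - V s \<omega>) \<le> exp m * exp_integral T' (\<lambda>u. z + V u \<omega>)"
proof -
  have c: "cadlag (\<lambda>u. z + V u \<omega>)" by (rule V_add_cadlag[OF w])
  have "exp_integral T (\<lambda>u. z + V (s + u) \<omega>) \<le> exp_integral (s + T) (\<lambda>u. z + V u \<omega>)"
    using exp_integral_split[OF c s T(1)] exp_integral_nonneg by simp
  also have "\<dots> \<le> exp_integral T' (\<lambda>u. z + V u \<omega>)"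
    using s T by (intro exp_integral_mono[OF c]) auto
  finally have "exp (V s \<omega> + z) * exp_integral T (\<lambda>u. z + V (s + u) \<omega>) \<le> exp m * exp_integral T' (\<lambda>u. z + V u \<omega>)"
    using z by (intro mult_mono) (auto simp: exp_integral_nonneg)
  then show ?thesis unfolding future_exp_integral[OF w s, of T z] .
qed

lemma grid_sets:
  assumes d: "d \<ge> 0" and f: "\<And>j. f j \<in> sets borel"
  shows "{g\<in>space path_space. \<forall>j\<in>{..k}. g (real j * d) \<in> f j} \<in> sets path_space"
  using d f by (intro sets_Collect_finite_Ball_in[where N=borel] measurable_path_component) auto

lemma past_path_grid:
  assumes "d \<ge> 0" "j \<le> k"
  shows "past_path (real k * d) \<omega> (real j * d) = V (real j * d) \<omega>"
  using assms by (simp add: past_path_def min_def mult_right_mono)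

definition grid_above :: "real \<Rightarrow> real \<Rightarrow> 'a set" where
  "grid_above y d = {\<omega>\<in>space M. \<forall>k::nat. - y \<le> V (real k * d) \<omega>}"

lemma grid_above_sets:
  assumes "d \<ge> 0"
  shows "grid_above y d \<in> sets M"
proof -
  have "Measurable.pred M (\<lambda>\<omega>. - y \<le> V (real k * d) \<omega>)" for k :: nat
    unfolding pred_def by (rule borel_measurable_le[OF borel_measurable_const V_measurable]) (use assms in simp)
  then show ?thesis unfolding grid_above_def by (intro sets_Collect_pred pred_intros_countable)
qed

text \<open>The complement is handled first. With \<open>E\<close> the functional event and
  \<open>G\<close> the grid event, paths outside \<open>G\<close> are split by their first grid
  index below \<open>- y\<close>; summation gives \<open>P(E - G) \<le> P(E) * (1 - P(G))\<close>,
  and subtraction from \<open>P(E)\<close> gives the claim.\<close>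

lemma exp_le_grid_above:
  assumes d: "d \<ge> 0" and y: "y \<ge> 0"
  shows "prob (exp_le c) * prob (grid_above y d) \<le> prob (exp_le c \<inter> grid_above y d)"
proof -
  \<comment> \<open>Conditions at the indices up to \<open>k\<close> that make \<open>k\<close> the
    first index below \<open>- y\<close>, written as Borel sets so that \<open>B k\<close> becomes a
    cylinder event of the past.\<close>
  define f where "f k j = (if j < k then {- y..} else {..< - y})" for k j :: nat
  have f: "f k j \<in> sets borel" for k j by (simp add: f_def)
  define B where "B k = {\<omega>\<in>space M. (\<forall>j<k. - y \<le> V (real j * d) \<omega>) \<and> V (real k * d) \<omega> < - y}" for k :: nat
  have kd: "real k * d \<ge> 0" for k using d by simp
  define A where "A k = {g\<in>space path_space. \<forall>j\<in>{..k}. g (real j * d) \<in> f k j}" for k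
  have A: "A k \<in> sets path_space" for k unfolding A_def by (rule grid_sets[OF d f])
  have Biff: "B k = {\<omega>\<in>space M. past_path (real k * d) \<omega> \<in> A k}" for k
  proof -
    have "past_path (real k * d) \<omega> \<in> A k \<longleftrightarrow> (\<forall>j\<in>{..k}. V (real j * d) \<omega> \<in> f k j)" if "\<omega> \<in> space M" for \<omega>
      using measurable_space[OF past_path_measurable[OF kd] that, of k] past_path_grid[OF d] by (simp add: A_def)
    also have "(\<forall>j\<in>{..k}. V (real j * d) \<omega> \<in> f k j) \<longleftrightarrow> (\<forall>j<k. - y \<le> V (real j * d) \<omega>) \<and> V (real k * d) \<omega> < - y" for \<omega>
      unfolding f_def using le_less by auto
    finally show ?thesis unfolding B_def by blast
  qed
  have B: "B k \<in> sets M" for k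
  proof -
    have "B k = past_path (real k * d) -` A k \<inter> space M" unfolding Biff by auto
    then show ?thesis using measurable_sets[OF past_path_measurable[OF kd] A] by simp
  qed
  have disj: "disjoint_family B"
    unfolding disjoint_family_on_def
  proof (intro ballI impI)
    fix i j :: nat assume "i \<noteq> j"
    then consider "i < j" | "j < i" by linarith
    then show "B i \<inter> B j = {}" by cases (force simp: B_def)+
  qed
  have compl: "space M - grid_above y d = (\<Union>k. B k)"
  proof (intro equalityI subsetI)
    fix \<omega> assume w: "\<omega> \<in> space M - grid_above y d"
    then have ex: "\<exists>k::nat. V (real k * d) \<omega> < - y" by (auto simp: grid_above_def not_le)
    define k where "k = (LEAST k. V (real k * d) \<omega> < - y)"
    have "V (real k * d) \<omega> < - y" unfolding k_def using ex by (rule LeastI_ex)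
    moreover have "- y \<le> V (real j * d) \<omega>" if "j < k" for j
      using not_less_Least[OF that[unfolded k_def]] by simp
    ultimately show "\<omega> \<in> (\<Union>k. B k)" using w by (auto simp: B_def)
  next
    fix \<omega> assume "\<omega> \<in> (\<Union>k. B k)"
    then show "\<omega> \<in> space M - grid_above y d" by (auto simp: B_def grid_above_def not_le)
  qed
  \<comment> \<open>On \<open>B k\<close> the restart takes place below \<open>- y \<le> 0\<close>,
    so the restarted functional is still at most \<open>c\<close>; it is independent of
    \<open>B k\<close>.\<close>
  have le: "prob (exp_le c \<inter> B k) \<le> prob (B k) * prob (exp_le c)" for k
  proof -
    let ?Q = "{\<omega>\<in>space M. past_path (real k * d) \<omega> \<in> A k \<and> future_path (real k * d) \<omega> \<in> path_exp_le c}"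
    have "exp_le c \<inter> B k \<subseteq> ?Q"
    proof
      fix \<omega> assume w: "\<omega> \<in> exp_le c \<inter> B k"
      then have wM: "\<omega> \<in> space M" and neg: "V (real k * d) \<omega> + 0 \<le> 0" using y by (auto simp: B_def)
      have "exp_integral (real (Suc n)) (\<lambda>u. V (real k * d + u) \<omega> - V (real k * d) \<omega>) \<le> c" for n
      proof -
        obtain m :: nat where m: "real k * d + real (Suc n) \<le> real m" using real_arch_simple by blast
        then have "real k * d + real (Suc n) \<le> real (Suc m)" by linarith
        from future_exp_integral_le[OF wM kd _ this neg]
        have "exp_integral (real (Suc n)) (\<lambda>u. V (real k * d + u) \<omega> - V (real k * d) \<omega>) \<le> exp_integral (real (Suc m)) (\<lambda>u. V u \<omega>)"
          by (simp del: of_nat_Suc)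
        also have "\<dots> \<le> c" using w by (simp add: exp_le_def)
        finally show ?thesis .
      qed
      then show "\<omega> \<in> ?Q"
        using w wM future_path_exp_le[OF wM kd] unfolding Biff by blast
    qed
    moreover have "?Q =
      (past_path (real k * d) -` A k \<inter> space M) \<inter> (future_path (real k * d) -` path_exp_le c \<inter> space M)" by auto
    then have "?Q \<in> sets M"
      using measurable_sets[OF past_path_measurable[OF kd] A] measurable_sets[OF future_path_measurable[OF kd] path_exp_le_sets] by simp
    ultimately have "prob (exp_le c \<inter> B k) \<le> prob ?Q"
      by (rule finite_measure_mono)
    also have "\<dots> = prob (B k) * prob (exp_le c)"
      unfolding markov_prob[OF kd A path_exp_le_sets] exp_le_future Biff ..
    finally show ?thesis .
  qed
  have s1: "(\<lambda>k. prob (B k)) sums prob (\<Union>k. B k)"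
    by (rule finite_measure_UNION) (use B disj in auto)
  have s2: "(\<lambda>k. prob (exp_le c \<inter> B k)) sums prob (\<Union>k. exp_le c \<inter> B k)"
  proof (rule finite_measure_UNION)
    show "disjoint_family (\<lambda>k. exp_le c \<inter> B k)" using disj by (auto simp: disjoint_family_on_def)
  qed (use B exp_le_sets in auto)
  have "prob (\<Union>k. exp_le c \<inter> B k) \<le> prob (\<Union>k. B k) * prob (exp_le c)"
    by (rule sums_le[OF le s2 sums_mult2[OF s1]])
  moreover have "prob (\<Union>k. B k) = 1 - prob (grid_above y d)"
    unfolding compl[symmetric] by (rule prob_compl[OF grid_above_sets[OF d]])
  moreover have "prob (exp_le c) = prob (exp_le c \<inter> grid_above y d) + prob (\<Union>k. exp_le c \<inter> B k)"
  proof -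
    have "exp_le c \<subseteq> space M" by (auto simp: exp_le_def)
    then have "exp_le c = (exp_le c \<inter> grid_above y d) \<union> (\<Union>k. exp_le c \<inter> B k)"
      using compl by blast
    moreover have "(exp_le c \<inter> grid_above y d) \<inter> (\<Union>k. exp_le c \<inter> B k) = {}" using compl by blast
    moreover have "exp_le c \<inter> grid_above y d \<in> sets M" "(\<Union>k. exp_le c \<inter> B k) \<in> sets M"
      using exp_le_sets grid_above_sets[OF d] B by auto
    ultimately show ?thesis by (metis finite_measure_Union)
  qed
  ultimately show ?thesis by (simp add: algebra_simps)
qed

text \<open>Dyadic meshes make the grids nested, so the events decrease and their probabilities
  converge.\<close>

definition always_above :: "real \<Rightarrow> 'a set" where
  "always_above y = (\<Inter>n::nat. grid_above y (1 / 2 ^ n))"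

lemma always_above_sets: "always_above y \<in> sets M"
  unfolding always_above_def using grid_above_sets by (intro sets.countable_INT) auto

lemma always_above_iff:
  assumes w: "\<omega> \<in> space M"
  shows "\<omega> \<in> always_above y \<longleftrightarrow> (\<forall>t\<ge>0. - y \<le> V t \<omega>)"
proof
  assume a: "\<omega> \<in> always_above y"
  show "\<forall>t\<ge>0. - y \<le> V t \<omega>"
  proof (intro allI impI)
    fix t :: real assume t: "t \<ge> 0"
    define k where "k n = nat (\<lfloor>2 ^ n * t\<rfloor> + 1)" for n :: nat
    have kr: "real (k n) = of_int \<lfloor>2 ^ n * t\<rfloor> + 1" for n
      unfolding k_def using t by (subst of_nat_nat) auto
    have lt: "t < real (k n) * (1 / 2 ^ n)" for n
    proof -
      have "2 ^ n * t < real (k n)" unfolding kr using real_of_int_floor_add_one_gt[of "2 ^ n * t"] by simp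
      then show ?thesis by (simp add: field_simps)
    qed
    have le: "real (k n) * (1 / 2 ^ n) \<le> t + (1 / 2) ^ n" for n
    proof -
      have "real (k n) \<le> 2 ^ n * t + 1" unfolding kr by simp
      then show ?thesis by (simp add: field_simps power_divide)
    qed
    have "(\<lambda>n. real (k n) * (1 / 2 ^ n)) \<longlonglongrightarrow> t"
    proof (rule tendsto_sandwich[OF _ _ tendsto_const])
      have "(\<lambda>n. t + (1 / 2 :: real) ^ n) \<longlonglongrightarrow> t + 0"
        by (intro tendsto_intros LIMSEQ_realpow_zero) auto
      then show "(\<lambda>n. t + (1 / 2 :: real) ^ n) \<longlonglongrightarrow> t" by simp
    qed (use less_imp_le[OF lt] le in simp_all)
    then have "(\<lambda>n. V (real (k n) * (1 / 2 ^ n)) \<omega>) \<longlonglongrightarrow> V t \<omega>"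
      using cadlag_tendsto_from_right[where u="\<lambda>n. real (k n) * (1 / 2 ^ n)", OF V_cadlag[OF w] t lt] by blast
    moreover have "- y \<le> V (real (k n) * (1 / 2 ^ n)) \<omega>" for n
      using a by (simp add: always_above_def grid_above_def)
    ultimately show "- y \<le> V t \<omega>" by (intro LIMSEQ_le_const) auto
  qed
next
  assume "\<forall>t\<ge>0. - y \<le> V t \<omega>"
  then show "\<omega> \<in> always_above y" using w by (simp add: always_above_def grid_above_def)
qed

lemma exp_le_always_above:
  assumes y: "y \<ge> 0"
  shows "prob (exp_le c) * prob (always_above y) \<le> prob (exp_le c \<inter> always_above y)"
proof (rule LIMSEQ_le_const)
  have dec: "grid_above y (1 / 2 ^ Suc n) \<subseteq> grid_above y (1 / 2 ^ n)" for n
  proof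
    fix \<omega> assume w: "\<omega> \<in> grid_above y (1 / 2 ^ Suc n)"
    have "- y \<le> V (real k * (1 / 2 ^ n)) \<omega>" for k :: nat
    proof -
      have "- y \<le> V (real (2 * k) * (1 / 2 ^ Suc n)) \<omega>" using w by (simp only: grid_above_def mem_Collect_eq)
      moreover have "real (2 * k) * (1 / 2 ^ Suc n) = real k * (1 / 2 ^ n)" by simp
      ultimately show ?thesis by (simp only:)
    qed
    then show "\<omega> \<in> grid_above y (1 / 2 ^ n)" using w unfolding grid_above_def by blast
  qed
  have "(\<lambda>n. prob (exp_le c \<inter> grid_above y (1 / 2 ^ n))) \<longlonglongrightarrow> prob (\<Inter>n. exp_le c \<inter> grid_above y (1 / 2 ^ n))"
  proof (rule finite_Lim_measure_decseq)
    show "range (\<lambda>n. exp_le c \<inter> grid_above y (1 / 2 ^ n)) \<subseteq> sets M"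
      using exp_le_sets grid_above_sets by auto
    show "decseq (\<lambda>n. exp_le c \<inter> grid_above y (1 / 2 ^ n))"
      by (rule decseq_SucI) (use dec in blast)
  qed
  moreover have "(\<Inter>n. exp_le c \<inter> grid_above y (1 / 2 ^ n)) = exp_le c \<inter> always_above y"
    by (auto simp: always_above_def)
  ultimately show "(\<lambda>n. prob (exp_le c \<inter> grid_above y (1 / 2 ^ n))) \<longlonglongrightarrow> prob (exp_le c \<inter> always_above y)"
    by simp
  have "prob (exp_le c) * prob (always_above y) \<le> prob (exp_le c \<inter> grid_above y (1 / 2 ^ n))" for n
  proof -
    have "always_above y \<subseteq> grid_above y (1 / 2 ^ n)" by (auto simp: always_above_def)
    then have "prob (always_above y) \<le> prob (grid_above y (1 / 2 ^ n))"
      by (intro finite_measure_mono grid_above_sets) auto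
    then have "prob (exp_le c) * prob (always_above y) \<le> prob (exp_le c) * prob (grid_above y (1 / 2 ^ n))"
      by (intro mult_left_mono) auto
    also have "\<dots> \<le> prob (exp_le c \<inter> grid_above y (1 / 2 ^ n))"
      using y by (intro exp_le_grid_above) auto
    finally show ?thesis .
  qed
  then show "\<exists>N. \<forall>n\<ge>N. prob (exp_le c) * prob (always_above y) \<le> prob (exp_le c \<inter> grid_above y (1 / 2 ^ n))" by blast
qed

lemma always_above_forever_pos:
  assumes "y < z"
  shows "always_above y \<subseteq> forever_pos z"
proof
  fix \<omega> assume w: "\<omega> \<in> always_above y"
  have wM: "\<omega> \<in> space M" using w by (auto simp: always_above_def grid_above_def)
  have "stays_pos (real n) (\<lambda>s. z + V s \<omega>)" for n :: nat
    unfolding stays_pos_def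
  proof (intro exI[of _ "z - y"] conjI ballI)
    fix s assume "s \<in> {0..real n}"
    then have "- y \<le> V s \<omega>" using w always_above_iff[OF wM] by simp
    then show "z - y \<le> z + V s \<omega>" by simp
  qed (use assms in simp)
  then show "\<omega> \<in> forever_pos z" using wM by (auto simp: forever_pos_def survival_def)
qed

text \<open>
  The grid argument only sees the event \<open>inf V \<ge> -y\<close>; the drift makes it increase to
  \<open>inf V > -z\<close> as \<open>y\<close> increases to \<open>z\<close>.
\<close>

lemma exp_le_forever_pos:
  assumes z: "z > 0" and drift: "AE \<omega> in M. filterlim (\<lambda>t. V t \<omega>) at_top at_top"
  shows "prob (exp_le c) * prob (forever_pos z) \<le> prob (exp_le c \<inter> forever_pos z)"
proof (rule LIMSEQ_le_const2)
  \<comment> \<open>Levels strictly below \<open>z\<close>: the gap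
    \<open>z - y n = z / Suc n\<close> supplies the positive margin that
    \<open>forever_pos z\<close> demands.\<close>
  define y where "y n = z * (1 - 1 / real (Suc n))" for n
  have y: "0 \<le> y n" "y n < z" for n using z by (auto simp: y_def)
  have ymono: "y m \<le> y n" if "m \<le> n" for m n
    unfolding y_def using z that by (intro mult_left_mono diff_left_mono) (auto simp: frac_le)
  have "(\<lambda>n. prob (always_above (y n))) \<longlonglongrightarrow> prob (\<Union>n. always_above (y n))"
  proof (rule finite_Lim_measure_incseq)
    show "range (\<lambda>n. always_above (y n)) \<subseteq> sets M" using always_above_sets by auto
    show "incseq (\<lambda>n. always_above (y n))"
    proof (rule incseq_SucI)
      fix n
      show "always_above (y n) \<subseteq> always_above (y (Suc n))"
      proof
        fix \<omega> assume w: "\<omega> \<in> always_above (y n)"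
        have wM: "\<omega> \<in> space M" using w by (auto simp: always_above_def grid_above_def)
        have "- y (Suc n) \<le> - y n" using ymono[of n "Suc n"] by simp
        then show "\<omega> \<in> always_above (y (Suc n))" using w unfolding always_above_iff[OF wM] by (meson order.trans)
      qed
    qed
  qed
  also have "prob (\<Union>n. always_above (y n)) = prob (forever_pos z)"
  proof (rule finite_measure_eq_AE)
    show "AE \<omega> in M. \<omega> \<in> (\<Union>n. always_above (y n)) \<longleftrightarrow> \<omega> \<in> forever_pos z"
      using drift AE_space
    proof eventually_elim
      fix \<omega> assume lim: "filterlim (\<lambda>t. V t \<omega>) at_top at_top" and wM: "\<omega> \<in> space M"
      show "\<omega> \<in> (\<Union>n. always_above (y n)) \<longleftrightarrow> \<omega> \<in> forever_pos z"
      proof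
        assume "\<omega> \<in> forever_pos z"
        then have sp: "stays_pos (real n) (\<lambda>s. z + V s \<omega>)" for n :: nat by (simp add: forever_pos_def survival_def)
        from lim have "eventually (\<lambda>t. 0 \<le> V t \<omega>) at_top" by (auto simp: filterlim_at_top)
        then obtain T0 where T0: "\<And>t. t \<ge> T0 \<Longrightarrow> 0 \<le> V t \<omega>" unfolding eventually_at_top_linorder by blast
        obtain m :: nat where m: "T0 \<le> real m" using real_arch_simple by blast
        obtain e where e: "e > 0" "\<And>s. s \<in> {0..real m} \<Longrightarrow> e \<le> z + V s \<omega>"
          using sp[of m] unfolding stays_pos_def by blast
        \<comment> \<open>After time \<open>m\<close> the path is nonnegative and so above every
          \<open>- y n\<close>. Before \<open>m\<close> it has margin \<open>e\<close>, and
          \<open>n\<close> is chosen so that \<open>z / Suc n\<close> does not exceed this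
          margin.\<close>
        have "0 < min e z / z" using e z by simp
        then obtain n where n: "1 / real (Suc n) < min e z / z" using nat_approx_posE by blast
        have "z * (1 / real (Suc n)) \<le> z * (min e z / z)" using n z by (intro mult_left_mono) auto
        then have ez: "z * (1 / real (Suc n)) \<le> min e z" using z by simp
        have "- y n \<le> V t \<omega>" if t: "t \<ge> 0" for t
        proof (cases "t \<le> real m")
          case True
          then have "e \<le> z + V t \<omega>" using t by (intro e(2)) simp
          then show ?thesis using ez unfolding y_def right_diff_distrib by linarith
        next
          case False
          then have "0 \<le> V t \<omega>" using m by (intro T0) simp
          then show ?thesis using y(1)[of n] by linarith
        qed
        then have "\<omega> \<in> always_above (y n)" unfolding always_above_iff[OF wM] by blast
        then show "\<omega> \<in> (\<Union>n. always_above (y n))" by blast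
      qed (use always_above_forever_pos[OF y(2)] in blast)
    qed
  qed (use always_above_sets forever_pos_sets in auto)
  finally show "(\<lambda>n. prob (exp_le c) * prob (always_above (y n))) \<longlonglongrightarrow> prob (exp_le c) * prob (forever_pos z)"
    by (intro tendsto_mult tendsto_const)
  have "prob (exp_le c) * prob (always_above (y n)) \<le> prob (exp_le c \<inter> forever_pos z)" for n
  proof -
    have "prob (exp_le c) * prob (always_above (y n)) \<le> prob (exp_le c \<inter> always_above (y n))"
      by (rule exp_le_always_above[OF y(1)])
    also have "\<dots> \<le> prob (exp_le c \<inter> forever_pos z)"
      using always_above_forever_pos[OF y(2)[of n]] exp_le_sets forever_pos_sets by (intro finite_measure_mono) auto
    finally show ?thesis .
  qed
  then show "\<exists>N. \<forall>n\<ge>N. prob (exp_le c) * prob (always_above (y n)) \<le> prob (exp_le c \<inter> forever_pos z)" by blast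
qed

end

section \<open>Restarting after passage above a level\<close>

definition path_stays_above :: "real \<Rightarrow> (real \<Rightarrow> real) set" where
  "path_stays_above y = {g\<in>space path_space. \<forall>n::nat. stays_pos_rat (real n) (\<lambda>u. y + g u)}"

lemma path_stays_above_sets: "path_stays_above y \<in> sets path_space"
  unfolding path_stays_above_def
  by (intro sets_Collect_pred pred_intros_countable stays_pos_rat_measurable borel_measurable_add borel_measurable_const
      measurable_path_component) auto

lemma path_exp_set: "T > 0 \<Longrightarrow> {g\<in>space path_space. path_exp_integral T g \<le> c} \<in> sets path_space"
  by (rule borel_measurable_le[OF path_exp_integral_measurable borel_measurable_const])
    (auto intro: measurable_path_component)

context levy begin

lemma future_path_stays_above:
  assumes w: "\<omega> \<in> space M" and s: "s \<ge> 0"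
  shows "future_path s \<omega> \<in> path_stays_above y \<longleftrightarrow> (\<forall>n::nat. stays_pos (real n) (\<lambda>u. y + (V (s + u) \<omega> - V s \<omega>)))"
proof -
  have "stays_pos_rat (real n) (\<lambda>u. y + future_path s \<omega> u) \<longleftrightarrow> stays_pos (real n) (\<lambda>u. y + (V (s + u) \<omega> - V s \<omega>))" for n :: nat
  proof -
    have "stays_pos_rat (real n) (\<lambda>u. y + future_path s \<omega> u) \<longleftrightarrow> stays_pos_rat (real n) (\<lambda>u. y + (V (s + u) \<omega> - V s \<omega>))"
      by (rule stays_pos_rat_cong) (simp_all add: future_path_def)
    also have "\<dots> \<longleftrightarrow> stays_pos (real n) (\<lambda>u. y + (V (s + u) \<omega> - V s \<omega>))"
    proof (rule stays_pos_rat_iff)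
      show "cadlag (\<lambda>u. y + (V (s + u) \<omega> - V s \<omega>))"
        using cadlag_shift[OF V_cadlag[OF w] s, of "y - V s \<omega>"] by (simp add: algebra_simps)
    qed simp
    finally show ?thesis .
  qed
  then show ?thesis unfolding path_stays_above_def
    using measurable_space[OF future_path_measurable[OF s] w] by simp
qed

lemma forever_pos_future: "{\<omega>\<in>space M. future_path 0 \<omega> \<in> path_stays_above y} = forever_pos y"
  unfolding forever_pos_def survival_def using future_path_stays_above[of _ 0 y] by (auto simp: start)

text \<open>Disjoint in \<open>k\<close> and determined by the path up to the fixed time
  \<open>k * d\<close>: a substitute for a stopping time to which the Markov property at
  deterministic times applies.\<close>

definition passage :: "real \<Rightarrow> real \<Rightarrow> real \<Rightarrow> nat \<Rightarrow> 'a set" where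
  "passage z y d k = survival (real k * d) z \<inter> {\<omega>\<in>space M. (\<forall>j<k. z + V (real j * d) \<omega> < y) \<and> y \<le> z + V (real k * d) \<omega>}"

definition passage_path :: "real \<Rightarrow> real \<Rightarrow> real \<Rightarrow> nat \<Rightarrow> (real \<Rightarrow> real) set" where
  "passage_path z y d k = {g\<in>space path_space. (\<forall>j\<in>{..k}. g (real j * d) \<in> (if j < k then {..< y - z} else {y - z..})) \<and>
     stays_pos_rat (real k * d) (\<lambda>u. z + g u)}"

lemma passage_path_sets:
  assumes d: "d \<ge> 0"
  shows "passage_path z y d k \<in> sets path_space"
proof -
  have kd: "0 \<le> real k * d" using d by simp
  have "Measurable.pred path_space (\<lambda>g. \<forall>j\<in>{..k}. g (real j * d) \<in> (if j < k then {..< y - z} else {y - z..}))"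
    unfolding pred_def by (rule grid_sets[OF d]) simp
  moreover have "Measurable.pred path_space (\<lambda>g. stays_pos_rat (real k * d) (\<lambda>u. z + g u))"
    by (rule stays_pos_rat_measurable[OF kd]) (intro borel_measurable_add borel_measurable_const measurable_path_component)
  ultimately show ?thesis unfolding passage_path_def by (intro sets_Collect_pred pred_intros_logic(3))
qed

lemma passage_iff:
  assumes d: "d \<ge> 0"
  shows "passage z y d k = {\<omega>\<in>space M. past_path (real k * d) \<omega> \<in> passage_path z y d k}"
proof -
  have kd: "0 \<le> real k * d" using d by simp
  have "past_path (real k * d) \<omega> \<in> passage_path z y d k \<longleftrightarrow> \<omega> \<in> passage z y d k" if w: "\<omega> \<in> space M" for \<omega>
  proof -
    have "stays_pos_rat (real k * d) (\<lambda>u. z + past_path (real k * d) \<omega> u) \<longleftrightarrow> stays_pos_rat (real k * d) (\<lambda>u. z + V u \<omega>)"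
      by (rule stays_pos_rat_cong[OF kd]) (simp add: past_path_def)
    then have "stays_pos_rat (real k * d) (\<lambda>u. z + past_path (real k * d) \<omega> u) \<longleftrightarrow> \<omega> \<in> survival (real k * d) z"
      unfolding survival_rat[OF kd] using w by simp
    moreover have "(\<forall>j\<in>{..k}. past_path (real k * d) \<omega> (real j * d) \<in> (if j < k then {..< y - z} else {y - z..})) \<longleftrightarrow>
      (\<forall>j\<in>{..k}. V (real j * d) \<omega> \<in> (if j < k then {..< y - z} else {y - z..}))"
      using past_path_grid[OF d] by simp
    moreover have "(\<forall>j\<in>{..k}. V (real j * d) \<omega> \<in> (if j < k then {..< y - z} else {y - z..})) \<longleftrightarrow>
      (\<forall>j<k. z + V (real j * d) \<omega> < y) \<and> y \<le> z + V (real k * d) \<omega>"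
    proof -
      have "{..k} = insert k {..<k}" by auto
      then show ?thesis by (auto simp: algebra_simps)
    qed
    ultimately show ?thesis
      unfolding passage_path_def passage_def using w measurable_space[OF past_path_measurable[OF kd] w] by blast
  qed
  moreover have "passage z y d k \<subseteq> space M" unfolding passage_def by blast
  ultimately show ?thesis by blast
qed

lemma passage_sets:
  assumes d: "d \<ge> 0" shows "passage z y d k \<in> sets M"
proof -
  have "passage z y d k = past_path (real k * d) -` passage_path z y d k \<inter> space M" unfolding passage_iff[OF d] by auto
  then show ?thesis using measurable_sets[OF past_path_measurable passage_path_sets[OF d]] d by simp
qed

lemma passage_disjoint: "disjoint_family (passage z y d)"
  unfolding disjoint_family_on_def
proof (intro ballI impI)
  fix i j :: nat assume "i \<noteq> j"
  then consider "i < j" | "j < i" by linarith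
  then show "passage z y d i \<inter> passage z y d j = {}" by cases (force simp: passage_def)+
qed

lemma passage_future_prob:
  assumes d: "d \<ge> 0" and C: "C \<in> sets path_space"
  shows "{\<omega>\<in>passage z y d k. future_path (real k * d) \<omega> \<in> C} \<in> sets M"
    and "prob {\<omega>\<in>passage z y d k. future_path (real k * d) \<omega> \<in> C} =
      prob (passage z y d k) * prob {\<omega>\<in>space M. future_path 0 \<omega> \<in> C}"
proof -
  let ?Q = "{\<omega>\<in>passage z y d k. future_path (real k * d) \<omega> \<in> C}"
  have kd: "0 \<le> real k * d" using d by simp
  have e: "?Q = passage z y d k \<inter> (future_path (real k * d) -` C \<inter> space M)"
    using sets.sets_into_space[OF passage_sets[OF d]] by blast
  show "?Q \<in> sets M"
    unfolding e using passage_sets[OF d] measurable_sets[OF future_path_measurable[OF kd] C] by blast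
  have "?Q =
    {\<omega>\<in>space M. past_path (real k * d) \<omega> \<in> passage_path z y d k \<and> future_path (real k * d) \<omega> \<in> C}"
    unfolding passage_iff[OF d] by blast
  then show "prob ?Q =
      prob (passage z y d k) * prob {\<omega>\<in>space M. future_path 0 \<omega> \<in> C}"
    using markov_prob[OF kd passage_path_sets[OF d, of z y k] C] passage_iff[OF d, of z y k] by simp
qed

lemma sums_passage:
  assumes d: "d \<ge> 0"
  shows "(\<lambda>k. prob (passage z y d k)) sums prob (\<Union>k. passage z y d k)"
  by (rule finite_measure_UNION) (use passage_sets[OF d] passage_disjoint in auto)

text \<open>A path above \<open>y\<close> whose increments stay above \<open>-y\<close> remains positive.\<close>

lemma forever_pos_ge_passage:
  assumes d: "d \<ge> 0"
  shows "prob (\<Union>k. passage z y d k) * prob (forever_pos y) \<le> prob (forever_pos z)"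
proof -
  define D where "D k = {\<omega>\<in>passage z y d k. future_path (real k * d) \<omega> \<in> path_stays_above y}" for k
  have D: "D k \<in> sets M" "prob (D k) = prob (passage z y d k) * prob (forever_pos y)" for k
    unfolding D_def passage_future_prob(2)[OF d path_stays_above_sets] forever_pos_future
    using passage_future_prob(1)[OF d path_stays_above_sets] by simp_all
  have "disjoint_family D"
    using passage_disjoint unfolding D_def disjoint_family_on_def by blast
  then have s: "(\<lambda>k. prob (D k)) sums prob (\<Union>k. D k)"
    using D by (intro finite_measure_UNION) auto
  have "D k \<subseteq> forever_pos z" for k
  proof
    fix \<omega> assume w: "\<omega> \<in> D k"
    define s where "s = real k * d"
    have s0: "0 \<le> s" using d by (simp add: s_def)
    have wM: "\<omega> \<in> space M" and surv: "stays_pos s (\<lambda>u. z + V u \<omega>)" and ge: "y \<le> z + V s \<omega>"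
      using w by (auto simp: D_def passage_def survival_def s_def)
    have fut: "stays_pos (real n) (\<lambda>u. y + (V (s + u) \<omega> - V s \<omega>))" for n :: nat
      using w future_path_stays_above[OF wM s0, of y] unfolding D_def s_def by blast
    have "stays_pos (real n) (\<lambda>u. z + V u \<omega>)" for n :: nat
    proof -
      obtain e where e: "e > 0" "\<And>u. u \<in> {0..real n} \<Longrightarrow> e \<le> y + (V (s + u) \<omega> - V s \<omega>)"
        using fut[of n] unfolding stays_pos_def by blast
      have "e \<le> z + V (s + u) \<omega>" if "u \<in> {0..real n}" for u using e(2)[OF that] ge by linarith
      then have "stays_pos (real n) (\<lambda>u. z + V (s + u) \<omega>)" unfolding stays_pos_def using e(1) by blast
      then have "stays_pos (s + real n) (\<lambda>u. z + V u \<omega>)" using stays_pos_add[OF s0] surv by simp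
      then show ?thesis by (rule stays_pos_mono) (use s0 in simp)
    qed
    then show "\<omega> \<in> forever_pos z" using wM by (simp add: forever_pos_def survival_def)
  qed
  then have "prob (\<Union>k. D k) \<le> prob (forever_pos z)"
    by (intro finite_measure_mono forever_pos_sets) blast
  moreover have "prob (\<Union>k. D k) = prob (\<Union>k. passage z y d k) * prob (forever_pos y)"
    by (rule sums_unique2[OF s]) (unfold D(2), rule sums_mult2[OF sums_passage[OF d]])
  ultimately show ?thesis by simp
qed

text \<open>The time limit \<open>R\<close> leaves room for the restarted path inside the horizon of
  the functional, and the height limit \<open>2 * y\<close> bounds the factor lost at the
  restart.\<close>

definition good_passage :: "real \<Rightarrow> real \<Rightarrow> real \<Rightarrow> real \<Rightarrow> 'a set" where
  "good_passage z y R d = {\<omega>\<in>space M. \<exists>k::nat. real k * d \<le> R \<and> (\<forall>j<k. z + V (real j * d) \<omega> < y) \<and>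
      y \<le> z + V (real k * d) \<omega> \<and> z + V (real k * d) \<omega> \<le> 2 * y}"

definition exp_event :: "real \<Rightarrow> real \<Rightarrow> real \<Rightarrow> 'a set" where
  "exp_event T c z = {\<omega>\<in>space M. exp_integral T (\<lambda>t. z + V t \<omega>) \<le> c}"

lemma exp_event_sets: "T > 0 \<Longrightarrow> exp_event T c z \<in> sets M"
  unfolding exp_event_def
  by (intro borel_measurable_le[OF exp_integral_measurable borel_measurable_const] borel_measurable_add
      borel_measurable_const V_measurable V_add_cadlag)

lemma good_passage_sets:
  assumes d: "d \<ge> 0"
  shows "good_passage z y R d \<in> sets M"
proof -
  have [measurable]: "V (real j * d) \<in> borel_measurable M" for j :: nat using d by simp
  show ?thesis unfolding good_passage_def by measurable
qed

text \<open>After a good passage the restarted functional is at most \<open>exp (2 * y) * c\<close>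
  and independent of the passage; summation over \<open>k\<close> yields the probability of some
  passage as a factor. \<open>forever_pos_ge_passage\<close> trades this factor for
  \<open>prob (forever_pos z)\<close> at the price of \<open>prob (forever_pos y)\<close>, which
  does not involve \<open>z\<close>.\<close>

lemma good_passage_bound:
  assumes d: "d \<ge> 0" and T': "T' > 0" and T: "R + T' \<le> T"
  shows "prob (exp_event T c z \<inter> forever_pos z \<inter> good_passage z y R d) * prob (forever_pos y) \<le>
    prob (forever_pos z) * prob (exp_event T' (exp (2 * y) * c) 0)"
proof -
  define C where "C = {g\<in>space path_space. path_exp_integral T' g \<le> exp (2 * y) * c}"
  have C: "C \<in> sets path_space" unfolding C_def by (rule path_exp_set[OF T'])
  have C0: "{\<omega>\<in>space M. future_path 0 \<omega> \<in> C} = exp_event T' (exp (2 * y) * c) 0"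
    unfolding exp_event_def C_def
    using path_exp_integral_future[OF _ _ T', of _ 0] measurable_space[OF future_path_measurable[of 0]] by (auto simp: start)
  define D where "D k = {\<omega>\<in>passage z y d k. future_path (real k * d) \<omega> \<in> C}" for k
  have D: "D k \<in> sets M" "prob (D k) = prob (passage z y d k) * prob (exp_event T' (exp (2 * y) * c) 0)" for k
    unfolding D_def passage_future_prob(2)[OF d C] C0 using passage_future_prob(1)[OF d C] by simp_all
  have "disjoint_family D"
    using passage_disjoint unfolding D_def disjoint_family_on_def by blast
  then have s: "(\<lambda>k. prob (D k)) sums prob (\<Union>k. D k)"
    using D by (intro finite_measure_UNION) auto
  have "exp_event T c z \<inter> forever_pos z \<inter> good_passage z y R d \<subseteq> (\<Union>k. D k)"
  proof
    fix \<omega> assume w: "\<omega> \<in> exp_event T c z \<inter> forever_pos z \<inter> good_passage z y R d"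
    then have wM: "\<omega> \<in> space M" and le: "exp_integral T (\<lambda>t. z + V t \<omega>) \<le> c" by (auto simp: exp_event_def)
    obtain k :: nat where k: "real k * d \<le> R" "\<forall>j<k. z + V (real j * d) \<omega> < y" "y \<le> z + V (real k * d) \<omega>" "z + V (real k * d) \<omega> \<le> 2 * y"
      using w by (auto simp: good_passage_def)
    have kd: "0 \<le> real k * d" using d by simp
    have "\<omega> \<in> survival (real k * d) z" using w forever_pos_subset[OF kd] by blast
    then have 1: "\<omega> \<in> passage z y d k" using k wM by (simp add: passage_def)
    have "exp_integral T' (\<lambda>u. V (real k * d + u) \<omega> - V (real k * d) \<omega>) \<le> exp (2 * y) * exp_integral T (\<lambda>u. z + V u \<omega>)"
      using k(1,4) T T' by (intro future_exp_integral_le[OF wM kd]) auto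
    also have "\<dots> \<le> exp (2 * y) * c" using le by simp
    finally have "future_path (real k * d) \<omega> \<in> C"
      unfolding C_def using path_exp_integral_future[OF wM kd T'] measurable_space[OF future_path_measurable[OF kd] wM] by simp
    then show "\<omega> \<in> (\<Union>k. D k)" using 1 by (auto simp: D_def)
  qed
  then have "prob (exp_event T c z \<inter> forever_pos z \<inter> good_passage z y R d) \<le> prob (\<Union>k. D k)"
    using D(1) by (intro finite_measure_mono) auto
  also have "\<dots> = prob (\<Union>k. passage z y d k) * prob (exp_event T' (exp (2 * y) * c) 0)"
    by (rule sums_unique2[OF s]) (unfold D(2), rule sums_mult2[OF sums_passage[OF d]])
  finally have "prob (exp_event T c z \<inter> forever_pos z \<inter> good_passage z y R d) * prob (forever_pos y) \<le>
     (prob (\<Union>k. passage z y d k) * prob (exp_event T' (exp (2 * y) * c) 0)) * prob (forever_pos y)"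
    by (rule mult_right_mono) simp
  also have "\<dots> = (prob (\<Union>k. passage z y d k) * prob (forever_pos y)) * prob (exp_event T' (exp (2 * y) * c) 0)" by simp
  also have "\<dots> \<le> prob (forever_pos z) * prob (exp_event T' (exp (2 * y) * c) 0)"
    by (rule mult_right_mono[OF forever_pos_ge_passage[OF d]]) simp
  finally show ?thesis .
qed

text \<open>The path exceeds \<open>y\<close> by time \<open>S\<close>, and by right-continuity it
  does so on an interval, which every fine grid meets. Absence of positive jumps then limits the
  overshoot at the first grid point where the level is reached.\<close>

lemma eventually_good_passage:
  assumes w: "\<omega> \<in> space M" and zy: "0 < z" "z < y" and c: "c * exp y < S" "0 \<le> S" "S \<le> T"
    and le: "exp_integral T (\<lambda>t. z + V t \<omega>) \<le> c"
    and jump: "\<And>t l. t > 0 \<Longrightarrow> ((\<lambda>s. V s \<omega>) \<longlongrightarrow> l) (at_left t) \<Longrightarrow> V t \<omega> \<le> l"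
  shows "eventually (\<lambda>n. \<omega> \<in> good_passage z y (S + 1) (1 / 2 ^ n)) sequentially"
proof -
  have cad: "cadlag (\<lambda>t. z + V t \<omega>)" by (rule V_add_cadlag[OF w])
  \<comment> \<open>Staying at or below \<open>y\<close> up to time \<open>S\<close> would make the
    functional at least \<open>S * exp (- y) > c\<close>.\<close>
  have "\<exists>t. 0 \<le> t \<and> t \<le> S \<and> y < z + V t \<omega>"
  proof (rule ccontr)
    assume "\<not> (\<exists>t. 0 \<le> t \<and> t \<le> S \<and> y < z + V t \<omega>)"
    then have "S * exp (- y) \<le> exp_integral S (\<lambda>t. z + V t \<omega>)"
      by (intro exp_integral_ge_const[OF cad c(2)]) (auto simp: not_less)
    also have "\<dots> \<le> exp_integral T (\<lambda>t. z + V t \<omega>)" by (rule exp_integral_mono[OF cad c(2,3)])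
    also have "\<dots> \<le> c" by (rule le)
    finally have "S * exp (- y) * exp y \<le> c * exp y" by (rule mult_right_mono) simp
    then show False using c(1) by (simp add: exp_minus field_simps)
  qed
  then obtain t where t: "0 \<le> t" "t \<le> S" "y < z + V t \<omega>" by blast
  obtain d1 where d1: "d1 > 0" "\<And>s. t < s \<Longrightarrow> s < t + d1 \<Longrightarrow> \<bar>z + V s \<omega> - (z + V t \<omega>)\<bar> < z + V t \<omega> - y"
    using cadlag_local_right[OF cad t(1), of "z + V t \<omega> - y"] t(3) by (metis diff_gt_0_iff_gt)
  have above: "y < z + V s \<omega>" if "t < s" "s < t + d1" for s using d1(2)[OF that] by linarith
  have S1: "0 \<le> S + 1" and y0: "0 < y" using c(2) zy by auto
  obtain d2 where d2: "d2 > 0" "\<And>s t. 0 \<le> s \<Longrightarrow> s < t \<Longrightarrow> t \<le> S + 1 \<Longrightarrow> t - s < d2 \<Longrightarrow> V t \<omega> - V s \<omega> < y"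
    using cadlag_no_positive_jumps_oscillation[OF V_cadlag[OF w] S1 y0 jump] by metis
  have "(\<lambda>n. (1 / 2 :: real) ^ n) \<longlonglongrightarrow> 0" by (rule LIMSEQ_realpow_zero) auto
  then have "eventually (\<lambda>n. (1 / 2 :: real) ^ n < min 1 (min d1 d2)) sequentially"
    by (rule order_tendstoD) (use d1(1) d2(1) in simp)
  then show ?thesis
  proof eventually_elim
    fix n assume n: "(1 / 2 :: real) ^ n < min 1 (min d1 d2)"
    define d where "d = (1 / 2 :: real) ^ n"
    have d: "0 < d" "d < 1" "d < d1" "d < d2" using n by (auto simp: d_def)
    have d_eq: "1 / 2 ^ n = d" by (simp add: d_def power_divide)
    \<comment> \<open>A grid point in the interval from \<open>t\<close> to \<open>t + d\<close>,
      strictly after \<open>t\<close>: the path is above \<open>y\<close> there, so the first index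
      is at most \<open>k0\<close> and its time at most \<open>S + 1\<close>.\<close>
    define k0 where "k0 = nat (\<lfloor>t / d\<rfloor> + 1)"
    have kr: "real k0 = of_int \<lfloor>t / d\<rfloor> + 1" unfolding k0_def using t(1) d(1) by (subst of_nat_nat) auto
    have k0: "t < real k0 * d" "real k0 * d \<le> t + d"
      using floor_divide_lower[OF d(1), of t] floor_divide_upper[OF d(1), of t] unfolding kr by (auto simp: algebra_simps)
    have ex: "y \<le> z + V (real k0 * d) \<omega>" using k0 d by (intro less_imp_le[OF above]) auto
    define k where "k = (LEAST k. y \<le> z + V (real k * d) \<omega>)"
    have k1: "y \<le> z + V (real k * d) \<omega>" unfolding k_def
      by (rule LeastI[where P="\<lambda>k. y \<le> z + V (real k * d) \<omega>", OF ex])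
    have k2: "\<forall>j<k. z + V (real j * d) \<omega> < y"
      using not_less_Least[where P="\<lambda>k. y \<le> z + V (real k * d) \<omega>"] unfolding k_def by (meson not_le)
    have "k \<le> k0" unfolding k_def
      by (rule Least_le[where P="\<lambda>k. y \<le> z + V (real k * d) \<omega>", OF ex])
    then have "real k * d \<le> real k0 * d" using d(1) by (intro mult_right_mono) auto
    then have k3: "real k * d \<le> S + 1" using k0(2) t(2) d(2) by linarith
    \<comment> \<open>The path starts at \<open>z < y\<close>, so there is a preceding grid point.
      The path is below \<open>y\<close> there and gains less than \<open>y\<close> over one
      mesh.\<close>
    have "k \<noteq> 0" using k1 zy start[OF w] by (intro notI) simp
    then obtain j where j: "k = Suc j" using not0_implies_Suc by blast
    have jd: "real k * d = real j * d + d" unfolding j by (simp add: distrib_right)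
    have "V (real k * d) \<omega> - V (real j * d) \<omega> < y"
      using d k3 unfolding jd by (intro d2(2)) auto
    moreover have "z + V (real j * d) \<omega> < y" using k2 j by simp
    ultimately have k4: "z + V (real k * d) \<omega> \<le> 2 * y" by linarith
    show "\<omega> \<in> good_passage z y (S + 1) (1 / 2 ^ n)"
      unfolding d_eq good_passage_def using w k1 k2 k3 k4 by blast
  qed
qed

text \<open>The right side of \<open>good_passage_bound\<close> does not depend on the mesh, and
  almost every path of the event has a good passage on all sufficiently fine dyadic grids.\<close>

lemma exp_event_forever_pos_bound:
  assumes zy: "0 < z" "z < y" and c: "c * exp y < S" "0 \<le> S" and T': "T' > 0" and T: "S + 1 + T' \<le> T"
    and jump: "AE \<omega> in M. \<forall>t>0. \<forall>l. ((\<lambda>s. V s \<omega>) \<longlongrightarrow> l) (at_left t) \<longrightarrow> V t \<omega> \<le> l"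
  shows "prob (exp_event T c z \<inter> forever_pos z) * prob (forever_pos y) \<le>
    prob (forever_pos z) * prob (exp_event T' (exp (2 * y) * c) 0)"
proof -
  define E where "E = exp_event T c z \<inter> forever_pos z"
  have E: "E \<in> sets M" unfolding E_def using exp_event_sets[of T c z] forever_pos_sets T T' c(2) by auto
  have G: "good_passage z y (S + 1) (1 / 2 ^ n) \<in> sets M" for n by (rule good_passage_sets) simp
  have "(\<lambda>n. \<integral>\<omega>. indicator (E \<inter> good_passage z y (S + 1) (1 / 2 ^ n)) \<omega> \<partial>M) \<longlonglongrightarrow> (\<integral>\<omega>. (indicator E \<omega> :: real) \<partial>M)"
  proof (rule integral_dominated_convergence[where w="\<lambda>_. 1"])
    show "AE \<omega> in M. (\<lambda>n. indicator (E \<inter> good_passage z y (S + 1) (1 / 2 ^ n)) \<omega> :: real) \<longlonglongrightarrow> indicator E \<omega>"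
      using jump AE_space
    proof eventually_elim
      fix \<omega> assume jump: "\<forall>t>0. \<forall>l. ((\<lambda>s. V s \<omega>) \<longlongrightarrow> l) (at_left t) \<longrightarrow> V t \<omega> \<le> l" and w: "\<omega> \<in> space M"
      show "(\<lambda>n. indicator (E \<inter> good_passage z y (S + 1) (1 / 2 ^ n)) \<omega> :: real) \<longlonglongrightarrow> indicator E \<omega>"
      proof (cases "\<omega> \<in> E")
        case True
        have "eventually (\<lambda>n. \<omega> \<in> good_passage z y (S + 1) (1 / 2 ^ n)) sequentially"
          by (rule eventually_good_passage[OF w zy c, of T]) (use T T' True jump in \<open>auto simp: E_def exp_event_def\<close>)
        then have "eventually (\<lambda>n. indicator (E \<inter> good_passage z y (S + 1) (1 / 2 ^ n)) \<omega> = (indicator E \<omega> :: real)) sequentially"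
          by eventually_elim (simp add: indicator_def)
        then show ?thesis by (rule tendsto_eventually)
      qed (simp add: indicator_def)
    qed
  qed (use E G in \<open>auto simp: indicator_def\<close>)
  then have "(\<lambda>n. prob (E \<inter> good_passage z y (S + 1) (1 / 2 ^ n))) \<longlonglongrightarrow> prob E"
    using E G sets.Int_space_eq2[OF E] by (simp add: sets.Int_space_eq2)
  then have "(\<lambda>n. prob (E \<inter> good_passage z y (S + 1) (1 / 2 ^ n)) * prob (forever_pos y)) \<longlonglongrightarrow> prob E * prob (forever_pos y)"
    by (intro tendsto_mult tendsto_const)
  moreover have "prob (E \<inter> good_passage z y (S + 1) (1 / 2 ^ n)) * prob (forever_pos y) \<le>
      prob (forever_pos z) * prob (exp_event T' (exp (2 * y) * c) 0)" for n
    unfolding E_def by (rule good_passage_bound[OF _ T' T]) simp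
  ultimately show ?thesis unfolding E_def by (intro LIMSEQ_le_const2) auto
qed

end

section \<open>The comparison\<close>

lemma exp_functional_le_Suc_iff:
  assumes g: "cadlag (\<lambda>t. X t \<omega>)" and x: "x \<ge> 0"
  shows "exp_functional X \<omega> \<le> ennreal x \<longleftrightarrow> (\<forall>n::nat. exp_integral (real (Suc n)) (\<lambda>t. X t \<omega>) \<le> x)"
  unfolding exp_functional_le_iff[where X=X, OF g x]
proof safe
  fix n :: nat assume "\<forall>n::nat. exp_integral (real (Suc n)) (\<lambda>t. X t \<omega>) \<le> x"
  moreover have "exp_integral (real n) (\<lambda>t. X t \<omega>) \<le> exp_integral (real (Suc n)) (\<lambda>t. X t \<omega>)"
    by (rule exp_integral_mono[OF g]) auto
  ultimately show "exp_integral (real n) (\<lambda>t. X t \<omega>) \<le> x" by (meson order.trans)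
qed blast

lemma exp_functional_event:
  assumes X: "cadlag_process K X" and x: "x \<ge> 0"
  shows "{\<omega>\<in>space K. exp_functional X \<omega> \<le> ennreal x} =
      {\<omega>\<in>space K. \<forall>n::nat. exp_integral (real (Suc n)) (\<lambda>t. X t \<omega>) \<le> x}"
    and "{\<omega>\<in>space K. exp_integral (real (Suc n)) (\<lambda>t. X t \<omega>) \<le> c} \<in> sets K"
    and "{\<omega>\<in>space K. exp_functional X \<omega> \<le> ennreal x} \<in> sets K"
proof -
  have cad: "cadlag (\<lambda>t. X t \<omega>)" if "\<omega> \<in> space K" for \<omega> using X that by (simp add: cadlag_process_def)
  show eq: "{\<omega>\<in>space K. exp_functional X \<omega> \<le> ennreal x} =
      {\<omega>\<in>space K. \<forall>n::nat. exp_integral (real (Suc n)) (\<lambda>t. X t \<omega>) \<le> x}"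
    using exp_functional_le_Suc_iff[where X=X, OF cad x] by blast
  have *: "{\<omega>\<in>space K. exp_integral (real (Suc n)) (\<lambda>t. X t \<omega>) \<le> c} \<in> sets K" for n c
    by (rule borel_measurable_le[OF exp_integral_measurable borel_measurable_const])
      (use X in \<open>auto simp: cadlag_process_def\<close>)
  then show "{\<omega>\<in>space K. exp_integral (real (Suc n)) (\<lambda>t. X t \<omega>) \<le> c} \<in> sets K" .
  have "Measurable.pred K (\<lambda>\<omega>. \<forall>n::nat. exp_integral (real (Suc n)) (\<lambda>t. X t \<omega>) \<le> x)"
    using * by (intro pred_intros_countable) (simp add: pred_def)
  then show "{\<omega>\<in>space K. exp_functional X \<omega> \<le> ennreal x} \<in> sets K"
    unfolding eq by (rule sets_Collect_pred)
qed

text \<open>The kernels are given in terms of a process that starts at 0 almost surely; this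
  transfers them to a version that does so everywhere.\<close>

lemma killed_law_cong:
  assumes X: "cadlag_process M X" and Y: "cadlag_process M Y" and ae: "AE \<omega> in M. \<forall>t\<ge>0. X t \<omega> = Y t \<omega>" and t: "t \<ge> 0"
  shows "killed_law M X t x = killed_law M Y t x"
proof -
  have sets: "{\<omega>\<in>space M. 0 < (INF s\<in>{0..t}. x + Z s \<omega>)} \<in> sets M" if Z: "cadlag_process M Z" for Z
  proof -
    have cad: "cadlag (\<lambda>s. x + Z s \<omega>)" if "\<omega> \<in> space M" for \<omega>
      using cadlag_shift[of "\<lambda>s. Z s \<omega>" 0 x] Z that by (simp add: cadlag_process_def)
    have "{\<omega>\<in>space M. 0 < (INF s\<in>{0..t}. x + Z s \<omega>)} = {\<omega>\<in>space M. stays_pos_rat t (\<lambda>s. x + Z s \<omega>)}"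
      using stays_pos_iff_INF[OF cad t] stays_pos_rat_iff[OF cad t] by blast
    also have "\<dots> \<in> sets M"
      by (intro sets_Collect_pred stays_pos_rat_measurable[OF t] borel_measurable_add borel_measurable_const)
        (use Z in \<open>simp add: cadlag_process_def\<close>)
    finally show ?thesis .
  qed
  let ?S = "\<lambda>Z. {\<omega>\<in>space M. 0 < (INF s\<in>{0..t}. x + Z s \<omega>)}"
  have m: "(indicator (?S X) :: _ \<Rightarrow> ennreal) \<in> borel_measurable M" "(indicator (?S Y) :: _ \<Rightarrow> ennreal) \<in> borel_measurable M"
    using sets[OF X] sets[OF Y] by (auto intro: borel_measurable_indicator)
  have "AE \<omega> in M. indicator (?S X) \<omega> = (indicator (?S Y) \<omega> :: ennreal)"
    using ae AE_space
  proof eventually_elim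
    fix \<omega> assume eq: "\<forall>t\<ge>0. X t \<omega> = Y t \<omega>" and w: "\<omega> \<in> space M"
    have "(INF s\<in>{0..t}. x + X s \<omega>) = (INF s\<in>{0..t}. x + Y s \<omega>)"
      by (rule INF_cong) (use eq in auto)
    then show "indicator (?S X) \<omega> = (indicator (?S Y) \<omega> :: ennreal)" using w by (simp add: indicator_def)
  qed
  then have d: "density M (indicator (?S X)) = density M (indicator (?S Y))"
    by (rule density_cong[OF m])
  have XY: "(\<lambda>\<omega>. x + X t \<omega>) \<in> borel_measurable M" "(\<lambda>\<omega>. x + Y t \<omega>) \<in> borel_measurable M"
    using X Y t by (auto simp: cadlag_process_def)
  show ?thesis
    unfolding killed_law_def d
  proof (rule distr_cong_AE)
    show "AE \<omega> in density M (indicator (?S Y)). x + X t \<omega> = x + Y t \<omega>"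
      unfolding AE_density[OF m(2)] using ae by eventually_elim (use t in simp)
  qed (use XY in simp_all)
qed

text \<open>\<open>V 0\<close> vanishes only almost surely; this version vanishes everywhere.\<close>

lemma levy_process_start:
  assumes V: "levy_process M V"
  shows "levy_process M (\<lambda>t \<omega>. V t \<omega> - V 0 \<omega>)"
  unfolding levy_process_def
proof (intro conjI allI impI)
  have c: "cadlag_process M V" and z: "AE \<omega> in M. V 0 \<omega> = 0" using V by (auto simp: levy_process_def)
  have m: "V t \<in> borel_measurable M" if "t \<ge> 0" for t using c that by (simp add: cadlag_process_def)
  show "cadlag_process M (\<lambda>t \<omega>. V t \<omega> - V 0 \<omega>)"
    unfolding cadlag_process_def
  proof (intro conjI allI impI ballI)
    show "prob_space M" using c by (simp add: cadlag_process_def)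
    show "(\<lambda>\<omega>. V t \<omega> - V 0 \<omega>) \<in> borel_measurable M" if "t \<ge> 0" for t
      using m[OF that] m[of 0] by simp
    show "cadlag (\<lambda>t. V t \<omega> - V 0 \<omega>)" if "\<omega> \<in> space M" for \<omega>
      using cadlag_shift[of "\<lambda>s. V s \<omega>" 0 "- V 0 \<omega>"] c that by (simp add: cadlag_process_def)
  qed
  show "AE \<omega> in M. V 0 \<omega> - V 0 \<omega> = 0" by simp
  show "prob_space.indep_vars M (\<lambda>_. borel) (\<lambda>i \<omega>. V (t (Suc i)) \<omega> - V 0 \<omega> - (V (t i) \<omega> - V 0 \<omega>)) {..<n}"
    if "0 \<le> t 0 \<and> mono t" for n :: nat and t
    using V that by (simp add: levy_process_def)
  show "distr M borel (\<lambda>\<omega>. V (s + h) \<omega> - V 0 \<omega> - (V s \<omega> - V 0 \<omega>)) = distr M borel (\<lambda>\<omega>. V h \<omega> - V 0 \<omega>)"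
    if "0 \<le> s" "0 \<le> h" for s h
  proof -
    have "distr M borel (\<lambda>\<omega>. V h \<omega> - V 0 \<omega>) = distr M borel (V h)"
      by (rule distr_cong_AE) (use z m[OF that(2)] m[of 0] in auto)
    then show ?thesis using V that by (simp add: levy_process_def)
  qed
qed

context levy begin

lemma exp_event_tendsto: "(\<lambda>n. prob (exp_event (real (Suc n)) c 0)) \<longlonglongrightarrow> prob (exp_le c)"
proof -
  have "(\<lambda>n. prob (exp_event (real (Suc n)) c 0)) \<longlonglongrightarrow> prob (\<Inter>n. exp_event (real (Suc n)) c 0)"
  proof (rule finite_Lim_measure_decseq)
    show "range (\<lambda>n. exp_event (real (Suc n)) c 0) \<subseteq> sets M" using exp_event_sets by auto
    show "decseq (\<lambda>n. exp_event (real (Suc n)) c 0)"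
    proof (rule decseq_SucI, rule subsetI)
      fix n \<omega> assume w: "\<omega> \<in> exp_event (real (Suc (Suc n))) c 0"
      have "exp_integral (real (Suc n)) (\<lambda>t. 0 + V t \<omega>) \<le> exp_integral (real (Suc (Suc n))) (\<lambda>t. 0 + V t \<omega>)"
        by (rule exp_integral_mono[OF V_add_cadlag]) (use w in \<open>auto simp: exp_event_def\<close>)
      then show "\<omega> \<in> exp_event (real (Suc n)) c 0" using w by (simp add: exp_event_def)
    qed
  qed
  moreover have "(\<Inter>n. exp_event (real (Suc n)) c 0) = exp_le c"
    by (auto simp: exp_event_def exp_le_def simp del: of_nat_Suc)
  ultimately show ?thesis by simp
qed

lemma exp_le_subset_exp_event:
  assumes "z \<ge> 0" "T \<ge> 0"
  shows "exp_le c \<subseteq> exp_event T c z"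
proof
  fix \<omega> assume w: "\<omega> \<in> exp_le c"
  then have wM: "\<omega> \<in> space M" by (simp add: exp_le_def)
  obtain n :: nat where n: "T \<le> real n" using real_arch_simple by blast
  have "exp_integral T (\<lambda>t. z + V t \<omega>) = exp (- z) * exp_integral T (\<lambda>t. V t \<omega>)"
    by (rule exp_integral_add_const)
  also have "\<dots> \<le> 1 * exp_integral T (\<lambda>t. V t \<omega>)"
    using assms by (intro mult_right_mono) (auto simp: exp_integral_nonneg)
  also have "\<dots> \<le> exp_integral (real (Suc n)) (\<lambda>t. V t \<omega>)"
    using exp_integral_mono[OF V_cadlag[OF wM] assms(2), of "real (Suc n)"] n by simp
  also have "\<dots> \<le> c" using w by (simp add: exp_le_def)
  finally show "\<omega> \<in> exp_event T c z" using wM by (simp add: exp_event_def)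
qed

end

context conditioned_levy_drift begin

text \<open>The ramp lies between the indicators at its two thresholds. The normalisation
  \<open>prob (forever_pos z)\<close> is kept as a factor, to be cancelled against the same factor
  in the Markov estimates.\<close>

lemma ramp_expectation_bounds:
  assumes z: "z > 0" and T: "T > 0" and ab: "a < b"
  shows "prob (exp_event T a z \<inter> forever_pos z) \<le> (\<integral>\<omega>. ramp a b (exp_integral T (\<lambda>t. U z t \<omega>)) \<partial>N z) * prob (forever_pos z)"
    and "(\<integral>\<omega>. ramp a b (exp_integral T (\<lambda>t. U z t \<omega>)) \<partial>N z) * prob (forever_pos z) \<le> prob (exp_event T b z \<inter> forever_pos z)"
proof -
  have rm: "ramp a b \<in> borel_measurable borel"
    using continuous_on_ramp[OF ab] by (rule borel_measurable_continuous_onI)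
  let ?f = "\<lambda>\<omega>. indicator (forever_pos z) \<omega> * ramp a b (exp_integral T (\<lambda>t. z + V t \<omega>))"
  have "?f \<in> borel_measurable M"
    by (intro borel_measurable_times borel_measurable_indicator forever_pos_sets
      measurable_compose[OF exp_integral_measurable rm] T borel_measurable_add borel_measurable_const V_measurable V_add_cadlag)
  then have int: "integrable M ?f"
    by (intro integrable_const_bound[where B=1] AE_I2) (simp_all add: indicator_def ramp_bounds)
  have E: "exp_event T c z \<inter> forever_pos z \<in> sets M" for c
    using exp_event_sets[OF T] forever_pos_sets by blast
  have i: "integrable M (indicator (exp_event T c z \<inter> forever_pos z) :: _ \<Rightarrow> real)" for c
    using E by (intro integrable_real_indicator) (simp_all add: emeasure_eq_measure)
  have p: "(\<integral>\<omega>. (indicator (exp_event T c z \<inter> forever_pos z) \<omega> :: real) \<partial>M) = prob (exp_event T c z \<inter> forever_pos z)" for c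
    using E[of c] by (simp add: sets.Int_space_eq2)
  show "prob (exp_event T a z \<inter> forever_pos z) \<le> (\<integral>\<omega>. ramp a b (exp_integral T (\<lambda>t. U z t \<omega>)) \<partial>N z) * prob (forever_pos z)"
    unfolding ramp_exp_integral_expectation[OF z T ab] p[symmetric]
    by (rule integral_mono[OF i int]) (simp add: indicator_def exp_event_def ramp_eq_1[OF ab] ramp_bounds)
  show "(\<integral>\<omega>. ramp a b (exp_integral T (\<lambda>t. U z t \<omega>)) \<partial>N z) * prob (forever_pos z) \<le> prob (exp_event T b z \<inter> forever_pos z)"
    unfolding ramp_exp_integral_expectation[OF z T ab] p[symmetric]
  proof (rule integral_mono[OF int i])
    fix \<omega> assume "\<omega> \<in> space M"
    then show "?f \<omega> \<le> indicator (exp_event T b z \<inter> forever_pos z) \<omega>"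
      using ramp_eq_0[OF ab, of "exp_integral T (\<lambda>t. z + V t \<omega>)"] ramp_bounds
      by (cases "exp_integral T (\<lambda>t. z + V t \<omega>) \<le> b") (auto simp: indicator_def exp_event_def)
  qed
qed

end

section \<open>The limit at starting point zero\<close>

locale conditioned_levy_limit = conditioned_levy_drift M V W N U
  for M :: "'a measure" and V W and N :: "real \<Rightarrow> 'b measure" and U +
  assumes U0: "cadlag_process (N 0) (U 0)"
    and weak: "\<And>F. bounded_continuous_functional F \<Longrightarrow>
      ((\<lambda>x. \<integral>\<omega>. F (\<lambda>t. U x t \<omega>) \<partial>N x) \<longlongrightarrow> (\<integral>\<omega>. F (\<lambda>t. U 0 t \<omega>) \<partial>N 0)) (at_right 0)"
    and jump: "AE \<omega> in M. \<forall>t>0. \<forall>l. ((\<lambda>s. V s \<omega>) \<longlongrightarrow> l) (at_left t) \<longrightarrow> V t \<omega> \<le> l"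
begin

definition U0_event :: "nat \<Rightarrow> real \<Rightarrow> 'b set" where
  "U0_event n c = {\<omega>\<in>space (N 0). exp_integral (real (Suc n)) (\<lambda>t. U 0 t \<omega>) \<le> c}"

definition U0_exp_le :: "real \<Rightarrow> 'b set" where
  "U0_exp_le c = {\<omega>\<in>space (N 0). \<forall>n::nat. exp_integral (real (Suc n)) (\<lambda>t. U 0 t \<omega>) \<le> c}"

lemma U0_event_sets: "U0_event n c \<in> sets (N 0)"
  unfolding U0_event_def by (rule exp_functional_event(2)[OF U0, of 0]) simp

lemma U0_ramp_bounds:
  assumes ab: "a < b"
  shows "measure (N 0) (U0_event n a) \<le> (\<integral>\<omega>. ramp a b (exp_integral (real (Suc n)) (\<lambda>t. U 0 t \<omega>)) \<partial>N 0)"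
    and "(\<integral>\<omega>. ramp a b (exp_integral (real (Suc n)) (\<lambda>t. U 0 t \<omega>)) \<partial>N 0) \<le> measure (N 0) (U0_event n b)"
proof -
  interpret N0: prob_space "N 0" using U0 by (simp add: cadlag_process_def)
  have rm: "ramp a b \<in> borel_measurable borel"
    using continuous_on_ramp[OF ab] by (rule borel_measurable_continuous_onI)
  let ?T = "real (Suc n)"
  let ?f = "\<lambda>\<omega>. ramp a b (exp_integral ?T (\<lambda>t. U 0 t \<omega>))"
  have "?f \<in> borel_measurable (N 0)"
    by (rule measurable_compose[OF exp_integral_measurable rm]) (use U0 in \<open>auto simp: cadlag_process_def\<close>)
  then have int: "integrable (N 0) ?f"
    by (intro N0.integrable_const_bound[where B=1] AE_I2) (simp_all add: ramp_bounds)
  have i: "integrable (N 0) (indicator (U0_event n c) :: _ \<Rightarrow> real)" for c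
    using U0_event_sets by (intro integrable_real_indicator) (simp_all add: N0.emeasure_eq_measure)
  have p: "(\<integral>\<omega>. (indicator (U0_event n c) \<omega> :: real) \<partial>N 0) = measure (N 0) (U0_event n c)" for c
    using U0_event_sets[of n c] by (simp add: sets.Int_space_eq2)
  show "measure (N 0) (U0_event n a) \<le> (\<integral>\<omega>. ?f \<omega> \<partial>N 0)"
    unfolding p[symmetric]
    by (rule integral_mono[OF i int]) (simp add: indicator_def U0_event_def ramp_eq_1[OF ab] ramp_bounds del: of_nat_Suc)
  show "(\<integral>\<omega>. ?f \<omega> \<partial>N 0) \<le> measure (N 0) (U0_event n b)"
    unfolding p[symmetric]
  proof (rule integral_mono[OF int i])
    fix \<omega> assume w: "\<omega> \<in> space (N 0)"
    show "?f \<omega> \<le> indicator (U0_event n b) \<omega>"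
    proof (cases "exp_integral ?T (\<lambda>t. U 0 t \<omega>) \<le> b")
      case True
      then show ?thesis using w ramp_bounds by (simp add: U0_event_def del: of_nat_Suc)
    next
      case False
      then have "?f \<omega> = 0" by (intro ramp_eq_0[OF ab]) simp
      then show ?thesis by simp
    qed
  qed
qed

lemma ramp_weak:
  assumes ab: "a < b" and T: "T > 0"
  shows "((\<lambda>z. \<integral>\<omega>. ramp a b (exp_integral T (\<lambda>t. U z t \<omega>)) \<partial>N z) \<longlongrightarrow>
     (\<integral>\<omega>. ramp a b (exp_integral T (\<lambda>t. U 0 t \<omega>)) \<partial>N 0)) (at_right 0)"
  by (rule weak[OF bounded_continuous_functional_ramp[OF ab T]])

text \<open>For a fixed horizon and a threshold \<open>b > c\<close> the estimate holds for every
  \<open>z > 0\<close> and survives the limit in \<open>z\<close>. The gap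
  \<open>b - c = 1 / Suc n\<close> then closes as the horizon \<open>Suc n\<close> grows, in a
  single decreasing sequence of events.\<close>

lemma lower_bound:
  shows "prob (exp_le c) \<le> measure (N 0) (U0_exp_le c)"
proof -
  let ?e = "\<lambda>n \<omega>. exp_integral (real (Suc n)) (\<lambda>t. U 0 t \<omega>)"
  let ?A = "\<lambda>n. U0_event n (c + 1 / real (Suc n))"
  interpret N0: prob_space "N 0" using U0 by (simp add: cadlag_process_def)
  have cad: "cadlag (\<lambda>t. U 0 t \<omega>)" if "\<omega> \<in> space (N 0)" for \<omega> using U0 that by (simp add: cadlag_process_def)
  have *: "prob (exp_le c) \<le> measure (N 0) (U0_event n b)" if b: "c < b" for n b
  proof -
    let ?T = "real (Suc n)"
    let ?R = "\<lambda>z. \<integral>\<omega>. ramp c b (exp_integral ?T (\<lambda>t. U z t \<omega>)) \<partial>N z"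
    have "prob (exp_le c) \<le> ?R z" if z: "z > 0" for z
    proof -
      have "prob (exp_le c) * prob (forever_pos z) \<le> prob (exp_le c \<inter> forever_pos z)"
        using drift by (intro exp_le_forever_pos[OF z]) (simp add: drifts_to_plus_infinity_def)
      also have "\<dots> \<le> prob (exp_event ?T c z \<inter> forever_pos z)"
        using exp_le_subset_exp_event[of z ?T c] z exp_event_sets[of ?T c z] forever_pos_sets
        by (intro finite_measure_mono) auto
      also have "\<dots> \<le> ?R z * prob (forever_pos z)"
        by (rule ramp_expectation_bounds(1)[OF z _ b]) simp
      finally show ?thesis using forever_pos_prob[OF z] by simp
    qed
    then have "eventually (\<lambda>z. prob (exp_le c) \<le> ?R z) (at_right 0)"
      by (auto simp: eventually_at_right_field intro!: exI[of _ 1])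
    then have "prob (exp_le c) \<le> ?R 0"
      by (intro tendsto_lowerbound[OF ramp_weak[OF b]]) auto
    also have "\<dots> \<le> measure (N 0) (U0_event n b)" by (rule U0_ramp_bounds(2)[OF b])
    finally show ?thesis .
  qed
  have "(\<lambda>n. measure (N 0) (?A n)) \<longlonglongrightarrow> measure (N 0) (\<Inter>n. ?A n)"
  proof (rule N0.finite_Lim_measure_decseq)
    show "range (\<lambda>n. ?A n) \<subseteq> sets (N 0)" using U0_event_sets by auto
    show "decseq (\<lambda>n. ?A n)"
    proof (rule decseq_SucI, rule subsetI)
      fix n \<omega> assume w: "\<omega> \<in> U0_event (Suc n) (c + 1 / real (Suc (Suc n)))"
      have "?e n \<omega> \<le> ?e (Suc n) \<omega>"
        by (rule exp_integral_mono[OF cad]) (use w in \<open>auto simp: U0_event_def\<close>)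
      moreover have "1 / real (Suc (Suc n)) \<le> 1 / real (Suc n)" by (simp add: frac_le)
      moreover have "?e (Suc n) \<omega> \<le> c + 1 / real (Suc (Suc n))"
        using w unfolding U0_event_def by blast
      moreover have "\<omega> \<in> space (N 0)" using w unfolding U0_event_def by blast
      ultimately show "\<omega> \<in> ?A n" unfolding U0_event_def by (simp del: of_nat_Suc)
    qed
  qed
  then have "prob (exp_le c) \<le> measure (N 0) (\<Inter>n. ?A n)"
    using * by (intro LIMSEQ_le_const) auto
  also have "(\<Inter>n. ?A n) = U0_exp_le c"
  proof (intro equalityI subsetI)
    fix \<omega> assume "\<omega> \<in> (\<Inter>n. ?A n)"
    then have w: "\<omega> \<in> space (N 0)" "\<And>n. ?e n \<omega> \<le> c + 1 / real (Suc n)"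
      unfolding U0_event_def by blast+
    \<comment> \<open>A fixed horizon is compared with all longer ones, whose gaps tend to
      0.\<close>
    have "?e n \<omega> \<le> c" for n
    proof (rule LIMSEQ_le_const)
      show "(\<lambda>m. c + 1 / real (Suc m)) \<longlonglongrightarrow> c"
        using LIMSEQ_inverse_real_of_nat_add[of c] by (simp add: divide_inverse)
      have "?e n \<omega> \<le> c + 1 / real (Suc m)" if "m \<ge> n" for m
      proof -
        have "?e n \<omega> \<le> ?e m \<omega>"
          by (rule exp_integral_mono[OF cad[OF w(1)]]) (use that in auto)
        then show ?thesis using w(2)[of m] by linarith
      qed
      then show "\<exists>k. \<forall>m\<ge>k. ?e n \<omega> \<le> c + 1 / real (Suc m)" by blast
    qed
    then show "\<omega> \<in> U0_exp_le c" using w(1) unfolding U0_exp_le_def by blast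
  next
    fix \<omega> assume w: "\<omega> \<in> U0_exp_le c"
    have "?e n \<omega> \<le> c + 1 / real (Suc n)" for n
    proof -
      have "?e n \<omega> \<le> c" using w unfolding U0_exp_le_def by blast
      moreover have "0 \<le> 1 / real (Suc n)" by simp
      ultimately show ?thesis by linarith
    qed
    then show "\<omega> \<in> (\<Inter>n. ?A n)" using w unfolding U0_exp_le_def U0_event_def by blast
  qed
  finally show ?thesis .
qed

text \<open>The horizon on the conditioned side exceeds that on the side of \<open>V\<close> by at
  least the time reserved for the passage, so for each horizon of \<open>V\<close> a longer one is
  chosen before the limit in \<open>z\<close> is taken. The horizon of \<open>V\<close> tends to
  infinity last.\<close>

lemma upper_bound:
  assumes y: "y > 0" and c: "0 < c" "c < b"
  shows "measure (N 0) (U0_exp_le c) * prob (forever_pos y) \<le> prob (exp_le (exp (2 * y) * b))"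
proof (rule LIMSEQ_le_const[OF exp_event_tendsto])
  interpret N0: prob_space "N 0" using U0 by (simp add: cadlag_process_def)
  have "measure (N 0) (U0_exp_le c) * prob (forever_pos y) \<le> prob (exp_event (real (Suc n)) (exp (2 * y) * b) 0)" for n
  proof -
    let ?q = "prob (exp_event (real (Suc n)) (exp (2 * y) * b) 0)"
    \<comment> \<open>Any time beyond \<open>b * exp y\<close> forces the passage above
      \<open>y\<close>. It does not depend on \<open>z\<close>, so the horizon stays fixed in the
      limit.\<close>
    define S where "S = b * exp y + 1"
    have S: "b * exp y < S" "0 \<le> S" using c by (simp_all add: S_def)
    obtain m :: nat where m: "S + 1 + real (Suc n) \<le> real m" using real_arch_simple by blast
    let ?T = "real (Suc m)"
    let ?R = "\<lambda>z. \<integral>\<omega>. ramp c b (exp_integral ?T (\<lambda>t. U z t \<omega>)) \<partial>N z"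
    have T: "S + 1 + real (Suc n) \<le> ?T" using m by simp
    have "?R z \<le>
        ?q / prob (forever_pos y)" if z: "0 < z" "z < y" for z
    proof -
      have "?R z * prob (forever_pos z) \<le> prob (exp_event ?T b z \<inter> forever_pos z)"
        by (rule ramp_expectation_bounds(2)[OF z(1) _ c(2)]) simp
      then have "?R z * prob (forever_pos z) * prob (forever_pos y)
          \<le> prob (exp_event ?T b z \<inter> forever_pos z) * prob (forever_pos y)"
        by (rule mult_right_mono) simp
      also have "\<dots> \<le> prob (forever_pos z) * ?q"
        by (rule exp_event_forever_pos_bound[OF z S _ T jump]) simp
      \<comment> \<open>The normalisation cancels here, for fixed \<open>z\<close>; only
        \<open>prob (forever_pos y)\<close> is left for the limit.\<close>
      finally have "prob (forever_pos z) * (?R z * prob (forever_pos y))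
          \<le> prob (forever_pos z) * ?q" by (simp only: mult_ac)
      then have "?R z * prob (forever_pos y)
          \<le> ?q"
        using forever_pos_prob[OF z(1)] mult_le_cancel_left_pos by blast
      then show ?thesis using forever_pos_prob[OF y] by (simp only: pos_le_divide_eq)
    qed
    then have "eventually (\<lambda>z. ?R z \<le>
        ?q / prob (forever_pos y)) (at_right 0)"
      unfolding eventually_at_right_field using y by blast
    then have "?R 0 \<le>
        ?q / prob (forever_pos y)"
      by (intro tendsto_upperbound[OF ramp_weak[OF c(2)]]) auto
    moreover have "measure (N 0) (U0_exp_le c) \<le> measure (N 0) (U0_event m c)"
      by (rule N0.finite_measure_mono[OF _ U0_event_sets]) (auto simp: U0_exp_le_def U0_event_def)
    moreover have "measure (N 0) (U0_event m c) \<le> ?R 0"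
      by (rule U0_ramp_bounds(1)[OF c(2)])
    ultimately have "measure (N 0) (U0_exp_le c) \<le> ?q / prob (forever_pos y)"
      by linarith
    then show ?thesis using forever_pos_prob[OF y] by (simp only: pos_le_divide_eq)
  qed
  then show "\<exists>k. \<forall>n\<ge>k. measure (N 0) (U0_exp_le c) * prob (forever_pos y) \<le> prob (exp_event (real (Suc n)) (exp (2 * y) * b) 0)"
    by blast
qed

text \<open>\<open>upper_bound\<close> leaves the denominator \<open>p\<close>, which depends on
  \<open>\<epsilon>\<close> through \<open>y\<close>. Once \<open>x < p / \<epsilon>\<close> it is
  at least \<open>\<epsilon> * x\<close>, so this dependence is hidden in the threshold for
  \<open>x\<close> and the constant 1 serves every \<open>\<epsilon>\<close>.\<close>

lemma exponential_functional_comparison: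
  "\<exists>c>0. \<forall>\<epsilon>>0. \<exists>x\<^sub>0>0. \<forall>x. 0 < x \<and> x < x\<^sub>0 \<longrightarrow>
     prob (exp_le x) \<le> measure (N 0) (U0_exp_le x) \<and>
     measure (N 0) (U0_exp_le x) \<le> prob (exp_le ((1 + \<epsilon>) * x)) / (c * \<epsilon> * x)"
proof (rule exI[of _ 1], intro conjI allI impI)
  fix \<epsilon> :: real assume e: "\<epsilon> > 0"
  \<comment> \<open>Two factors \<open>exp (2 * y)\<close> make up \<open>1 + \<epsilon>\<close>:
    one for the height at the restart, one for the gap between the thresholds \<open>x\<close> and
    \<open>exp (2 * y) * x\<close> of the ramp.\<close>
  define y where "y = ln (1 + \<epsilon>) / 4"
  define p where "p = prob (forever_pos y)"
  have y: "y > 0" using e by (simp add: y_def)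
  have p: "p > 0" unfolding p_def by (rule forever_pos_prob[OF y])
  show "\<exists>x\<^sub>0>0. \<forall>x. 0 < x \<and> x < x\<^sub>0 \<longrightarrow>
     prob (exp_le x) \<le> measure (N 0) (U0_exp_le x) \<and>
     measure (N 0) (U0_exp_le x) \<le> prob (exp_le ((1 + \<epsilon>) * x)) / (1 * \<epsilon> * x)"
  proof (intro exI[of _ "p / \<epsilon>"] conjI allI impI)
    show "0 < p / \<epsilon>" using p e by simp
    fix x assume x: "0 < x \<and> x < p / \<epsilon>"
    show "prob (exp_le x) \<le> measure (N 0) (U0_exp_le x)" by (rule lower_bound)
    have eq: "exp (2 * y) * (exp (2 * y) * x) = (1 + \<epsilon>) * x"
    proof -
      have "exp (2 * y) * exp (2 * y) = exp (ln (1 + \<epsilon>))" unfolding exp_add[symmetric] y_def by simp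
      then show ?thesis using e by (simp flip: mult.assoc)
    qed
    have "x < exp (2 * y) * x" using x y by simp
    from upper_bound[OF y _ this] have "measure (N 0) (U0_exp_le x) * p \<le> prob (exp_le ((1 + \<epsilon>) * x))"
      using x unfolding p_def eq by blast
    moreover have ex: "\<epsilon> * x \<le> p" using x e by (simp add: pos_less_divide_eq mult.commute)
    then have "measure (N 0) (U0_exp_le x) * (\<epsilon> * x) \<le> measure (N 0) (U0_exp_le x) * p"
      by (rule mult_left_mono) simp
    ultimately have "measure (N 0) (U0_exp_le x) * (\<epsilon> * x) \<le> prob (exp_le ((1 + \<epsilon>) * x))" by linarith
    moreover have "0 < \<epsilon> * x" using x e by simp
    ultimately show "measure (N 0) (U0_exp_le x) \<le> prob (exp_le ((1 + \<epsilon>) * x)) / (1 * \<epsilon> * x)"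
      by (simp only: pos_le_divide_eq mult_1)
  qed
qed simp

end

section \<open>Transfer to the given version of the process\<close>

theorem proposition1p10:
  fixes M :: "'a measure" and V :: "real \<Rightarrow> 'a \<Rightarrow> real"
    and \<Psi> W :: "real \<Rightarrow> real"
    and N :: "real \<Rightarrow> 'b measure" and U :: "real \<Rightarrow> real \<Rightarrow> 'b \<Rightarrow> real"
  assumes "spectrally_negative_levy M V"
    and "\<not> subordinator M (\<lambda>t \<omega>. - V t \<omega>)"
    and "drifts_to_plus_infinity M V"
    and "laplace_exponent M V \<Psi>"
    and "scale_function M V \<Psi> W"
    and "conditioned_to_stay_positive M V W N U"
  shows "\<exists>c>0. \<forall>\<epsilon>>0. \<exists>x\<^sub>0>0. \<forall>x. 0 < x \<and> x < x\<^sub>0 \<longrightarrow>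
           measure M {\<omega> \<in> space M. exp_functional V \<omega> \<le> ennreal x}
             \<le> measure (N 0) {\<omega> \<in> space (N 0). exp_functional (U 0) \<omega> \<le> ennreal x} \<and>
           measure (N 0) {\<omega> \<in> space (N 0). exp_functional (U 0) \<omega> \<le> ennreal x}
             \<le> measure M {\<omega> \<in> space M. exp_functional V \<omega> \<le> ennreal ((1 + \<epsilon>) * x)} / (c * \<epsilon> * x)"
proof -
  \<comment> \<open>This version starts at 0 everywhere, as the locale demands. Almost surely the
    entire paths of \<open>X\<close> and \<open>V\<close> coincide, so drift, jumps, killed laws and
    the functional carry over.\<close>
  define X where "X t \<omega> = V t \<omega> - V 0 \<omega>" for t \<omega>
  have levyV: "levy_process M V"
    and jumpV: "AE \<omega> in M. \<forall>t>0. \<forall>l. ((\<lambda>s. V s \<omega>) \<longlongrightarrow> l) (at_left t) \<longrightarrow> V t \<omega> \<le> l"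
    using assms(1) by (auto simp: spectrally_negative_levy_def)
  have levyX: "levy_process M X" unfolding X_def by (rule levy_process_start[OF levyV])
  have cV: "cadlag_process M V" and cX: "cadlag_process M X"
    using levyV levyX by (auto simp: levy_process_def)
  have "AE \<omega> in M. V 0 \<omega> = 0" using levyV by (simp add: levy_process_def)
  then have XV: "AE \<omega> in M. (\<lambda>t. X t \<omega>) = (\<lambda>t. V t \<omega>)"
    by eventually_elim (simp add: X_def)
  then have XV': "AE \<omega> in M. \<forall>t\<ge>0. X t \<omega> = V t \<omega>"
    by eventually_elim meson
  have driftX: "drifts_to_plus_infinity M X"
    using assms(3) XV unfolding drifts_to_plus_infinity_def by (eventually_elim) simp
  have jumpX: "AE \<omega> in M. \<forall>t>0. \<forall>l. ((\<lambda>s. X s \<omega>) \<longlongrightarrow> l) (at_left t) \<longrightarrow> X t \<omega> \<le> l"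
    using jumpV XV
  proof eventually_elim
    fix \<omega> assume j: "\<forall>t>0. \<forall>l. ((\<lambda>s. V s \<omega>) \<longlongrightarrow> l) (at_left t) \<longrightarrow> V t \<omega> \<le> l" and eq: "(\<lambda>t. X t \<omega>) = (\<lambda>t. V t \<omega>)"
    have "X t \<omega> = V t \<omega>" for t using fun_cong[OF eq] .
    then show "\<forall>t>0. \<forall>l. ((\<lambda>s. X s \<omega>) \<longlongrightarrow> l) (at_left t) \<longrightarrow> X t \<omega> \<le> l" using j by simp
  qed
  have kernel: "up_kernel M X W t x = up_kernel M V W t x" if "t \<ge> 0" for t x
    unfolding up_kernel_def killed_law_cong[OF cX cV XV' that] ..
  have up: "markov_process (N x) (U x) {0<..} (up_kernel M X W) x" if "x > 0" for x
  proof -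
    have "markov_process (N x) (U x) {0<..} (up_kernel M V W) x"
      using assms(6) that by (simp add: conditioned_to_stay_positive_def)
    then show ?thesis by (simp add: markov_process_def kernel)
  qed
  interpret conditioned_levy_limit M X W N U
  proof
    show "levy_process M X" by (rule levyX)
    show "X 0 \<omega> = 0" for \<omega> by (simp add: X_def)
    show "0 \<le> W x" if "x \<ge> 0" for x using assms(5) that by (simp add: scale_function_def)
    show "mono_on {0..} W" using assms(5) by (simp add: scale_function_def)
    show "cadlag_process (N 0) (U 0)"
      using assms(6) by (auto simp: conditioned_to_stay_positive_def markov_process_def)
    show "((\<lambda>x. \<integral>\<omega>. F (\<lambda>t. U x t \<omega>) \<partial>N x) \<longlongrightarrow> (\<integral>\<omega>. F (\<lambda>t. U 0 t \<omega>) \<partial>N 0)) (at_right 0)"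
      if "bounded_continuous_functional F" for F
      using assms(6) that by (simp add: conditioned_to_stay_positive_def)
  qed (rule up driftX jumpX; assumption?)+
  have eqV: "measure M {\<omega>\<in>space M. exp_functional V \<omega> \<le> ennreal x} = prob (exp_le x)" if x: "x \<ge> 0" for x
  proof -
    have "measure M {\<omega>\<in>space M. exp_functional V \<omega> \<le> ennreal x} = measure M {\<omega>\<in>space M. exp_functional X \<omega> \<le> ennreal x}"
    proof (rule finite_measure_eq_AE)
      show "AE \<omega> in M. \<omega> \<in> {\<omega>\<in>space M. exp_functional V \<omega> \<le> ennreal x} \<longleftrightarrow> \<omega> \<in> {\<omega>\<in>space M. exp_functional X \<omega> \<le> ennreal x}"
        using XV
      proof eventually_elim
        fix \<omega> assume "(\<lambda>t. X t \<omega>) = (\<lambda>t. V t \<omega>)"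
        then have "X t \<omega> = V t \<omega>" for t by (rule fun_cong)
        then show "\<omega> \<in> {\<omega>\<in>space M. exp_functional V \<omega> \<le> ennreal x} \<longleftrightarrow> \<omega> \<in> {\<omega>\<in>space M. exp_functional X \<omega> \<le> ennreal x}"
          by (simp add: exp_functional_def)
      qed
    qed (use exp_functional_event(3)[OF cV x] exp_functional_event(3)[OF cX x] in simp_all)
    then show ?thesis unfolding exp_functional_event(1)[OF cX x] exp_le_def .
  qed
  have eqU: "measure (N 0) {\<omega>\<in>space (N 0). exp_functional (U 0) \<omega> \<le> ennreal x} = measure (N 0) (U0_exp_le x)" if x: "x \<ge> 0" for x
    unfolding exp_functional_event(1)[OF U0 x] U0_exp_le_def ..
  obtain c where c: "c > 0" and bound: "\<forall>\<epsilon>>0. \<exists>x\<^sub>0>0. \<forall>x. 0 < x \<and> x < x\<^sub>0 \<longrightarrow>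
     prob (exp_le x) \<le> measure (N 0) (U0_exp_le x) \<and>
     measure (N 0) (U0_exp_le x) \<le> prob (exp_le ((1 + \<epsilon>) * x)) / (c * \<epsilon> * x)"
    using exponential_functional_comparison by blast
  show ?thesis
  proof (rule exI[of _ c], intro conjI allI impI)
    show "c > 0" by (rule c)
    fix \<epsilon> :: real assume e: "\<epsilon> > 0"
    obtain x\<^sub>0 where x0: "x\<^sub>0 > 0" and b: "\<forall>x. 0 < x \<and> x < x\<^sub>0 \<longrightarrow>
       prob (exp_le x) \<le> measure (N 0) (U0_exp_le x) \<and>
       measure (N 0) (U0_exp_le x) \<le> prob (exp_le ((1 + \<epsilon>) * x)) / (c * \<epsilon> * x)"
      using bound e by blast
    have "measure M {\<omega> \<in> space M. exp_functional V \<omega> \<le> ennreal x}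
             \<le> measure (N 0) {\<omega> \<in> space (N 0). exp_functional (U 0) \<omega> \<le> ennreal x} \<and>
           measure (N 0) {\<omega> \<in> space (N 0). exp_functional (U 0) \<omega> \<le> ennreal x}
             \<le> measure M {\<omega> \<in> space M. exp_functional V \<omega> \<le> ennreal ((1 + \<epsilon>) * x)} / (c * \<epsilon> * x)"
      if x: "0 < x \<and> x < x\<^sub>0" for x
    proof -
      have "0 \<le> x" "0 \<le> (1 + \<epsilon>) * x" using x e by simp_all
      then show ?thesis using b x by (simp only: eqV eqU)
    qed
    then show "\<exists>x\<^sub>0>0. \<forall>x. 0 < x \<and> x < x\<^sub>0 \<longrightarrow>
       measure M {\<omega> \<in> space M. exp_functional V \<omega> \<le> ennreal x}
             \<le> measure (N 0) {\<omega> \<in> space (N 0). exp_functional (U 0) \<omega> \<le> ennreal x} \<and>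
           measure (N 0) {\<omega> \<in> space (N 0). exp_functional (U 0) \<omega> \<le> ennreal x}
             \<le> measure M {\<omega> \<in> space M. exp_functional V \<omega> \<le> ennreal ((1 + \<epsilon>) * x)} / (c * \<epsilon> * x)"
      using x0 by blast
  qed
qed

end
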